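(* Let $\nu>0$, let $\chi_\omega\in L^\infty(\mathbb{T}^3)$ be nonnegative, let $\mathcal{P}$ be a parameter set, $K:\mathcal{P}\to[0,\infty)$ a bounded map, and $\rho:[0,\infty)\to\mathcal{P}$ a measurable signal. For $\rho_0\in\mathcal{P}$ let $A(\rho_0):=A_0-D_{K(\rho_0)}$ with domain $D(A_0)$, where $A_0=\nu P\Delta$ is the periodic Stokes operator on $H$ and $D_kv:=P(\chi_\omega\,k\,v)$ for $k\ge 0$, $v\in H$. Assume that there is a constant $K_{\max}$ such that, for every $T>0$, the map $t\mapsto K(\rho(t))$ belongs to $W^{1,\infty}(0,T)$ and satisfies $0\le K(\rho(t))\le K_{\max}$ for almost every $t\in(0,T)$. Then the nonautonomous linear system $$\dot u(t)=A(\rho(t))u(t)$$ admits a unique evolution family $(U(t,s))_{t\ge s\ge 0}$ on $H$, and $$\|U(t,s)\|_{\mathcal{L}(H)}\le 1,\qquad\forall t\ge s\ge 0.$$ If moreover there exists $\alpha_\omega>0$ such that $-\langle A(\rho_0)v,v\rangle_H\ge\alpha_\omega\|v\|_H^2$ for all $v\in D(A_0)$ and all $\rho_0\in\mathcal{P}$, then $$\|U(t,s)\|_{\mathcal{L}(H)}\le e^{-\alpha_\omega(t-s)},\qquad\forall t\ge s\ge 0.$$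
   Context: $\mathbb{T}^3=(\mathbb{R}/\mathbb{Z})^3$. $H:=\{v\in L^2(\mathbb{T}^3;\mathbb{R}^3): \nabla\cdot v=0,\ \int_{\mathbb{T}^3}v\,dx=0\}$ with the $L^2$ inner product. $P:L^2(\mathbb{T}^3;\mathbb{R}^3)\to H$ is the orthogonal (Leray) projector onto $H$. The Stokes operator is $A_0:=\nu P\Delta$ with domain $D(A_0):=H^2(\mathbb{T}^3;\mathbb{R}^3)\cap H$. $\mathcal{L}(H)$ denotes the bounded linear operators on $H$. An evolution family for the system is a family $(U(t,s))_{t\ge s\ge 0}\subset\mathcal{L}(H)$ such that $U(s,s)=I$, $U(t,r)U(r,s)=U(t,s)$ for $t\ge r\ge s\ge 0$, $(t,s)\mapsto U(t,s)$ is strongly continuous, and, for every $s\ge 0$ and $u_s\in D(A_0)$, the function $u(t)=U(t,s)u_s$ is a strong solution on $[s,\infty)$: it is continuous with values in $D(A_0)$ (with the graph norm), locally absolutely continuous with values in $H$, and satisfies $\dot u(t)=A(\rho(t))u(t)$ for almost every $t\ge s$ and $u(s)=u_s$. *)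

theory Defs
  imports "HOL-Analysis.Analysis"
begin

text \<open>
  The torus is represented, as a measure space, by its fundamental domain.  Measurable functions on
  the torus are functions on this cube; smooth functions on the torus are smooth functions on the
  whole space that are 1-periodic in every coordinate (see \<open>torus_smooth\<close> below).
\<close>

definition torus :: "(real^3) measure" where
  "torus = lebesgue_on {x. \<forall>i. 0 \<le> x $ i \<and> x $ i < 1}"

definition square_integrable :: "(real^3 \<Rightarrow> real^3) \<Rightarrow> bool" where
  "square_integrable f \<longleftrightarrow>
     f \<in> borel_measurable torus \<and> integrable torus (\<lambda>x. (norm (f x))\<^sup>2)"

lemma square_integrable_inner:
  assumes "square_integrable f" "square_integrable g"
  shows "integrable torus (\<lambda>x. f x \<bullet> g x)"
proof (rule Bochner_Integration.integrable_bound)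
  show "integrable torus (\<lambda>x. (norm (f x))\<^sup>2 + (norm (g x))\<^sup>2)"
    using assms by (auto simp: square_integrable_def)
  show "(\<lambda>x. f x \<bullet> g x) \<in> borel_measurable torus"
    using assms by (auto simp: square_integrable_def)
  show "AE x in torus. norm (f x \<bullet> g x) \<le> norm ((norm (f x))\<^sup>2 + (norm (g x))\<^sup>2)"
  proof (rule AE_I2)
    fix x
    have "\<bar>f x \<bullet> g x\<bar> \<le> norm (f x) * norm (g x)" by (rule Cauchy_Schwarz_ineq2)
    also have "\<dots> \<le> (norm (f x))\<^sup>2 + (norm (g x))\<^sup>2"
      using sum_squares_bound[of "norm (f x)" "norm (g x)"]
        mult_nonneg_nonneg[OF norm_ge_zero[of "f x"] norm_ge_zero[of "g x"]] by linarith
    finally show "norm (f x \<bullet> g x) \<le> norm ((norm (f x))\<^sup>2 + (norm (g x))\<^sup>2)" by simp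
  qed
qed

lemma square_integrable_zero: "square_integrable (\<lambda>x. 0)"
  by (simp add: square_integrable_def)

lemma square_integrable_add:
  assumes "square_integrable f" "square_integrable g"
  shows "square_integrable (\<lambda>x. f x + g x)"
proof -
  have "integrable torus (\<lambda>x. (norm (f x))\<^sup>2 + (norm (g x))\<^sup>2 + 2 * (f x \<bullet> g x))"
    using assms square_integrable_inner[OF assms] by (auto simp: square_integrable_def)
  moreover have "(norm (f x))\<^sup>2 + (norm (g x))\<^sup>2 + 2 * (f x \<bullet> g x) = (norm (f x + g x))\<^sup>2" for x
    by (simp add: power2_norm_eq_inner inner_add inner_commute)
  ultimately show ?thesis using assms by (auto simp: square_integrable_def)
qed

lemma square_integrable_scaleR:
  assumes "square_integrable f"
  shows "square_integrable (\<lambda>x. c *\<^sub>R f x)"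
  using assms by (auto simp: square_integrable_def power_mult_distrib)

definition l2_eq :: "(real^3 \<Rightarrow> real^3) \<Rightarrow> (real^3 \<Rightarrow> real^3) \<Rightarrow> bool" where
  "l2_eq f g \<longleftrightarrow>
     square_integrable f \<and> square_integrable g \<and> (AE x in torus. f x = g x)"

lemma part_equivp_l2_eq: "part_equivp l2_eq"
proof (rule part_equivpI)
  show "\<exists>f. l2_eq f f"
    by (rule exI[of _ "\<lambda>x. 0"]) (simp add: l2_eq_def square_integrable_zero)
  show "symp l2_eq" by (rule sympI) (auto simp: l2_eq_def)
  show "transp l2_eq" by (rule transpI) (auto simp: l2_eq_def)
qed

quotient_type l2_field = "real^3 \<Rightarrow> real^3" / partial: l2_eq
  by (rule part_equivp_l2_eq)

instantiation l2_field :: real_inner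
begin

lift_definition zero_l2_field :: l2_field is "\<lambda>x. 0"
  by (simp add: l2_eq_def square_integrable_zero)

lift_definition plus_l2_field :: "l2_field \<Rightarrow> l2_field \<Rightarrow> l2_field" is "\<lambda>f g x. f x + g x"
  by (auto simp: l2_eq_def intro: square_integrable_add)

lift_definition scaleR_l2_field :: "real \<Rightarrow> l2_field \<Rightarrow> l2_field" is "\<lambda>c f x. c *\<^sub>R f x"
  by (auto simp: l2_eq_def intro: square_integrable_scaleR)

definition uminus_l2_field :: "l2_field \<Rightarrow> l2_field" where
  "uminus_l2_field v = (-1) *\<^sub>R v"

definition minus_l2_field :: "l2_field \<Rightarrow> l2_field \<Rightarrow> l2_field" where
  "minus_l2_field v w = v + (-1) *\<^sub>R w"

lift_definition inner_l2_field :: "l2_field \<Rightarrow> l2_field \<Rightarrow> real"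
  is "\<lambda>f g. integral\<^sup>L torus (\<lambda>x. f x \<bullet> g x)"
  by (rule integral_cong_AE) (auto simp: l2_eq_def square_integrable_def)

definition norm_l2_field :: "l2_field \<Rightarrow> real" where
  "norm_l2_field v = sqrt (v \<bullet> v)"

definition dist_l2_field :: "l2_field \<Rightarrow> l2_field \<Rightarrow> real" where
  "dist_l2_field v w = norm (v - w)"

definition sgn_l2_field :: "l2_field \<Rightarrow> l2_field" where
  "sgn_l2_field v = inverse (norm v) *\<^sub>R v"

definition uniformity_l2_field :: "(l2_field \<times> l2_field) filter" where
  "uniformity_l2_field = (INF e\<in>{0<..}. principal {(v, w). dist v w < e})"

definition open_l2_field :: "l2_field set \<Rightarrow> bool" where
  "open_l2_field U = (\<forall>v\<in>U. \<forall>\<^sub>F (v', w) in uniformity. v' = v \<longrightarrow> w \<in> U)"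

instance
proof
  fix a b c :: l2_field and r q :: real
  show "a + b + c = a + (b + c)"
    by transfer (auto simp: l2_eq_def add.assoc intro!: square_integrable_add)
  show "a + b = b + a"
    by transfer (auto simp: l2_eq_def add.commute intro!: square_integrable_add)
  show "0 + a = a" by transfer (auto simp: l2_eq_def)
  show "- a + a = 0" unfolding uminus_l2_field_def
    by transfer (auto simp: l2_eq_def square_integrable_zero)
  show "a - b = a + - b" by (simp add: minus_l2_field_def uminus_l2_field_def)
  show "r *\<^sub>R (a + b) = r *\<^sub>R a + r *\<^sub>R b"
    by transfer (auto simp: l2_eq_def scaleR_add_right
        intro!: square_integrable_add square_integrable_scaleR)
  show "(r + q) *\<^sub>R a = r *\<^sub>R a + q *\<^sub>R a"
    by transfer (auto simp: l2_eq_def scaleR_add_left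
        intro!: square_integrable_add square_integrable_scaleR)
  show "r *\<^sub>R q *\<^sub>R a = (r * q) *\<^sub>R a"
    by transfer (auto simp: l2_eq_def intro!: square_integrable_scaleR)
  show "1 *\<^sub>R a = a" by transfer (auto simp: l2_eq_def)
  show "dist a b = norm (a - b)" by (rule dist_l2_field_def)
  show "sgn a = inverse (norm a) *\<^sub>R a" by (rule sgn_l2_field_def)
  show "uniformity = (INF e\<in>{0<..}. principal {(v::l2_field, w). dist v w < e})"
    by (rule uniformity_l2_field_def)
  show "open U = (\<forall>v\<in>U. \<forall>\<^sub>F (v', w) in uniformity. v' = v \<longrightarrow> w \<in> U)" for U :: "l2_field set"
    by (rule open_l2_field_def)
  show "a \<bullet> b = b \<bullet> a" by transfer (simp add: inner_commute)
  show "(a + b) \<bullet> c = a \<bullet> c + b \<bullet> c"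
    by transfer (auto simp: l2_eq_def inner_add_left square_integrable_inner)
  show "(r *\<^sub>R a) \<bullet> b = r * (a \<bullet> b)" by transfer simp
  show "0 \<le> a \<bullet> a" by transfer simp
  show "a \<bullet> a = 0 \<longleftrightarrow> a = 0"
  proof transfer
    fix f assume "l2_eq f f"
    then have f: "square_integrable f" by (simp add: l2_eq_def)
    have "integral\<^sup>L torus (\<lambda>x. f x \<bullet> f x) = 0 \<longleftrightarrow> (AE x in torus. f x \<bullet> f x = 0)"
      by (rule integral_nonneg_eq_0_iff_AE) (auto intro: square_integrable_inner f)
    then show "integral\<^sup>L torus (\<lambda>x. f x \<bullet> f x) = 0 \<longleftrightarrow> l2_eq f (\<lambda>x. 0)"
      using f by (simp add: l2_eq_def square_integrable_zero)
  qed
  show "norm a = sqrt (a \<bullet> a)" by (rule norm_l2_field_def)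
qed

end

definition partial_deriv :: "3 \<Rightarrow> (real^3 \<Rightarrow> real) \<Rightarrow> real^3 \<Rightarrow> real" where
  "partial_deriv i \<phi> x = frechet_derivative \<phi> (at x) (axis i 1)"

primrec continuously_differentiable :: "nat \<Rightarrow> (real^3 \<Rightarrow> real) \<Rightarrow> bool" where
  "continuously_differentiable 0 \<phi> \<longleftrightarrow> continuous_on UNIV \<phi>"
| "continuously_differentiable (Suc m) \<phi> \<longleftrightarrow>
     (\<forall>x. \<phi> differentiable (at x)) \<and> (\<forall>i. continuously_differentiable m (partial_deriv i \<phi>))"

definition torus_smooth :: "(real^3 \<Rightarrow> real) \<Rightarrow> bool" where
  "torus_smooth \<phi> \<longleftrightarrow>
     (\<forall>m. continuously_differentiable m \<phi>) \<and> (\<forall>x i. \<phi> (x + axis i 1) = \<phi> x)"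

definition gradient :: "(real^3 \<Rightarrow> real) \<Rightarrow> real^3 \<Rightarrow> real^3" where
  "gradient \<phi> x = (\<chi> i. partial_deriv i \<phi> x)"

definition weak_partial :: "3 \<Rightarrow> l2_field \<Rightarrow> l2_field \<Rightarrow> bool" where
  "weak_partial i v w \<longleftrightarrow>
     (\<forall>\<phi>. torus_smooth \<phi> \<longrightarrow>
        integral\<^sup>L torus (\<lambda>x. partial_deriv i \<phi> x *\<^sub>R rep_l2_field v x) =
        - integral\<^sup>L torus (\<lambda>x. \<phi> x *\<^sub>R rep_l2_field w x))"

primrec sobolev :: "nat \<Rightarrow> l2_field set" where
  "sobolev 0 = UNIV"
| "sobolev (Suc m) = {v. \<forall>i. \<exists>w\<in>sobolev m. weak_partial i v w}"

definition weak_pderiv :: "3 \<Rightarrow> l2_field \<Rightarrow> l2_field" where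
  "weak_pderiv i v = (THE w. weak_partial i v w)"

definition laplacian :: "l2_field \<Rightarrow> l2_field" where
  "laplacian v = (\<Sum>i\<in>UNIV. weak_pderiv i (weak_pderiv i v))"

definition divergence_free :: "l2_field \<Rightarrow> bool" where
  "divergence_free v \<longleftrightarrow>
     (\<forall>\<phi>. torus_smooth \<phi> \<longrightarrow> integral\<^sup>L torus (\<lambda>x. rep_l2_field v x \<bullet> gradient \<phi> x) = 0)"

definition mean_free :: "l2_field \<Rightarrow> bool" where
  "mean_free v \<longleftrightarrow> integral\<^sup>L torus (rep_l2_field v) = 0"

lemma l2_eq_rep: "l2_eq (rep_l2_field v) (rep_l2_field v)"
  by (rule Quotient_rep_reflp[OF Quotient_l2_field])

lemma square_integrable_rep: "square_integrable (rep_l2_field v)"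
  using l2_eq_rep[of v] by (simp add: l2_eq_def)

lemma rep_abs_l2_field:
  assumes "square_integrable f"
  shows "AE x in torus. rep_l2_field (abs_l2_field f) x = f x"
proof -
  have "l2_eq (rep_l2_field (abs_l2_field f)) f"
    by (rule Quotient_rep_abs[OF Quotient_l2_field]) (simp add: l2_eq_def assms)
  then show ?thesis by (simp add: l2_eq_def)
qed

lemma rep_l2_field_zero: "AE x in torus. rep_l2_field 0 x = 0"
  unfolding zero_l2_field_def by (rule rep_abs_l2_field[OF square_integrable_zero])

lemma rep_l2_field_add:
  "AE x in torus. rep_l2_field (v + w) x = rep_l2_field v x + rep_l2_field w x"
  unfolding plus_l2_field_def
  by (simp add: rep_abs_l2_field square_integrable_add square_integrable_rep)

lemma rep_l2_field_scaleR:
  "AE x in torus. rep_l2_field (c *\<^sub>R v) x = c *\<^sub>R rep_l2_field v x"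
  unfolding scaleR_l2_field_def
  by (simp add: rep_abs_l2_field square_integrable_scaleR square_integrable_rep)

lemma inner_l2_field_rep:
  "v \<bullet> w = integral\<^sup>L torus (\<lambda>x. rep_l2_field v x \<bullet> rep_l2_field w x)"
  by (simp add: inner_l2_field_def)

lemma emeasure_torus_finite: "emeasure torus (space torus) < \<infinity>"
proof -
  have meas: "{x::real^3. \<forall>i. 0 \<le> x $ i \<and> x $ i < 1} \<in> sets lebesgue"
    (is "?C \<in> _")
  proof -
    have "?C \<in> sets borel" by measurable
    then show ?thesis by simp
  qed
  have "emeasure lebesgue ?C \<le> emeasure lebesgue (cbox 0 1 :: (real^3) set)"
    by (rule emeasure_mono) (auto simp: mem_box_cart less_imp_le)
  also have "\<dots> < \<infinity>" by (simp add: emeasure_lborel_cbox_eq)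
  finally show ?thesis
    using meas by (simp add: torus_def emeasure_restrict_space space_restrict_space)
qed

lemma square_integrable_bounded:
  assumes "f \<in> borel_measurable torus" and "\<And>x. x \<in> space torus \<Longrightarrow> norm (f x) \<le> B"
  shows "square_integrable f"
proof -
  interpret finite_measure torus
    by (rule finite_measureI) (use emeasure_torus_finite in auto)
  have "integrable torus (\<lambda>x. (norm (f x))\<^sup>2)"
  proof (rule integrable_const_bound[where B = "B\<^sup>2"])
    show "AE x in torus. norm ((norm (f x))\<^sup>2) \<le> B\<^sup>2"
      by (rule AE_I2) (simp add: assms power_mono)
    show "(\<lambda>x. (norm (f x))\<^sup>2) \<in> borel_measurable torus" using assms(1) by measurable
  qed
  with assms(1) show ?thesis by (simp add: square_integrable_def)
qed

lemma square_integrable_continuous: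
  assumes "continuous_on UNIV f"
  shows "square_integrable f"
proof -
  have meas: "f \<in> borel_measurable torus"
    unfolding torus_def
    by (intro measurable_restrict_space1 measurable_completion)
      (use borel_measurable_continuous_onI[OF assms] in simp)
  have "bounded (f ` cbox 0 1)"
    by (intro compact_imp_bounded compact_continuous_image continuous_on_subset[OF assms]) auto
  then obtain B where "\<forall>x\<in>cbox 0 1. norm (f x) \<le> B" by (auto simp: bounded_iff)
  moreover have "space torus \<subseteq> cbox 0 1"
    by (auto simp: torus_def space_restrict_space mem_box_cart less_imp_le)
  ultimately show ?thesis by (intro square_integrable_bounded[OF meas]) auto
qed

lemma square_integrable_gradient:
  assumes "torus_smooth \<phi>"
  shows "square_integrable (gradient \<phi>)"
proof (rule square_integrable_continuous)
  have "continuously_differentiable (Suc 0) \<phi>"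
    using assms unfolding torus_smooth_def by blast
  then have "\<forall>i. continuous_on UNIV (partial_deriv i \<phi>)" by simp
  then show "continuous_on UNIV (gradient \<phi>)"
    unfolding gradient_def by (intro continuous_on_vec_lambda) simp
qed

lemma integral_rep_l2_field:
  assumes "square_integrable g"
  shows "integral\<^sup>L torus (\<lambda>x. rep_l2_field v x \<bullet> g x) = v \<bullet> abs_l2_field g"
  unfolding inner_l2_field_rep
proof (rule integral_cong_AE)
  show "AE x in torus. rep_l2_field v x \<bullet> g x =
      rep_l2_field v x \<bullet> rep_l2_field (abs_l2_field g) x"
    using rep_abs_l2_field[OF assms] by eventually_elim simp
  show "(\<lambda>x. rep_l2_field v x \<bullet> g x) \<in> borel_measurable torus"
    by (rule borel_measurable_integrable[OF
        square_integrable_inner[OF square_integrable_rep assms]])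
  show "(\<lambda>x. rep_l2_field v x \<bullet> rep_l2_field (abs_l2_field g) x) \<in> borel_measurable torus"
    by (rule borel_measurable_integrable[OF
        square_integrable_inner[OF square_integrable_rep square_integrable_rep]])
qed

lemma divergence_free_iff:
  "divergence_free v \<longleftrightarrow> (\<forall>\<phi>. torus_smooth \<phi> \<longrightarrow> v \<bullet> abs_l2_field (gradient \<phi>) = 0)"
  by (auto simp: divergence_free_def integral_rep_l2_field square_integrable_gradient)

lemma mean_free_iff: "mean_free v \<longleftrightarrow> (\<forall>c. v \<bullet> abs_l2_field (\<lambda>x. c) = 0)"
proof -
  have const: "square_integrable (\<lambda>x. c)" for c
    by (rule square_integrable_continuous[OF continuous_on_const])
  interpret finite_measure torus
    by (rule finite_measureI) (use emeasure_torus_finite in auto)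
  let ?I = "integral\<^sup>L torus (rep_l2_field v)"
  have meas: "rep_l2_field v \<in> borel_measurable torus"
    and sq: "integrable torus (\<lambda>x. (norm (rep_l2_field v x))\<^sup>2)"
    using square_integrable_rep[of v] by (simp_all only: square_integrable_def)
  have "integrable torus (\<lambda>x. norm (rep_l2_field v x))"
    by (rule square_integrable_imp_integrable[OF measurable_compose[OF meas borel_measurable_norm] sq])
  then have int: "integrable torus (rep_l2_field v)"
    by (rule integrable_norm_cancel[OF _ meas])
  have eq: "v \<bullet> abs_l2_field (\<lambda>x. c) = ?I \<bullet> c" for c
    unfolding integral_rep_l2_field[OF const, symmetric] by (rule integral_inner_left[OF int])
  show ?thesis
  proof
    assume "mean_free v"
    then show "\<forall>c. v \<bullet> abs_l2_field (\<lambda>x. c) = 0"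
      by (simp only: eq mean_free_def inner_zero_left) simp
  next
    assume "\<forall>c. v \<bullet> abs_l2_field (\<lambda>x. c) = 0"
    then have "?I \<bullet> ?I = 0" unfolding eq by (rule spec)
    then show "mean_free v" unfolding mean_free_def by (simp only: inner_eq_zero_iff)
  qed
qed

typedef solenoidal = "{v. divergence_free v \<and> mean_free v}"
  morphisms field_of Abs_solenoidal
  by (rule exI[of _ 0]) (simp add: divergence_free_iff mean_free_iff)

setup_lifting type_definition_solenoidal

instantiation solenoidal :: real_inner
begin

lift_definition zero_solenoidal :: solenoidal is 0
  by (simp add: divergence_free_iff mean_free_iff)

lift_definition plus_solenoidal :: "solenoidal \<Rightarrow> solenoidal \<Rightarrow> solenoidal" is "(+)"
  by (simp add: divergence_free_iff mean_free_iff inner_add_left)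

lift_definition minus_solenoidal :: "solenoidal \<Rightarrow> solenoidal \<Rightarrow> solenoidal" is "(-)"
  by (simp add: divergence_free_iff mean_free_iff inner_diff_left)

lift_definition uminus_solenoidal :: "solenoidal \<Rightarrow> solenoidal" is uminus
  by (simp add: divergence_free_iff mean_free_iff)

lift_definition scaleR_solenoidal :: "real \<Rightarrow> solenoidal \<Rightarrow> solenoidal" is scaleR
  by (simp add: divergence_free_iff mean_free_iff)

lift_definition inner_solenoidal :: "solenoidal \<Rightarrow> solenoidal \<Rightarrow> real" is "(\<bullet>)" .

lift_definition norm_solenoidal :: "solenoidal \<Rightarrow> real" is norm .

lift_definition dist_solenoidal :: "solenoidal \<Rightarrow> solenoidal \<Rightarrow> real" is dist .

lift_definition sgn_solenoidal :: "solenoidal \<Rightarrow> solenoidal" is sgn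
  by (simp add: sgn_div_norm divergence_free_iff mean_free_iff)

definition uniformity_solenoidal :: "(solenoidal \<times> solenoidal) filter" where
  "uniformity_solenoidal = (INF e\<in>{0<..}. principal {(v, w). dist v w < e})"

definition open_solenoidal :: "solenoidal set \<Rightarrow> bool" where
  "open_solenoidal U = (\<forall>v\<in>U. \<forall>\<^sub>F (v', w) in uniformity. v' = v \<longrightarrow> w \<in> U)"

instance
proof
  fix a b c :: solenoidal and r q :: real
  show "a + b + c = a + (b + c)" by transfer simp
  show "a + b = b + a" by transfer simp
  show "0 + a = a" by transfer simp
  show "- a + a = 0" by transfer simp
  show "a - b = a + - b" by transfer simp
  show "r *\<^sub>R (a + b) = r *\<^sub>R a + r *\<^sub>R b" by transfer (simp add: scaleR_add_right)
  show "(r + q) *\<^sub>R a = r *\<^sub>R a + q *\<^sub>R a" by transfer (simp add: scaleR_add_left)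
  show "r *\<^sub>R q *\<^sub>R a = (r * q) *\<^sub>R a" by transfer simp
  show "1 *\<^sub>R a = a" by transfer simp
  show "dist a b = norm (a - b)" by transfer (simp add: dist_norm)
  show "sgn a = inverse (norm a) *\<^sub>R a" by transfer (simp add: sgn_div_norm)
  show "uniformity = (INF e\<in>{0<..}. principal {(v::solenoidal, w). dist v w < e})"
    by (rule uniformity_solenoidal_def)
  show "open U = (\<forall>v\<in>U. \<forall>\<^sub>F (v', w) in uniformity. v' = v \<longrightarrow> w \<in> U)" for U :: "solenoidal set"
    by (rule open_solenoidal_def)
  show "a \<bullet> b = b \<bullet> a" by transfer (simp add: inner_commute)
  show "(a + b) \<bullet> c = a \<bullet> c + b \<bullet> c" by transfer (simp add: inner_add_left)
  show "(r *\<^sub>R a) \<bullet> b = r * (a \<bullet> b)" by transfer simp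
  show "0 \<le> a \<bullet> a" by transfer simp
  show "a \<bullet> a = 0 \<longleftrightarrow> a = 0" by transfer simp
  show "norm a = sqrt (a \<bullet> a)" by transfer (rule norm_eq_sqrt_inner)
qed

end

text \<open>The orthogonal projection \<open>w\<close> of \<open>v\<close>: \<open>w\<close> is solenoidal and \<open>v - w\<close> is orthogonal to all
  solenoidal fields.\<close>

definition leray :: "l2_field \<Rightarrow> solenoidal" where
  "leray v = (THE w. \<forall>h. (v - field_of w) \<bullet> field_of h = 0)"

definition ess_bounded :: "'a measure \<Rightarrow> ('a \<Rightarrow> real) \<Rightarrow> bool" where
  "ess_bounded M f \<longleftrightarrow> f \<in> borel_measurable M \<and> (\<exists>C. AE x in M. \<bar>f x\<bar> \<le> C)"

definition test_function :: "real \<Rightarrow> (real \<Rightarrow> real) \<Rightarrow> bool" where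
  "test_function T \<phi> \<longleftrightarrow>
     (\<forall>m t. (deriv ^^ m) \<phi> field_differentiable (at t)) \<and>
     compact (closure {t. \<phi> t \<noteq> 0}) \<and> closure {t. \<phi> t \<noteq> 0} \<subseteq> {0<..<T}"

definition sobolev_W1_infty :: "real \<Rightarrow> (real \<Rightarrow> real) \<Rightarrow> bool" where
  "sobolev_W1_infty T g \<longleftrightarrow>
     ess_bounded (lebesgue_on {0<..<T}) g \<and>
     (\<exists>h. ess_bounded (lebesgue_on {0<..<T}) h \<and>
       (\<forall>\<phi>. test_function T \<phi> \<longrightarrow>
          integral\<^sup>L (lebesgue_on {0<..<T}) (\<lambda>t. g t * deriv \<phi> t) =
          - integral\<^sup>L (lebesgue_on {0<..<T}) (\<lambda>t. h t * \<phi> t)))"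

definition stokes_domain :: "solenoidal set" where
  "stokes_domain = {v. field_of v \<in> sobolev 2}"

text \<open>
  \<open>stokes\<close> and \<open>system_operator\<close> represent unbounded operators with domain \<open>stokes_domain\<close>; outside
  this set their values are meaningless (\<open>weak_pderiv\<close> is a definite description).
\<close>

definition stokes :: "real \<Rightarrow> solenoidal \<Rightarrow> solenoidal" where
  "stokes \<nu> v = \<nu> *\<^sub>R leray (laplacian (field_of v))"

text \<open>For essentially bounded \<open>chi\<close> the pointwise product is square integrable, so \<open>abs_l2_field\<close>
  forms its class; the class does not depend on the representatives of \<open>chi\<close> and \<open>v\<close>.\<close>

definition damping :: "(real^3 \<Rightarrow> real) \<Rightarrow> real \<Rightarrow> solenoidal \<Rightarrow> solenoidal" where
  "damping chi k v =
     leray (abs_l2_field (\<lambda>x. (chi x * k) *\<^sub>R rep_l2_field (field_of v) x))"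

definition system_operator ::
    "real \<Rightarrow> (real^3 \<Rightarrow> real) \<Rightarrow> ('p \<Rightarrow> real) \<Rightarrow> 'p \<Rightarrow> solenoidal \<Rightarrow> solenoidal" where
  "system_operator \<nu> chi K p v = stokes \<nu> v - damping chi (K p) v"

definition absolutely_continuous_on_interval ::
    "real \<Rightarrow> real \<Rightarrow> (real \<Rightarrow> 'a::metric_space) \<Rightarrow> bool" where
  "absolutely_continuous_on_interval a b u \<longleftrightarrow>
     (\<forall>\<epsilon>>0. \<exists>\<delta>>0. \<forall>n (l :: nat \<Rightarrow> real) r.
        (\<forall>i<n. a \<le> l i \<and> l i \<le> r i \<and> r i \<le> b) \<and>
        (\<forall>i<n. \<forall>j<n. i \<noteq> j \<longrightarrow> {l i<..<r i} \<inter> {l j<..<r j} = {}) \<and>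
        (\<Sum>i<n. r i - l i) < \<delta> \<longrightarrow>
        (\<Sum>i<n. dist (u (r i)) (u (l i))) < \<epsilon>)"

definition graph_norm :: "real \<Rightarrow> solenoidal \<Rightarrow> real" where
  "graph_norm \<nu> v = norm v + norm (stokes \<nu> v)"

text \<open>
  The second conjunct is continuity into \<open>stokes_domain\<close> with the graph norm.  The operators \<open>A t\<close>
  share the domain \<open>stokes_domain\<close>.
\<close>

definition strong_solution ::
    "real \<Rightarrow> (real \<Rightarrow> solenoidal \<Rightarrow> solenoidal) \<Rightarrow> real \<Rightarrow> solenoidal \<Rightarrow> (real \<Rightarrow> solenoidal) \<Rightarrow> bool"
  where
  "strong_solution \<nu> A s u\<^sub>0 u \<longleftrightarrow>
     (\<forall>t\<ge>s. u t \<in> stokes_domain) \<and>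
     (\<forall>t\<ge>s. ((\<lambda>r. graph_norm \<nu> (u r - u t)) \<longlongrightarrow> 0) (at t within {s..})) \<and>
     (\<forall>b\<ge>s. absolutely_continuous_on_interval s b u) \<and>
     (AE t in lebesgue_on {s..}. (u has_vector_derivative A t (u t)) (at t within {s..})) \<and>
     u s = u\<^sub>0"

text \<open>
  Only the values \<open>U t s\<close> with \<open>t \<ge> s \<ge> 0\<close> belong to the family.
\<close>

definition evolution_family ::
    "real \<Rightarrow> (real \<Rightarrow> solenoidal \<Rightarrow> solenoidal) \<Rightarrow>
      (real \<Rightarrow> real \<Rightarrow> solenoidal \<Rightarrow>\<^sub>L solenoidal) \<Rightarrow> bool" where
  "evolution_family \<nu> A U \<longleftrightarrow>
     (\<forall>s\<ge>0. U s s = id_blinfun) \<and>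
     (\<forall>t r s. 0 \<le> s \<and> s \<le> r \<and> r \<le> t \<longrightarrow> U t r o\<^sub>L U r s = U t s) \<and>
     (\<forall>v. continuous_on {(t, s). 0 \<le> s \<and> s \<le> t} (\<lambda>(t, s). blinfun_apply (U t s) v)) \<and>
     (\<forall>s\<ge>0. \<forall>u\<^sub>0\<in>stokes_domain. strong_solution \<nu> A s u\<^sub>0 (\<lambda>t. blinfun_apply (U t s) u\<^sub>0))"

end

theory Submission
  imports Defs
begin

text \<open>
  The functions \<open>cos (2 \<pi> k \<bullet> x) + sin (2 \<pi> k \<bullet> x)\<close> diagonalise the periodic Stokes operator: \<open>stokes \<nu>\<close> is
  multiplication of the Fourier coefficients by \<open>- 4 \<pi>\<^sup>2 \<nu> |k|\<^sup>2\<close>, and its domain consists of the fields for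
  which the products are square summable.  It therefore generates a contraction semigroup \<open>S\<close> with
  \<open>norm (A (S t v)) \<le> norm v / t\<close>.  The damping is a bounded perturbation with a time-dependent factor that
  is, up to a null set, locally Lipschitz; a weighted contraction argument gives mild solutions, these
  are Lipschitz in time for initial values in the domain, and the smoothing of \<open>S\<close> makes them
  strong.  The norm bounds are energy estimates, first for initial values in the domain, then by density.
  Uniqueness is the energy estimate for the difference of two strong solutions, which is only
  absolutely continuous.
\<close>

section \<open>Diagonal contraction semigroups\<close>

text \<open>The obstacle is that the damping coefficient is merely bounded in space: the
  perturbation need not map the domain of the generator into itself, so the generator cannot be put
  on the forcing in Duhamel's formula. Nor can it be put on the semigroup directly, since
  \<open>1 / (t - r)\<close> is not integrable at \<open>r = t\<close>. Regularity in time pays for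
  this: a forcing that is Lipschitz in \<open>r\<close> cancels exactly this singularity. Here the
  W^{1,infinity} hypothesis enters, and here the initial value must lie in the domain, which makes
  the mild solution itself Lipschitz. The hypothesis concerns weak derivatives and almost every
  time, so \<open>\<kappa>\<close> replaces the given coefficient off a null set; strong solutions
  tolerate this because their equation holds almost everywhere. Coercivity is assumed for the given
  coefficient and is carried to \<open>\<kappa>\<close> by continuity. No basis of the solenoidal
  space is built. Coefficients are taken against a basis of all square integrable fields; the
  Laplacian multiplies the three components at one frequency by the same number and so respects the
  constraint.\<close>

lemma gronwall:
  fixes g :: "real \<Rightarrow> real"
  assumes cont: "continuous_on {a..b} g" and "0 \<le> C"
    and le: "\<And>t. t \<in> {a..b} \<Longrightarrow> g t \<le> K + C * integral {a..t} g"
    and t: "t \<in> {a..b}"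
  shows "g t \<le> K * exp (C * (t - a))"
proof -
  define G where "G t = integral {a..t} g" for t
  have G: "(G has_real_derivative g r) (at r within {a..b})" if "r \<in> {a..b}" for r
    unfolding G_def has_real_derivative_iff_has_vector_derivative
    by (rule integral_has_vector_derivative[OF cont that])
  \<comment> \<open>With this integrating factor the assumed inequality says that \<open>h\<close>
    has nonpositive derivative.\<close>
  define h where "h r = exp (- (C * (r - a))) * (K + C * G r)" for r
  have h': "(h has_real_derivative exp (- (C * (r - a))) * C * (g r - (K + C * G r)))
      (at r within {a..b})" if "r \<in> {a..b}" for r
    unfolding h_def by (auto intro!: derivative_eq_intros G[OF that] simp: algebra_simps)
  have "h t \<le> h a"
  proof (rule DERIV_nonpos_imp_decreasing_open[of a t])
    show "a \<le> t" using t by simp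
    show "continuous_on {a..t} h"
      using t by (intro DERIV_continuous_on[where D = "\<lambda>r. exp (- (C * (r - a))) * C * (g r - (K + C * G r))"])
        (rule DERIV_subset[OF h'], auto)
    fix r assume r: "a < r" "r < t"
    then have "at r within {a..b} = at r" using t by (intro at_within_interior) auto
    moreover have "exp (- (C * (r - a))) * C * (g r - (K + C * G r)) \<le> 0"
      using le[of r] r t \<open>0 \<le> C\<close> by (intro mult_nonneg_nonpos) (auto simp: G_def)
    ultimately show "\<exists>y. DERIV h r :> y \<and> y \<le> 0"
      using h'[of r] r t by (auto intro!: exI[of _ "exp (- (C * (r - a))) * C * (g r - (K + C * G r))"])
  qed
  then have "exp (- (C * (t - a))) * (K + C * G t) \<le> K" by (simp add: h_def G_def)
  then have "exp (- (C * (t - a))) * (K + C * G t) * exp (C * (t - a)) \<le> K * exp (C * (t - a))"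
    by (intro mult_right_mono) auto
  moreover have "exp (- (C * (t - a))) * (K + C * G t) * exp (C * (t - a)) = K + C * G t"
    by (simp add: exp_minus)
  ultimately have "K + C * G t \<le> K * exp (C * (t - a))" by simp
  then show ?thesis using le[OF t] by (simp add: G_def)
qed

text \<open>The integrand frozen at \<open>m t\<close> beyond the moving endpoint lives on the fixed
  interval from \<open>s\<close> to \<open>T\<close> and is still jointly continuous; the surplus is
  the explicit term \<open>(T - m t) *\<^sub>R F t (m t)\<close>.\<close>

lemma continuous_on_integral_variable:
  fixes F :: "real \<Rightarrow> real \<Rightarrow> 'a::banach"
  assumes F: "continuous_on UNIV (\<lambda>(t, r). F t r)" and m: "continuous_on A m"
    and le: "\<And>t. t \<in> A \<Longrightarrow> s \<le> m t \<and> m t \<le> T"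
  shows "continuous_on A (\<lambda>t. integral {s..m t} (F t))"
proof -
  have Fc: "continuous_on X (F t)" for t X
    by (rule continuous_on_subset[OF continuous_on_compose2[OF F, of UNIV "\<lambda>r. (t, r)"], simplified])
      (auto intro: continuous_intros)
  have "continuous_on A (\<lambda>t. integral (cbox s T) (\<lambda>r. F t (min r (m t))))"
  proof (rule integral_continuous_on_param)
    have "continuous_on (A \<times> cbox s T) (\<lambda>p. m (fst p))"
      by (rule continuous_on_compose2[OF m]) (auto intro: continuous_intros)
    then show "continuous_on (A \<times> cbox s T) (\<lambda>(t, r). F t (min r (m t)))"
      unfolding split_def by (intro continuous_on_compose2[OF F, of _ "\<lambda>p. (fst p, min (snd p) (m (fst p)))", simplified])
        (auto intro!: continuous_intros)
  qed
  moreover have "continuous_on A (\<lambda>t. F t (m t))"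
    by (rule continuous_on_compose2[OF F, of _ "\<lambda>t. (t, m t)", simplified]) (auto intro: continuous_intros m)
  ultimately have "continuous_on A (\<lambda>t. integral (cbox s T) (\<lambda>r. F t (min r (m t))) - (T - m t) *\<^sub>R F t (m t))"
    by (intro continuous_intros m)
  moreover have "integral (cbox s T) (\<lambda>r. F t (min r (m t))) - (T - m t) *\<^sub>R F t (m t)
      = integral {s..m t} (F t)" if "t \<in> A" for t
  proof -
    have "continuous_on {s..T} (\<lambda>r. F t (min r (m t)))"
      by (rule continuous_on_compose2[OF Fc[of UNIV]]) (auto intro: continuous_intros)
    then have "integral {s..T} (\<lambda>r. F t (min r (m t))) =
        integral {s..m t} (\<lambda>r. F t (min r (m t))) + integral {m t..T} (\<lambda>r. F t (min r (m t)))"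
      using le[OF that] by (intro Henstock_Kurzweil_Integration.integral_combine[symmetric]
          integrable_continuous_real) auto
    also have "integral {s..m t} (\<lambda>r. F t (min r (m t))) = integral {s..m t} (F t)"
      by (rule integral_cong) auto
    also have "integral {m t..T} (\<lambda>r. F t (min r (m t))) = integral {m t..T} (\<lambda>r. F t (m t))"
      by (rule integral_cong) auto
    also have "\<dots> = (T - m t) *\<^sub>R F t (m t)" using le[OF that] by simp
    finally show ?thesis by simp
  qed
  ultimately show ?thesis by (simp cong: continuous_on_cong)
qed

lemma continuous_on_integral_variable_UNIV:
  fixes F :: "real \<Rightarrow> real \<Rightarrow> 'a::banach" and m :: "real \<Rightarrow> real"
  assumes F: "continuous_on UNIV (\<lambda>(t, r). F t r)" and m: "continuous_on UNIV m"
    and le: "\<And>t. s \<le> m t"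
  shows "continuous_on UNIV (\<lambda>t. integral {s..m t} (F t))"
proof -
  have "isCont (\<lambda>t. integral {s..m t} (F t)) t" for t
  proof -
    have m': "continuous_on {t - 1..t + 1} m" by (rule continuous_on_subset[OF m]) auto
    obtain T where T: "\<And>r. r \<in> {t - 1..t + 1} \<Longrightarrow> m r \<le> T"
      using continuous_attains_sup[OF compact_Icc _ m'] by fastforce
    have "continuous_on {t - 1..t + 1} (\<lambda>t. integral {s..m t} (F t))"
      by (rule continuous_on_integral_variable[OF F m', where T = T]) (use le T in auto)
    then show ?thesis by (rule continuous_on_interior) simp
  qed
  then show ?thesis by (simp add: continuous_on_eq_continuous_at)
qed

text \<open>The maps \<open>c i\<close> need not be the coefficients of an orthonormal basis: their
  joint range may be a proper closed subspace of the square summable families, as it is for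
  solenoidal fields. Hence \<open>multiplier\<close> does not ask for a vector with arbitrary
  coefficients, only for those that arise from existing ones through a function of
  \<open>lam\<close>.\<close>

locale spectral =
  fixes c :: "'i \<Rightarrow> 'a::{real_inner,banach} \<Rightarrow> real" and lam :: "'i \<Rightarrow> real"
  assumes linear_c: "linear (c i)"
    and parseval: "((\<lambda>i. (c i v)\<^sup>2) has_sum (norm v)\<^sup>2) UNIV"
    and multiplier: "(\<lambda>i. (g (lam i) * c i v)\<^sup>2) summable_on UNIV \<Longrightarrow> \<exists>w. \<forall>i. c i w = g (lam i) * c i v"
    and lam_nonneg: "0 \<le> lam i"
begin

section \<open>Coefficients, multipliers and the generator\<close>

lemma abs_c_le: "\<bar>c i v\<bar> \<le> norm v"
proof -
  have "sum (\<lambda>i. (c i v)\<^sup>2) {i} \<le> (norm v)\<^sup>2"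
    by (rule finite_sum_le_has_sum[OF parseval]) auto
  then show ?thesis by (auto intro: power2_le_imp_le)
qed

lemma bounded_linear_c: "bounded_linear (c i)"
  by (rule bounded_linear_intro[where K = 1])
    (auto simp: abs_c_le linear_add[OF linear_c] linear_scale[OF linear_c])

lemma c_simps [simp]:
  "c i (v + w) = c i v + c i w" "c i (v - w) = c i v - c i w" "c i (a *\<^sub>R v) = a * c i v"
  "c i 0 = 0" "c i (- v) = - c i v"
  by (simp_all add: linear_add[OF linear_c] linear_diff[OF linear_c] linear_scale[OF linear_c]
      linear_0[OF linear_c] linear_neg[OF linear_c])

lemma c_eqI: assumes "\<And>i. c i v = c i w" shows "v = w"
proof -
  have "((\<lambda>i. (c i (v - w))\<^sup>2) has_sum (norm (v - w))\<^sup>2) UNIV" by (rule parseval)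
  then have "((\<lambda>i. 0) has_sum (norm (v - w))\<^sup>2) (UNIV :: 'i set)" by (simp add: assms)
  then have "(norm (v - w))\<^sup>2 = 0" by (metis has_sum_0 has_sum_unique)
  then show ?thesis by simp
qed

lemma c_integral:
  fixes f :: "real \<Rightarrow> 'a"
  assumes "continuous_on {a..b} f"
  shows "c i (integral {a..b} f) = integral {a..b} (\<lambda>r. c i (f r))"
  using integral_linear[OF integrable_continuous_real[OF assms] bounded_linear_c, of i] by (simp add: o_def)

text \<open>The functional calculus of the operator with symbol \<open>lam\<close>. The described
  vector is unique by \<open>c_eqI\<close>; it exists for every \<open>v\<close> when
  \<open>g\<close> is bounded on the nonnegative reals.\<close>

definition mult :: "(real \<Rightarrow> real) \<Rightarrow> 'a \<Rightarrow> 'a" where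
  "mult g v = (THE w. \<forall>i. c i w = g (lam i) * c i v)"

lemma norm_le_c:
  assumes "\<And>i. \<bar>c i w\<bar> \<le> M * \<bar>c i v\<bar>" "0 \<le> M"
  shows "norm w \<le> M * norm v"
proof -
  have "(c i w)\<^sup>2 \<le> M\<^sup>2 * (c i v)\<^sup>2" for i
    using power_mono[OF assms(1)[of i], of 2] by (simp add: power_mult_distrib)
  then have "(norm w)\<^sup>2 \<le> M\<^sup>2 * (norm v)\<^sup>2"
    by (intro has_sum_mono[OF parseval has_sum_cmult_right[OF parseval]])
  then show ?thesis using assms(2)
    by (metis norm_ge_zero mult_nonneg_nonneg power2_le_imp_le power_mult_distrib)
qed

lemma c_mult:
  assumes "\<And>x. 0 \<le> x \<Longrightarrow> \<bar>g x\<bar> \<le> M"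
  shows "c i (mult g v) = g (lam i) * c i v"
proof -
  have "0 \<le> M" using assms[of 0] by auto
  have "(\<lambda>i. (g (lam i) * c i v)\<^sup>2) summable_on UNIV"
  proof (rule summable_on_comparison_test)
    show "(\<lambda>i. M\<^sup>2 * (c i v)\<^sup>2) summable_on UNIV"
      using has_sum_cmult_right[OF parseval[of v], of "M\<^sup>2"] by (auto simp: summable_on_def)
    show "(g (lam i) * c i v)\<^sup>2 \<le> M\<^sup>2 * (c i v)\<^sup>2" for i
      using power_mono[OF assms[OF lam_nonneg[of i]], of 2]
      by (simp add: power_mult_distrib mult_right_mono)
  qed auto
  from multiplier[OF this] have "\<exists>!w. \<forall>i. c i w = g (lam i) * c i v"
    by (auto intro: c_eqI)
  from theI'[OF this] show ?thesis unfolding mult_def by blast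
qed

lemma norm_mult_le:
  assumes "\<And>x. 0 \<le> x \<Longrightarrow> \<bar>g x\<bar> \<le> M"
  shows "norm (mult g v) \<le> M * norm v"
proof (rule norm_le_c)
  show "0 \<le> M" using assms[of 0] by auto
  show "\<bar>c i (mult g v)\<bar> \<le> M * \<bar>c i v\<bar>" for i
    using assms[OF lam_nonneg[of i]] by (simp add: c_mult[OF assms] abs_mult mult_right_mono)
qed

lemma bounded_linear_mult:
  assumes "\<And>x. 0 \<le> x \<Longrightarrow> \<bar>g x\<bar> \<le> M"
  shows "bounded_linear (mult g)"
  by (rule bounded_linear_intro[where K = M])
    (auto intro!: c_eqI simp: c_mult[OF assms] algebra_simps norm_mult_le[OF assms])

text \<open>The graph of minus the operator with symbol \<open>lam\<close>, kept as a relation so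
  that membership in the domain and the value are stated together. It is cut out by continuous
  functionals, hence closed, which is \<open>gen_lim\<close>.\<close>

definition gen :: "'a \<Rightarrow> 'a \<Rightarrow> bool" where
  "gen v w \<longleftrightarrow> (\<forall>i. c i w = - lam i * c i v)"

lemma gen_unique: "gen v w \<Longrightarrow> gen v w' \<Longrightarrow> w = w'"
  by (auto simp: gen_def intro: c_eqI)

lemma gen_diff: "gen v w \<Longrightarrow> gen v' w' \<Longrightarrow> gen (v - v') (w - w')"
  and gen_zero: "gen 0 0"
  by (auto simp: gen_def algebra_simps)

lemma gen_lim:
  assumes "\<And>n. gen (v n) (w n)" "v \<longlonglongrightarrow> v'" "w \<longlonglongrightarrow> w'"
  shows "gen v' w'"
  unfolding gen_def
proof
  fix i
  have "(\<lambda>n. c i (w n)) \<longlonglongrightarrow> c i w'" "(\<lambda>n. - lam i * c i (v n)) \<longlonglongrightarrow> - lam i * c i v'"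
    by (intro tendsto_intros bounded_linear.tendsto[OF bounded_linear_c] assms)+
  then show "c i w' = - lam i * c i v'"
    using assms(1) by (auto simp: gen_def intro: LIMSEQ_unique)
qed

lemma gen_integral:
  fixes f g :: "real \<Rightarrow> 'a"
  assumes f: "continuous_on {a..b} f" and g: "continuous_on {a..b} g"
    and gen: "\<And>r. r \<in> {a..b} \<Longrightarrow> gen (f r) (g r)"
  shows "gen (integral {a..b} f) (integral {a..b} g)"
  unfolding gen_def
proof
  fix i
  have "integral {a..b} (\<lambda>r. c i (g r)) = integral {a..b} (\<lambda>r. - lam i * c i (f r))"
    by (rule integral_cong) (use gen in \<open>auto simp: gen_def\<close>)
  then show "c i (integral {a..b} g) = - lam i * c i (integral {a..b} f)"
    by (simp add: c_integral f g)
qed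

text \<open>The locale gives Parseval for norms only, so the sign is obtained without expanding the
  inner product: the coefficients of \<open>v - e *\<^sub>R w\<close> are at least as large as those
  of \<open>v\<close> for every \<open>e > 0\<close>, and comparing squared norms to first order in
  \<open>e\<close> gives the claim.\<close>

lemma gen_nonpos: assumes "gen v w" shows "w \<bullet> v \<le> 0"
proof (rule ccontr)
  assume "\<not> w \<bullet> v \<le> 0"
  have *: "2 * (w \<bullet> v) \<le> e * (norm w)\<^sup>2" if "e > 0" for e
  proof -
    have "norm v \<le> 1 * norm (v - e *\<^sub>R w)"
    proof (rule norm_le_c)
      fix i
      have "c i (v - e *\<^sub>R w) = (1 + e * lam i) * c i v" using assms by (simp add: gen_def algebra_simps)
      moreover have "1 * \<bar>c i v\<bar> \<le> \<bar>1 + e * lam i\<bar> * \<bar>c i v\<bar>"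
        using that lam_nonneg[of i] by (intro mult_right_mono) auto
      ultimately show "\<bar>c i v\<bar> \<le> 1 * \<bar>c i (v - e *\<^sub>R w)\<bar>" by (simp add: abs_mult)
    qed auto
    then have "(norm v)\<^sup>2 \<le> (norm (v - e *\<^sub>R w))\<^sup>2" by (simp add: power_mono)
    also have "\<dots> = (norm v)\<^sup>2 - e * (2 * (w \<bullet> v)) + e * (e * (norm w)\<^sup>2)"
      unfolding power2_norm_eq_inner by (simp add: inner_diff inner_commute algebra_simps)
    finally have "e * (2 * (w \<bullet> v)) \<le> e * (e * (norm w)\<^sup>2)"
      by simp
    then show ?thesis using that by simp
  qed
  show False
  proof (cases "norm w = 0")
    case True with \<open>\<not> w \<bullet> v \<le> 0\<close> show False by simp
  next
    case False
    \<comment> \<open>With this \<open>e\<close> the bound reads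
      \<open>2 * (w \<bullet> v) \<le> w \<bullet> v\<close>.\<close>
    with *[of "(w \<bullet> v) / (norm w)\<^sup>2"] \<open>\<not> w \<bullet> v \<le> 0\<close> show False by simp
  qed
qed

text \<open>Replacing negative times by 0 extends the semigroup by the identity, so that the bound
  by 1 and strong continuity hold on the whole line and Duhamel integrands are continuous whatever
  the order of their times.\<close>

definition S :: "real \<Rightarrow> 'a \<Rightarrow> 'a" where
  "S t = mult (\<lambda>x. exp (- (max 0 t * x)))"

lemma S_bound: "0 \<le> x \<Longrightarrow> \<bar>exp (- (max 0 t * x))\<bar> \<le> (1::real)" by simp

lemma c_S: "c i (S t v) = exp (- (max 0 t * lam i)) * c i v"
  unfolding S_def by (rule c_mult[OF S_bound])

lemma norm_S: "norm (S t v) \<le> norm v"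
  unfolding S_def using norm_mult_le[OF S_bound] by simp

lemma bounded_linear_S: "bounded_linear (S t)"
  unfolding S_def by (rule bounded_linear_mult[OF S_bound])

lemmas S_simps = linear_add[OF bounded_linear.linear[OF bounded_linear_S]]
  linear_diff[OF bounded_linear.linear[OF bounded_linear_S]]
  linear_scale[OF bounded_linear.linear[OF bounded_linear_S]]
  linear_0[OF bounded_linear.linear[OF bounded_linear_S]]
  linear_neg[OF bounded_linear.linear[OF bounded_linear_S]]

lemma S_0 [simp]: "S 0 v = v" by (rule c_eqI) (simp add: c_S)

lemma S_add: "0 \<le> t \<Longrightarrow> 0 \<le> r \<Longrightarrow> S t (S r v) = S (t + r) v"
  by (rule c_eqI) (simp add: c_S exp_add[symmetric] algebra_simps)

lemma gen_S: "gen v w \<Longrightarrow> gen (S t v) (S t w)"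
  by (auto simp: gen_def c_S)

text \<open>\<open>J d\<close> is the generator composed with \<open>S d\<close>. It is bounded
  because \<open>x * exp (- (d * x))\<close> stays below \<open>1 / d\<close>.\<close>

definition J :: "real \<Rightarrow> 'a \<Rightarrow> 'a" where
  "J d = mult (\<lambda>x. - x * exp (- (d * x)))"

lemma J_bound: "0 < d \<Longrightarrow> 0 \<le> x \<Longrightarrow> \<bar>- x * exp (- (d * x))\<bar> \<le> 1 / (d::real)"
proof -
  assume "0 < d" "0 \<le> x"
  have "d * x \<le> exp (d * x)" using exp_ge_add_one_self[of "d * x"] by linarith
  then show ?thesis using \<open>0 < d\<close> \<open>0 \<le> x\<close> by (simp add: abs_mult exp_minus field_simps)
qed

lemma c_J: "0 < d \<Longrightarrow> c i (J d v) = - lam i * exp (- (d * lam i)) * c i v"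
  unfolding J_def by (rule c_mult[OF J_bound])

lemma norm_J: "0 < d \<Longrightarrow> norm (J d v) \<le> norm v / d"
  unfolding J_def using norm_mult_le[OF J_bound] by simp

lemma bounded_linear_J: "0 < d \<Longrightarrow> bounded_linear (J d)"
  unfolding J_def by (rule bounded_linear_mult[OF J_bound])

lemma gen_J: "0 < d \<Longrightarrow> gen (S d v) (J d v)"
  by (auto simp: gen_def c_S c_J)

lemma S_J: "0 < d \<Longrightarrow> 0 \<le> t \<Longrightarrow> S t (J d v) = J (t + d) v"
  by (rule c_eqI) (simp add: c_S c_J exp_add[symmetric] algebra_simps)

text \<open>Coefficientwise: \<open>exp (- x)\<close> has Lipschitz constant 1 on the nonnegative
  reals, and the factor \<open>lam i\<close> that this leaves is absorbed into
  \<open>w\<close>.\<close>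

lemma norm_S_diff_gen:
  assumes "gen v w"
  shows "norm (S t v - S r v) \<le> \<bar>t - r\<bar> * norm w"
proof (rule norm_le_c)
  fix i
  have *: "\<bar>exp (- (max 0 t * x)) - exp (- (max 0 r * x))\<bar> \<le> \<bar>t - r\<bar> * x" if "x \<ge> 0" for x
  proof -
    have "\<bar>exp (- a) - exp (- b)\<bar> \<le> \<bar>a - b\<bar>" if "0 \<le> a" "0 \<le> b" for a b :: real
    proof -
      have aux: "exp (- a) - exp (- b) \<le> b - a" if "0 \<le> a" "a \<le> b" for a b :: real
      proof -
        have le: "1 - exp (- (b - a)) \<le> b - a" using exp_ge_add_one_self[of "- (b - a)"] by linarith
        have "exp (- a) - exp (- b) = exp (- a) * (1 - exp (- (b - a)))"
          by (simp add: algebra_simps exp_add[symmetric])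
        also have "\<dots> \<le> 1 * (b - a)"
          using le that by (intro mult_mono) auto
        finally show ?thesis by simp
      qed
      show ?thesis
        using aux[of a b] aux[of b a] that by (cases "a \<le> b") auto
    qed
    from this[of "max 0 t * x" "max 0 r * x"] that
    have "\<bar>exp (- (max 0 t * x)) - exp (- (max 0 r * x))\<bar> \<le> \<bar>max 0 t - max 0 r\<bar> * x"
      by (simp add: abs_mult left_diff_distrib[symmetric])
    also have "\<dots> \<le> \<bar>t - r\<bar> * x" using that by (intro mult_right_mono) auto
    finally show ?thesis .
  qed
  have "\<bar>c i (S t v - S r v)\<bar> = \<bar>exp (- (max 0 t * lam i)) - exp (- (max 0 r * lam i))\<bar> * \<bar>c i v\<bar>"
    by (simp add: c_S left_diff_distrib[symmetric] abs_mult)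
  also have "\<dots> \<le> \<bar>t - r\<bar> * lam i * \<bar>c i v\<bar>"
    by (intro mult_right_mono *) (auto simp: lam_nonneg)
  also have "\<dots> = \<bar>t - r\<bar> * \<bar>c i w\<bar>" using assms lam_nonneg[of i] by (simp add: gen_def abs_mult)
  finally show "\<bar>c i (S t v - S r v)\<bar> \<le> \<bar>t - r\<bar> * \<bar>c i w\<bar>" .
qed auto

text \<open>Spectral cut-off: a finite set of indices carries the squared norm of \<open>v\<close>
  up to \<open>e\<^sup>2\<close>, and below the largest symbol in that set the generator is
  bounded.\<close>

lemma gen_dense:
  assumes "e > 0"
  obtains w z where "gen w z" "norm (v - w) < e"
proof -
  have "((\<lambda>F. \<Sum>i\<in>F. (c i v)\<^sup>2) \<longlongrightarrow> (norm v)\<^sup>2) (finite_subsets_at_top UNIV)"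
    using parseval[of v] by (simp add: has_sum_def)
  then have "\<forall>\<^sub>F F in finite_subsets_at_top UNIV. (norm v)\<^sup>2 - e\<^sup>2 < (\<Sum>i\<in>F. (c i v)\<^sup>2)"
    by (rule order_tendstoD) (use assms in simp)
  then obtain F where F: "finite F" "(norm v)\<^sup>2 - e\<^sup>2 < (\<Sum>i\<in>F. (c i v)\<^sup>2)"
    unfolding eventually_finite_subsets_at_top by blast
  \<comment> \<open>The inserted 0 makes the maximum meaningful for empty \<open>F\<close> and
    \<open>R\<close> nonnegative.\<close>
  define R where "R = Max (insert 0 (lam ` F))"
  have R: "0 \<le> R" "\<And>i. i \<in> F \<Longrightarrow> lam i \<le> R" using F by (auto simp: R_def)
  \<comment> \<open>The cut is by the size of the symbol and not by membership in \<open>F\<close>,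
    since only functions of \<open>lam\<close> are available as multipliers.\<close>
  define w where "w = mult (\<lambda>x. if x \<le> R then 1 else 0) v"
  define z where "z = mult (\<lambda>x. if x \<le> R then - x else 0) v"
  have cw: "c i w = (if lam i \<le> R then 1 else 0) * c i v" for i
    unfolding w_def by (rule c_mult[where M = 1]) auto
  have cz: "c i z = (if lam i \<le> R then - lam i else 0) * c i v" for i
    unfolding z_def by (rule c_mult[where M = R]) (use R in auto)
  have "gen w z" by (auto simp: gen_def cw cz)
  moreover have "norm (v - w) < e"
  proof -
    have "((\<lambda>i. (c i v)\<^sup>2 - (c i (v - w))\<^sup>2) has_sum (norm v)\<^sup>2 - (norm (v - w))\<^sup>2) UNIV"
        using has_sum_add[OF parseval[of v] has_sum_cmult_right[OF parseval[of "v - w"], of "-1"]] by simp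
    then have "(\<Sum>i\<in>F. (c i v)\<^sup>2 - (c i (v - w))\<^sup>2) \<le> (norm v)\<^sup>2 - (norm (v - w))\<^sup>2"
      by (rule finite_sum_le_has_sum) (auto simp: F cw)
    moreover have "(\<Sum>i\<in>F. (c i v)\<^sup>2 - (c i (v - w))\<^sup>2) = (\<Sum>i\<in>F. (c i v)\<^sup>2)"
      by (rule sum.cong) (auto simp: cw R)
    ultimately have "(norm (v - w))\<^sup>2 < e\<^sup>2" using F by linarith
    then show ?thesis using assms by (simp add: power2_less_imp_less)
  qed
  ultimately show ?thesis by (rule that)
qed

text \<open>Orbits of vectors in the domain are Lipschitz by \<open>norm_S_diff_gen\<close>;
  contractivity transfers continuity to limits of such vectors.\<close>

lemma S_continuous: "continuous_on X (\<lambda>t. S t v)"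
proof -
  have "((\<lambda>t. S t v) \<longlongrightarrow> S r v) (at r)" for r
  proof (rule tendstoI)
    fix e :: real assume "e > 0"
    then obtain w z where wz: "gen w z" "norm (v - w) < e / 3" using gen_dense[of "e / 3"] by auto
    have "\<forall>\<^sub>F t in at r. \<bar>t - r\<bar> * norm z < e / 3"
    proof -
      have "((\<lambda>t. \<bar>t - r\<bar> * norm z) \<longlongrightarrow> 0) (at r)" by (auto intro!: tendsto_eq_intros)
      then show ?thesis by (rule order_tendstoD) (use \<open>e > 0\<close> in simp)
    qed
    then show "\<forall>\<^sub>F t in at r. dist (S t v) (S r v) < e"
    proof eventually_elim
      case (elim t)
      have "S t v - S r v = S t (v - w) + (S t w - S r w) - S r (v - w)" by (simp add: S_simps)
      then have "norm (S t v - S r v) \<le> norm (S t (v - w)) + norm (S t w - S r w) + norm (S r (v - w))"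
        by (smt (verit) norm_triangle_ineq norm_triangle_ineq4)
      then show ?case
        using norm_S[of t "v - w"] norm_S[of r "v - w"] norm_S_diff_gen[OF wz(1), of t r] wz(2) elim
        by (simp add: dist_norm)
    qed
  qed
  then have "continuous_on UNIV (\<lambda>t. S t v)" by (auto simp: continuous_on_def)
  then show ?thesis by (rule continuous_on_subset) auto
qed

lemma tendsto_S:
  assumes "(f \<longlongrightarrow> t) F" "(g \<longlongrightarrow> v) F"
  shows "((\<lambda>x. S (f x) (g x)) \<longlongrightarrow> S t v) F"
proof (rule Lim_transform)
  show "((\<lambda>x. S (f x) v) \<longlongrightarrow> S t v) F"
    using S_continuous[of UNIV v] assms(1)
    by (auto simp: continuous_on_def intro: tendsto_compose[of "\<lambda>t. S t v"])
  show "((\<lambda>x. S (f x) (g x) - S (f x) v) \<longlongrightarrow> 0) F"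
  proof (rule Lim_null_comparison)
    show "\<forall>\<^sub>F x in F. norm (S (f x) (g x) - S (f x) v) \<le> norm (g x - v)"
      by (simp add: S_simps[symmetric] norm_S)
    show "((\<lambda>x. norm (g x - v)) \<longlongrightarrow> 0) F" by (auto intro!: tendsto_eq_intros assms)
  qed
qed

lemma continuous_on_S [continuous_intros]:
  "continuous_on X f \<Longrightarrow> continuous_on X g \<Longrightarrow> continuous_on X (\<lambda>x. S (f x) (g x))"
  by (auto simp: continuous_on_def intro: tendsto_S)

lemma S_integral:
  fixes f :: "real \<Rightarrow> 'a"
  assumes "continuous_on {a..b} f"
  shows "S t (integral {a..b} f) = integral {a..b} (\<lambda>r. S t (f r))"
  using integral_linear[OF integrable_continuous_real[OF assms] bounded_linear_S, of t] by (simp add: o_def)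

text \<open>The fundamental theorem of calculus for \<open>S (t - r) v\<close>, whose derivative in
  \<open>r\<close> is \<open>- J (t - r) v\<close>. Stopping at \<open>m < t\<close> keeps away from
  the singularity.\<close>

lemma integral_J:
  assumes "s \<le> m" "m < t"
  shows "integral {s..m} (\<lambda>r. J (t - r) v) = S (t - s) v - S (t - m) v"
proof (rule c_eqI)
  fix i
  \<comment> \<open>Splitting off the fixed operator \<open>J (t - m)\<close> shows that the
    integrand is continuous in \<open>r\<close>.\<close>
  have *: "J (t - r) v = S (m - r) (J (t - m) v)" if "r \<in> {s..m}" for r
    using that assms by (simp add: S_J)
  have eq: "integral {s..m} (\<lambda>r. J (t - r) v) = integral {s..m} (\<lambda>r. S (m - r) (J (t - m) v))"
    by (rule integral_cong) (rule *)
  have "((\<lambda>r. c i (S (m - r) (J (t - m) v))) has_integral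
      - exp (- ((t - m) * lam i)) * c i v - (- exp (- ((t - s) * lam i)) * c i v)) {s..m}"
  proof (rule fundamental_theorem_of_calculus[OF assms(1)])
    fix r assume r: "r \<in> {s..m}"
    have "((\<lambda>r. - exp (- ((t - r) * lam i)) * c i v) has_vector_derivative c i (J (t - r) v)) (at r within {s..m})"
      using assms r unfolding has_real_derivative_iff_has_vector_derivative[symmetric]
      by (auto intro!: derivative_eq_intros simp: c_J)
    then show "((\<lambda>r. - exp (- ((t - r) * lam i)) * c i v) has_vector_derivative c i (S (m - r) (J (t - m) v))) (at r within {s..m})"
      by (simp add: *[OF r])
  qed
  moreover have "continuous_on {s..m} (\<lambda>r. S (m - r) (J (t - m) v))" by (intro continuous_intros)
  ultimately have "c i (integral {s..m} (\<lambda>r. J (t - r) v)) =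
      exp (- ((t - s) * lam i)) * c i v - exp (- ((t - m) * lam i)) * c i v"
    unfolding eq by (subst c_integral) (auto dest: integral_unique)
  then show "c i (integral {s..m} (\<lambda>r. J (t - r) v)) = c i (S (t - s) v - S (t - m) v)"
    using assms by (simp add: c_S)
qed

end

section \<open>Bounded time-dependent perturbations\<close>

lemma integral_exp_le:
  assumes "0 < \<beta>" "s \<le> (m::real)"
  shows "integral {s..m} (\<lambda>r. exp (- (\<beta> * (m - r)))) \<le> 1 / \<beta>"
proof -
  have "((\<lambda>r. exp (- (\<beta> * (m - r)))) has_integral
      exp (- (\<beta> * (m - m))) / \<beta> - exp (- (\<beta> * (m - s))) / \<beta>) {s..m}"
    using assms by (intro fundamental_theorem_of_calculus)
      (auto intro!: derivative_eq_intros simp: has_real_derivative_iff_has_vector_derivative[symmetric])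
  from integral_unique[OF this] assms show ?thesis by (simp add: divide_right_mono diff_divide_distrib[symmetric])
qed

text \<open>\<open>\<kappa>\<close> is total and bounded everywhere, as it will be a representative
  chosen off a null set. Its Lipschitz constant may grow with \<open>T\<close>, because the
  W^{1,infinity} hypothesis concerns each bounded interval separately.\<close>

locale perturbed = spectral c lam for c :: "'i \<Rightarrow> 'a::{real_inner,banach} \<Rightarrow> real" and lam +
  fixes B :: "'a \<Rightarrow> 'a" and \<kappa> :: "real \<Rightarrow> real" and Km :: real
  assumes bounded_linear_B: "bounded_linear B" and B_nonneg: "0 \<le> B v \<bullet> v"
    and kappa_nonneg: "0 \<le> \<kappa> t" and kappa_le: "\<kappa> t \<le> Km"
    and kappa_lipschitz: "\<exists>L. L-lipschitz_on {..T} \<kappa>"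
begin

definition M :: real where "M = Km * onorm B"

lemma Km_nonneg: "0 \<le> Km" using kappa_nonneg[of 0] kappa_le[of 0] by linarith

lemma M_nonneg: "0 \<le> M"
  unfolding M_def using Km_nonneg onorm_pos_le[OF bounded_linear_B] by simp

lemma norm_kappa_B: "norm (\<kappa> r *\<^sub>R B v) \<le> M * norm v"
proof -
  have "norm (\<kappa> r *\<^sub>R B v) = \<kappa> r * norm (B v)" by (simp add: kappa_nonneg)
  also have "\<dots> \<le> Km * (onorm B * norm v)"
    by (intro mult_mono kappa_le onorm[OF bounded_linear_B]) (auto simp: Km_nonneg)
  finally show ?thesis by (simp add: M_def)
qed

lemma B_simps: "B (v + w) = B v + B w" "B (v - w) = B v - B w" "B (a *\<^sub>R v) = a *\<^sub>R B v" "B 0 = 0"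
  using bounded_linear.linear[OF bounded_linear_B]
  by (simp_all add: linear_add linear_diff linear_scale linear_0)

lemma continuous_kappa: "continuous_on X \<kappa>"
proof -
  have "isCont \<kappa> t" for t
  proof -
    obtain L where "L-lipschitz_on {..t + 1} \<kappa>" using kappa_lipschitz by blast
    then have "continuous_on {..t + 1} \<kappa>" by (rule lipschitz_on_continuous_on)
    then show ?thesis by (rule continuous_on_interior) (simp add: interior_Iic)
  qed
  then show ?thesis by (simp add: continuous_at_imp_continuous_on)
qed

lemma continuous_on_B [continuous_intros]:
  "continuous_on X f \<Longrightarrow> continuous_on X (\<lambda>x. B (f x))"
  by (rule bounded_linear.continuous_on[OF bounded_linear_B])

lemma continuous_on_kappa [continuous_intros]:
  "continuous_on X f \<Longrightarrow> continuous_on X (\<lambda>x. \<kappa> (f x))"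
  by (rule continuous_on_compose2[OF continuous_kappa[of UNIV]]) auto

text \<open>Freezing \<open>u\<close> before the initial time makes a mild solution unique as a function on the whole line.\<close>

definition mild :: "real \<Rightarrow> 'a \<Rightarrow> (real \<Rightarrow> 'a) \<Rightarrow> bool" where
  "mild s x u \<longleftrightarrow> continuous_on UNIV u \<and> (\<forall>t\<le>s. u t = x) \<and>
     (\<forall>t\<ge>s. u t = S (t - s) x - integral {s..t} (\<lambda>r. S (t - r) (\<kappa> r *\<^sub>R B (u r))))"

lemma mild_cont: "mild s x u \<Longrightarrow> continuous_on UNIV u"
  by (simp add: mild_def)

lemma continuous_mild:
  "mild s x u \<Longrightarrow> continuous_on X f \<Longrightarrow> continuous_on X (\<lambda>x. u (f x))"
  by (rule continuous_on_compose2[OF mild_cont]) auto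

text \<open>The unknown of the fixed point problem is
  \<open>exp (- (\<beta> * (t - s))) *\<^sub>R u t\<close>. With this weight the Duhamel term is a
  contraction on the bounded continuous functions of the whole line at once, whatever the length of
  time, so that no continuation of local solutions arises.\<close>

lemma mild_exists: "\<exists>u. mild s x u"
proof -
  \<comment> \<open>\<open>2 * M\<close> gives the contraction constant 1/2; the added 1 keeps
    \<open>\<beta>\<close> positive when \<open>M = 0\<close>.\<close>
  define \<beta> where "\<beta> = 2 * M + 1"
  have \<beta>: "0 < \<beta>" "M / \<beta> \<le> 1 / 2" using M_nonneg by (auto simp: \<beta>_def field_simps)
  \<comment> \<open>Times before \<open>s\<close> are sent to \<open>s\<close>, which makes
    \<open>\<Phi> v\<close> a function on the whole line.\<close>
  define m where "m = max s"
  have m: "s \<le> m t" for t by (simp add: m_def)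
  have m_cont [continuous_intros]: "continuous_on X f \<Longrightarrow> continuous_on X (\<lambda>x. m (f x))" for X :: "'b::topological_space set" and f
    unfolding m_def by (intro continuous_intros)
  \<comment> \<open>The exponent combines the weight at \<open>t\<close> with the inverse of the
    weight at \<open>r\<close>, since \<open>v r\<close> stands for a weighted value.\<close>
  define F where "F v t r = exp (- (\<beta> * (m t - r))) *\<^sub>R S (m t - r) (\<kappa> r *\<^sub>R B (v r))" for v t r
  define \<Phi> where "\<Phi> v t = exp (- (\<beta> * (m t - s))) *\<^sub>R S (m t - s) x - integral {s..m t} (F v t)" for v t
  have F_cont: "continuous_on UNIV (\<lambda>(t, r). F v t r)" if "continuous_on UNIV v" for v
  proof -
    have "continuous_on UNIV (\<lambda>p::real \<times> real. v (snd p))"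
      by (rule continuous_on_compose2[OF that]) (auto intro: continuous_intros)
    then show ?thesis unfolding F_def split_def by (intro continuous_intros)
  qed
  have F_cont': "continuous_on X (F v t)" if "continuous_on UNIV v" for v t X
  proof -
    have "continuous_on X v" by (rule continuous_on_subset[OF that]) auto
    then show ?thesis unfolding F_def by (intro continuous_intros)
  qed
  have \<Phi>_cont: "continuous_on UNIV (\<Phi> v)" if "continuous_on UNIV v" for v
    unfolding \<Phi>_def by (intro continuous_intros continuous_on_integral_variable_UNIV F_cont that m)
  have F_bound: "norm (integral {s..m t} (F v t)) \<le> C / 2"
    if v: "continuous_on UNIV v" and C: "\<And>r. norm (v r) \<le> C" for v t C
  proof -
    have "0 \<le> C" using norm_ge_zero[of "v 0"] C[of 0] by linarith
    have "norm (integral {s..m t} (F v t)) \<le> integral {s..m t} (\<lambda>r. exp (- (\<beta> * (m t - r))) * (M * C))"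
    proof (rule integral_norm_bound_integral)
      show "norm (F v t r) \<le> exp (- (\<beta> * (m t - r))) * (M * C)" for r
      proof -
        have "norm (S (m t - r) (\<kappa> r *\<^sub>R B (v r))) \<le> M * C"
          by (rule order_trans[OF norm_S order_trans[OF norm_kappa_B mult_left_mono[OF C M_nonneg]]])
        then show ?thesis by (simp add: F_def)
      qed
    qed (auto intro!: integrable_continuous_real F_cont' v continuous_intros)
    also have "\<dots> = integral {s..m t} (\<lambda>r. exp (- (\<beta> * (m t - r)))) * (M * C)" by simp
    also have "\<dots> \<le> 1 / \<beta> * (M * C)"
      using M_nonneg \<open>0 \<le> C\<close> by (intro mult_right_mono integral_exp_le \<beta> m) auto
    also have "\<dots> \<le> C / 2" using mult_right_mono[OF \<beta>(2) \<open>0 \<le> C\<close>] by simp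
    finally show ?thesis .
  qed
  have \<Phi>_bcont: "\<Phi> (apply_bcontfun v) \<in> bcontfun" for v
  proof (rule bcontfun_normI)
    show "continuous_on UNIV (\<Phi> (apply_bcontfun v))" by (rule \<Phi>_cont) simp
    fix t
    have "norm (exp (- (\<beta> * (m t - s))) *\<^sub>R S (m t - s) x) \<le> 1 * norm x"
      unfolding norm_scaleR using norm_S \<beta> m[of t] by (intro mult_mono) auto
    moreover have "norm (integral {s..m t} (F (apply_bcontfun v) t)) \<le> norm v / 2"
      by (rule F_bound) (auto simp: norm_bounded)
    ultimately show "norm (\<Phi> (apply_bcontfun v) t) \<le> norm x + norm v / 2"
      unfolding \<Phi>_def by (intro order_trans[OF norm_triangle_ineq4]) auto
  qed
  define \<Psi> where "\<Psi> v = Bcontfun (\<Phi> (apply_bcontfun v))" for v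
  have \<Psi>: "apply_bcontfun (\<Psi> v) = \<Phi> (apply_bcontfun v)" for v
    unfolding \<Psi>_def by (rule Bcontfun_inverse[OF \<Phi>_bcont])
  have "\<exists>!v. \<Psi> v = v"
  proof (rule banach_fix_type[where c = "1/2"])
    show "\<forall>v w. dist (\<Psi> v) (\<Psi> w) \<le> 1 / 2 * dist v w"
    proof (intro allI dist_bound)
      fix v w t
      have "\<Phi> (apply_bcontfun v) t - \<Phi> (apply_bcontfun w) t =
          - (integral {s..m t} (F v t) - integral {s..m t} (F w t))" by (simp add: \<Phi>_def)
      also have "integral {s..m t} (F v t) - integral {s..m t} (F w t) =
          integral {s..m t} (\<lambda>r. F v t r - F w t r)"
        by (rule Henstock_Kurzweil_Integration.integral_diff[symmetric])
          (auto intro!: integrable_continuous_real F_cont')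
      also have "\<dots> = integral {s..m t} (F (\<lambda>r. v r - w r) t)"
        by (rule integral_cong) (simp add: F_def B_simps S_simps scaleR_diff_right)
      finally have "dist (\<Phi> (apply_bcontfun v) t) (\<Phi> (apply_bcontfun w) t) =
          norm (integral {s..m t} (F (\<lambda>r. v r - w r) t))" by (simp add: dist_norm)
      also have "\<dots> \<le> dist v w / 2"
        by (rule F_bound) (auto intro!: continuous_intros simp: dist_norm[symmetric] dist_bounded)
      finally show "dist (\<Psi> v t) (\<Psi> w t) \<le> 1 / 2 * dist v w" by (simp add: \<Psi>)
    qed
  qed auto
  then obtain v where "\<Psi> v = v" by blast
  then have v: "\<Phi> v t = v t" for t using \<Psi>[of v] by simp
  define u where "u t = exp (\<beta> * (m t - s)) *\<^sub>R v t" for t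
  have "mild s x u" unfolding mild_def
  proof (intro conjI allI impI)
    show "continuous_on UNIV u" unfolding u_def by (intro continuous_intros) auto
    show "u t = x" if "t \<le> s" for t
      using v[of t] that by (simp add: u_def \<Phi>_def m_def)
    fix t assume "s \<le> t"
    then have mt: "m t = t" by (simp add: m_def)
    have "u t = exp (\<beta> * (t - s)) *\<^sub>R \<Phi> v t" by (simp add: u_def v mt)
    also have "\<dots> = S (t - s) x - exp (\<beta> * (t - s)) *\<^sub>R integral {s..t} (F v t)"
      by (simp add: \<Phi>_def mt scaleR_diff_right exp_minus)
    also have "exp (\<beta> * (t - s)) *\<^sub>R integral {s..t} (F v t) = integral {s..t} (\<lambda>r. exp (\<beta> * (t - s)) *\<^sub>R F v t r)"
      by simp
    also have "\<dots> = integral {s..t} (\<lambda>r. S (t - r) (\<kappa> r *\<^sub>R B (u r)))"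
    proof (rule integral_cong)
      fix r assume "r \<in> {s..t}"
      then have "m r = r" by (simp add: m_def)
      have "exp (\<beta> * (t - s)) * exp (- (\<beta> * (t - r))) = exp (\<beta> * (r - s))"
        by (simp add: exp_add[symmetric] algebra_simps)
      then show "exp (\<beta> * (t - s)) *\<^sub>R F v t r = S (t - r) (\<kappa> r *\<^sub>R B (u r))"
        by (simp add: F_def u_def mt \<open>m r = r\<close> B_simps S_simps mult.commute)
    qed
    finally show "u t = S (t - s) x - integral {s..t} (\<lambda>r. S (t - r) (\<kappa> r *\<^sub>R B (u r)))" .
  qed
  then show ?thesis by blast
qed

lemma mild_lincomb:
  assumes u: "mild s x u" and v: "mild s y v"
  shows "mild s (a *\<^sub>R x + b *\<^sub>R y) (\<lambda>t. a *\<^sub>R u t + b *\<^sub>R v t)"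
  unfolding mild_def
proof (intro conjI allI impI)
  show "continuous_on UNIV (\<lambda>t. a *\<^sub>R u t + b *\<^sub>R v t)"
    by (intro continuous_intros mild_cont[OF u] mild_cont[OF v])
  show "a *\<^sub>R u t + b *\<^sub>R v t = a *\<^sub>R x + b *\<^sub>R y" if "t \<le> s" for t
    using u v that by (simp add: mild_def)
  fix t assume "s \<le> t"
  let ?I = "\<lambda>u. integral {s..t} (\<lambda>r. S (t - r) (\<kappa> r *\<^sub>R B (u r)))"
  have int: "(\<lambda>r. S (t - r) (\<kappa> r *\<^sub>R B (w r))) integrable_on {s..t}" if "mild s z w" for z w
    by (intro integrable_continuous_real continuous_intros continuous_mild[OF that])
  have "?I (\<lambda>t. a *\<^sub>R u t + b *\<^sub>R v t) = integral {s..t} (\<lambda>r. a *\<^sub>R S (t - r) (\<kappa> r *\<^sub>R B (u r)) + b *\<^sub>R S (t - r) (\<kappa> r *\<^sub>R B (v r)))"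
    by (rule integral_cong) (simp add: B_simps S_simps algebra_simps)
  also have "\<dots> = a *\<^sub>R ?I u + b *\<^sub>R ?I v"
    by (subst Henstock_Kurzweil_Integration.integral_add)
      (auto intro!: integrable_cmul int[OF u] int[OF v])
  finally have eq: "?I (\<lambda>t. a *\<^sub>R u t + b *\<^sub>R v t) = a *\<^sub>R ?I u + b *\<^sub>R ?I v" .
  have "u t = S (t - s) x - ?I u" "v t = S (t - s) y - ?I v"
    using u v \<open>s \<le> t\<close> unfolding mild_def by blast+
  then have "a *\<^sub>R u t + b *\<^sub>R v t = a *\<^sub>R (S (t - s) x - ?I u) + b *\<^sub>R (S (t - s) y - ?I v)"
    by simp
  then show "a *\<^sub>R u t + b *\<^sub>R v t = S (t - s) (a *\<^sub>R x + b *\<^sub>R y) - ?I (\<lambda>t. a *\<^sub>R u t + b *\<^sub>R v t)"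
    unfolding eq by (simp add: S_simps scaleR_diff_right)
qed

lemma norm_mild_integral_le:
  assumes u: "continuous_on UNIV u" and "s \<le> t" "t \<le> t'"
  shows "norm (integral {s..t} (\<lambda>r. S (t' - r) (\<kappa> r *\<^sub>R B (u r)))) \<le> M * integral {s..t} (\<lambda>r. norm (u r))"
proof -
  have u': "continuous_on {s..t} u" by (rule continuous_on_subset[OF u]) auto
  have "norm (integral {s..t} (\<lambda>r. S (t' - r) (\<kappa> r *\<^sub>R B (u r)))) \<le> integral {s..t} (\<lambda>r. M * norm (u r))"
  proof (rule integral_norm_bound_integral)
    show "norm (S (t' - r) (\<kappa> r *\<^sub>R B (u r))) \<le> M * norm (u r)" for r
      by (rule order_trans[OF norm_S norm_kappa_B])
  qed (intro integrable_continuous_real continuous_intros u')+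
  then show ?thesis by simp
qed

text \<open>A crude growth bound. The sharp ones come from the energy estimate, which is first
  available only for initial values in the domain; this one yields uniqueness and controls the error
  in the later density argument.\<close>

lemma norm_mild_le:
  assumes u: "mild s x u" and "s \<le> t"
  shows "norm (u t) \<le> norm x * exp (M * (t - s))"
proof (rule gronwall[where b = t])
  show "continuous_on {s..t} (\<lambda>t. norm (u t))" by (intro continuous_intros continuous_mild[OF u])
  show "norm (u r) \<le> norm x + M * integral {s..r} (\<lambda>t. norm (u t))" if "r \<in> {s..t}" for r
  proof -
    have "u r = S (r - s) x - integral {s..r} (\<lambda>q. S (r - q) (\<kappa> q *\<^sub>R B (u q)))"
      using u that by (simp add: mild_def)
    then have "norm (u r) \<le> norm (S (r - s) x) + norm (integral {s..r} (\<lambda>q. S (r - q) (\<kappa> q *\<^sub>R B (u q))))"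
      by (metis norm_triangle_ineq4)
    then show ?thesis
      using norm_S[of "r - s" x] norm_mild_integral_le[OF mild_cont[OF u], of s r r] that by auto
  qed
qed (use assms M_nonneg in auto)

lemma mild_unique:
  assumes u: "mild s x u" and v: "mild s x v"
  shows "u = v"
proof
  fix t
  show "u t = v t"
  proof (cases "s \<le> t")
    case True
    with norm_mild_le[OF mild_lincomb[OF u v, of 1 "-1"]] show ?thesis by simp
  next
    case False
    with u v show ?thesis by (simp add: mild_def)
  qed
qed

definition sol :: "real \<Rightarrow> 'a \<Rightarrow> real \<Rightarrow> 'a" where
  "sol s x = (THE u. mild s x u)"

lemma mild_sol: "mild s x (sol s x)"
  unfolding sol_def using theI'[of "mild s x"] mild_exists mild_unique by blast

lemma sol_eqI: "mild s x u \<Longrightarrow> sol s x = u"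
  using mild_sol mild_unique by blast

lemma sol_init: "t \<le> s \<Longrightarrow> sol s x t = x"
  using mild_sol by (simp add: mild_def)

lemma bounded_linear_sol: "s \<le> t \<Longrightarrow> bounded_linear (\<lambda>x. sol s x t)"
proof (rule bounded_linear_intro)
  fix x y a
  show "sol s (x + y) t = sol s x t + sol s y t"
    using sol_eqI[OF mild_lincomb[OF mild_sol mild_sol, of s 1 x 1 y]] by simp
  show "sol s (a *\<^sub>R x) t = a *\<^sub>R sol s x t"
    using sol_eqI[OF mild_lincomb[OF mild_sol mild_sol, of s a x 0 x]] by simp
  show "s \<le> t \<Longrightarrow> norm (sol s x t) \<le> norm x * exp (M * (t - s))"
    by (rule norm_mild_le[OF mild_sol])
qed

lemma duhamel_split:
  fixes f :: "real \<Rightarrow> 'a"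
  assumes f: "continuous_on {s..t} f" and r: "s \<le> r" "r \<le> t"
  shows "integral {s..t} (\<lambda>q. S (t - q) (f q)) =
    S (t - r) (integral {s..r} (\<lambda>q. S (r - q) (f q))) + integral {r..t} (\<lambda>q. S (t - q) (f q))"
proof -
  have f': "continuous_on {s..r} f" by (rule continuous_on_subset[OF f]) (use r in auto)
  have "S (t - r) (integral {s..r} (\<lambda>q. S (r - q) (f q))) = integral {s..r} (\<lambda>q. S (t - r) (S (r - q) (f q)))"
    by (intro S_integral continuous_intros f')
  also have "\<dots> = integral {s..r} (\<lambda>q. S (t - q) (f q))"
    by (rule integral_cong) (use r in \<open>simp add: S_add\<close>)
  finally show ?thesis
    using r by (simp add: Henstock_Kurzweil_Integration.integral_combine
        integrable_continuous_real continuous_intros f)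
qed

lemma mild_step:
  assumes u: "mild s x u" and r: "s \<le> r" "r \<le> t"
  shows "u t = S (t - r) (u r) - integral {r..t} (\<lambda>q. S (t - q) (\<kappa> q *\<^sub>R B (u q)))"
proof -
  have "integral {s..t} (\<lambda>q. S (t - q) (\<kappa> q *\<^sub>R B (u q))) =
    S (t - r) (integral {s..r} (\<lambda>q. S (r - q) (\<kappa> q *\<^sub>R B (u q)))) + integral {r..t} (\<lambda>q. S (t - q) (\<kappa> q *\<^sub>R B (u q)))"
    by (intro duhamel_split r continuous_intros continuous_mild[OF u])
  then show ?thesis using u r by (simp add: mild_def S_simps S_add)
qed

text \<open>Uniqueness of mild solutions, applied to the old solution restarted at \<open>r\<close>:
  composing with \<open>max r\<close> provides the freezing that \<open>mild\<close>
  demands.\<close>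

lemma sol_sol:
  assumes "s \<le> r" "r \<le> t"
  shows "sol r (sol s x r) t = sol s x t"
proof -
  have "mild r (sol s x r) (\<lambda>t. sol s x (max r t))"
    unfolding mild_def
  proof (intro conjI allI impI)
    show "continuous_on UNIV (\<lambda>t. sol s x (max r t))"
      by (intro continuous_intros continuous_mild[OF mild_sol])
    show "sol s x (max r t) = sol s x r" if "t \<le> r" for t using that by (simp add: max_def)
    fix t assume "r \<le> t"
    have "integral {r..t} (\<lambda>q. S (t - q) (\<kappa> q *\<^sub>R B (sol s x q))) = integral {r..t} (\<lambda>q. S (t - q) (\<kappa> q *\<^sub>R B (sol s x (max r q))))"
      by (rule integral_cong) (simp add: max_def)
    then show "sol s x (max r t) = S (t - r) (sol s x r) - integral {r..t} (\<lambda>q. S (t - q) (\<kappa> q *\<^sub>R B (sol s x (max r q))))"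
      using mild_step[OF mild_sol[of s x] assms(1) \<open>r \<le> t\<close>] \<open>r \<le> t\<close> by (simp add: max_def)
  qed
  from sol_eqI[OF this] assms(2) show ?thesis by (simp add: max_def)
qed

end

section \<open>The generator on Duhamel integrals\<close>

context spectral
begin

lemma integral_S_gen:
  assumes "gen v w" "t \<le> t'"
  shows "integral {t..t'} (\<lambda>q. S (t' - q) w) = S (t' - t) v - v"
proof (rule c_eqI)
  fix i
  have "((\<lambda>q. c i (S (t' - q) w)) has_integral
      - exp (- ((t' - t') * lam i)) * c i v - (- exp (- ((t' - t) * lam i)) * c i v)) {t..t'}"
  proof (rule fundamental_theorem_of_calculus[OF assms(2)])
    fix q assume "q \<in> {t..t'}"
    then show "((\<lambda>q. - exp (- ((t' - q) * lam i)) * c i v) has_vector_derivative c i (S (t' - q) w)) (at q within {t..t'})"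
      using assms(1) unfolding has_real_derivative_iff_has_vector_derivative[symmetric]
      by (auto intro!: derivative_eq_intros simp: c_S gen_def)
  qed
  then have "c i (integral {t..t'} (\<lambda>q. S (t' - q) w)) = exp (- ((t' - t) * lam i)) * c i v - c i v"
    by (subst c_integral) (auto intro!: continuous_intros dest: integral_unique)
  then show "c i (integral {t..t'} (\<lambda>q. S (t' - q) w)) = c i (S (t' - t) v - v)"
    using assms(2) by (simp add: c_S)
qed

lemma continuous_on_J:
  fixes g :: "real \<Rightarrow> 'a"
  assumes "continuous_on {a..b} g" "b < t"
  shows "continuous_on {a..b} (\<lambda>r. J (t - r) (g r))"
proof -
  have "continuous_on {a..b} (\<lambda>r. S (b - r) (J (t - b) (g r)))"
    by (intro continuous_intros bounded_linear.continuous_on[OF bounded_linear_J] assms) (use assms in simp)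
  then show ?thesis
    by (rule continuous_on_cong[THEN iffD1, rotated 2]) (use assms in \<open>auto simp: S_J\<close>)
qed

text \<open>The integrand \<open>J (t - r) (f r)\<close> of \<open>A\<close> applied to the Duhamel integral is singular at \<open>r = t\<close>.
  Subtracting \<open>f t\<close> makes it bounded, because \<open>norm (J d v) \<le> norm v / d\<close> and \<open>f\<close> is Lipschitz;
  the subtracted part is integrated explicitly.\<close>

lemma duhamel_gen:
  fixes f :: "real \<Rightarrow> 'a"
  assumes f: "continuous_on UNIV f" and L: "L-lipschitz_on {s..T} f"
  obtains z where "continuous_on {s..T} z"
    and "\<And>t. t \<in> {s..T} \<Longrightarrow> gen (integral {s..t} (\<lambda>r. S (t - r) (f r))) (z t)"
proof -
  define d where "d n = inverse (real (Suc n))" for n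
  have d: "0 < d n" "k \<ge> n \<Longrightarrow> d k \<le> d n" for n k by (auto simp: d_def field_simps)
  have d_lim: "d \<longlonglongrightarrow> 0" unfolding d_def by (rule LIMSEQ_inverse_real_of_nat)
  have "0 \<le> L" using L by (rule lipschitz_on_nonneg)
  \<comment> \<open>The upper limit stops at distance \<open>d n\<close> from the singularity, but
    not before \<open>s\<close>.\<close>
  define m where "m n t = max s (t - d n)" for n t
  have m: "s \<le> m n t" "t \<in> {s..T} \<Longrightarrow> m n t \<le> t" "s < t \<Longrightarrow> m n t < t" "m n s = s"
    "t \<in> {s..T} \<Longrightarrow> t - m n t \<le> d n" for n t
    using d(1)[of n] by (auto simp: m_def)
  have m_mono: "m n t \<le> m k t" if "n \<le> k" for n k t
    using d(2)[OF that] unfolding m_def by (intro max.mono) auto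
  define I where "I n t = integral {s..m n t} (\<lambda>r. J (t - r) (f r - f t))" for n t
  have fc: "continuous_on X f" for X by (rule continuous_on_subset[OF f]) auto
  have fcomp: "continuous_on X g \<Longrightarrow> continuous_on X (\<lambda>x. f (g x))" for g and X :: "'b::topological_space set"
    by (rule continuous_on_compose2[OF f]) auto
  have Jc: "continuous_on {a..b} (\<lambda>r. J (t - r) (f r - f t))" if "b < t" for a b t
    by (intro continuous_on_J continuous_intros fc that)
  \<comment> \<open>On the strip between two truncations the integrand is bounded by
    \<open>L\<close>: the factor \<open>1 / (t - r)\<close> from \<open>norm_J\<close> meets
    \<open>L * \<bar>r - t\<bar>\<close>. The strip is no longer than \<open>d n\<close>, so the
    convergence is uniform in \<open>t\<close>.\<close>
  have I_diff: "norm (I k t - I n t) \<le> L * d n" if "n \<le> k" "t \<in> {s..T}" for k n t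
  proof (cases "t = s")
    case True
    then show ?thesis using \<open>0 \<le> L\<close> d[of n] m(4) by (simp add: I_def)
  next
    case False
    then have t: "s < t" using that by auto
    have "I k t = I n t + integral {m n t..m k t} (\<lambda>r. J (t - r) (f r - f t))"
      unfolding I_def using m(1) m_mono that
      by (intro Henstock_Kurzweil_Integration.integral_combine[symmetric] integrable_continuous_real Jc m(3) t) auto
    moreover have "norm (integral {m n t..m k t} (\<lambda>r. J (t - r) (f r - f t))) \<le> L * (m k t - m n t)"
    proof (rule integral_bound[OF m_mono[OF that(1)] Jc[OF m(3)[OF t]]])
      fix r assume r: "r \<in> {m n t..m k t}"
      then have "r < t" "r \<in> {s..T}" using m(3)[OF t, of k] m(1)[of n t] that by auto
      then have "norm (J (t - r) (f r - f t)) \<le> norm (f r - f t) / (t - r)" by (intro norm_J) auto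
      also have "\<dots> \<le> L * \<bar>r - t\<bar> / (t - r)"
        using lipschitz_on_normD[OF L \<open>r \<in> {s..T}\<close> that(2)] \<open>r < t\<close> by (intro divide_right_mono) auto
      also have "\<dots> = L" using \<open>r < t\<close> by simp
      finally show "norm (J (t - r) (f r - f t)) \<le> L" .
    qed
    moreover have "L * (m k t - m n t) \<le> L * d n"
      using m(2,5)[OF that(2)] \<open>0 \<le> L\<close> by (intro mult_left_mono) (smt (verit))+
    ultimately show ?thesis by simp
  qed
  define Z where "Z t = lim (\<lambda>n. I n t)" for t
  have I_Z: "(\<lambda>n. I n t) \<longlonglongrightarrow> Z t" if "t \<in> {s..T}" for t
  proof -
    have "Cauchy (\<lambda>n. I n t)"
    proof (rule CauchyI')
      fix e :: real assume "e > 0"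
      have "(\<lambda>n. L * d n) \<longlonglongrightarrow> L * 0" by (intro tendsto_intros d_lim)
      then have "\<forall>\<^sub>F n in sequentially. L * d n < e" by (rule order_tendstoD) (use \<open>e > 0\<close> in simp)
      then obtain N where N: "L * d N < e" by (auto simp: eventually_sequentially)
      have "dist (I n t) (I k t) < e" if "n \<ge> N" "k > n" for n k
      proof -
        have "dist (I n t) (I k t) \<le> L * d n"
          using I_diff[OF less_imp_le[OF that(2)] \<open>t \<in> {s..T}\<close>] by (simp add: dist_norm norm_minus_commute)
        also have "\<dots> \<le> L * d N" using d(2)[OF that(1)] \<open>0 \<le> L\<close> by (rule mult_left_mono)
        finally show ?thesis using N by simp
      qed
      then show "\<exists>M. \<forall>m\<ge>M. \<forall>n>m. dist (I m t) (I n t) < e" by blast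
    qed
    then show ?thesis unfolding Z_def by (simp add: Cauchy_convergent_iff convergent_LIMSEQ_iff)
  qed
  have I_Z_le: "norm (Z t - I n t) \<le> L * d n" if "t \<in> {s..T}" for t n
  proof (rule LIMSEQ_le_const2)
    show "(\<lambda>k. norm (I k t - I n t)) \<longlonglongrightarrow> norm (Z t - I n t)"
      by (intro tendsto_intros I_Z that)
    show "\<exists>N. \<forall>k\<ge>N. norm (I k t - I n t) \<le> L * d n" using I_diff that by blast
  qed
  have I_cont: "continuous_on {s..T} (I n)" for n
  proof -
    \<comment> \<open>For \<open>r \<le> t - d n\<close> the operator \<open>J (t - r)\<close> is
      \<open>S (t - d n - r)\<close> after the fixed operator \<open>J (d n)\<close>. In this form
      the integrand is defined and jointly continuous for all \<open>t\<close> and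
      \<open>r\<close>.\<close>
    have "continuous_on {s..T} (\<lambda>t. integral {s..m n t} (\<lambda>r. S (t - d n - r) (J (d n) (f r - f t))))"
    proof (rule continuous_on_integral_variable[where T = T])
      show "continuous_on UNIV (\<lambda>(t, r). S (t - d n - r) (J (d n) (f r - f t)))"
        unfolding split_def
        by (intro continuous_intros bounded_linear.continuous_on[OF bounded_linear_J] fcomp d)
      show "continuous_on {s..T} (m n)" unfolding m_def by (intro continuous_intros)
    next
      fix t assume "t \<in> {s..T}"
      then show "s \<le> m n t \<and> m n t \<le> T" using m(1)[of n t] m(2)[of t n] by auto
    qed
    moreover have "integral {s..m n t} (\<lambda>r. S (t - d n - r) (J (d n) (f r - f t))) = I n t" if "t \<in> {s..T}" for t
    proof (cases "t - d n \<le> s")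
      case True
      then show ?thesis by (simp add: I_def m_def max_def)
    next
      case False
      then show ?thesis unfolding I_def m_def
        by (intro integral_cong) (simp add: S_J d)
    qed
    ultimately show ?thesis by (subst continuous_on_cong[OF refl, of _ "I n"]) (auto simp del: atLeastAtMost_iff)
  qed
  have Z_cont: "continuous_on {s..T} Z"
  proof (rule uniform_limit_theorem[where F = sequentially and f = I])
    show "uniform_limit {s..T} I Z sequentially"
    proof (rule uniform_limitI)
      fix e :: real assume "e > 0"
      have "(\<lambda>n. L * d n) \<longlonglongrightarrow> L * 0" by (intro tendsto_intros d_lim)
      then have "\<forall>\<^sub>F n in sequentially. L * d n < e" by (rule order_tendstoD) (use \<open>e > 0\<close> in simp)
      then show "\<forall>\<^sub>F n in sequentially. \<forall>t\<in>{s..T}. dist (I n t) (Z t) < e"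
      proof eventually_elim
        case (elim n)
        show ?case
        proof
          fix t assume "t \<in> {s..T}"
          from I_Z_le[OF this, of n] elim show "dist (I n t) (Z t) < e"
            by (simp add: dist_norm norm_minus_commute)
        qed
      qed
    qed
  qed (auto simp: I_cont)
  show thesis
  proof
    \<comment> \<open>The term added to \<open>Z t\<close> is the limit of the closed form in
      \<open>integral_J\<close>: it restores the part of the integrand that was subtracted.\<close>
    show "continuous_on {s..T} (\<lambda>t. Z t + (S (t - s) (f t) - f t))"
      by (intro continuous_intros Z_cont fc)
    fix t assume t: "t \<in> {s..T}"
    show "gen (integral {s..t} (\<lambda>r. S (t - r) (f r))) (Z t + (S (t - s) (f t) - f t))"
    proof (cases "t = s")
      case True
      have "I n s = 0" for n by (simp add: I_def m)
      then have "Z s = 0" using I_Z[of s] t True by (simp add: LIMSEQ_const_iff)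
      then show ?thesis by (simp add: True gen_zero)
    next
      case False
      then have "s < t" using t by auto
      show ?thesis
      \<comment> \<open>The generator is closed, so the identity for the truncated integrals passes
        to the limit.\<close>
      proof (rule gen_lim)
        show "gen (integral {s..m n t} (\<lambda>r. S (t - r) (f r))) (I n t + (S (t - s) (f t) - S (t - m n t) (f t)))" for n
        proof -
          have lt: "m n t < t" using m(3) \<open>s < t\<close> .
          have "gen (integral {s..m n t} (\<lambda>r. S (t - r) (f r))) (integral {s..m n t} (\<lambda>r. J (t - r) (f r)))"
            using lt by (intro gen_integral continuous_intros continuous_on_J fc) (auto intro!: gen_J)
          also have "integral {s..m n t} (\<lambda>r. J (t - r) (f r)) =
              integral {s..m n t} (\<lambda>r. J (t - r) (f r - f t) + J (t - r) (f t))"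
            using lt by (intro integral_cong)
              (simp add: linear_diff[OF bounded_linear.linear[OF bounded_linear_J]])
          also have "\<dots> = I n t + integral {s..m n t} (\<lambda>r. J (t - r) (f t))"
            unfolding I_def by (rule Henstock_Kurzweil_Integration.integral_add)
              (auto intro!: integrable_continuous_real Jc lt continuous_on_J)
          also have "integral {s..m n t} (\<lambda>r. J (t - r) (f t)) = S (t - s) (f t) - S (t - m n t) (f t)"
            using m(1) lt by (rule integral_J)
          finally show ?thesis .
        qed
        have m_lim: "(\<lambda>n. m n t) \<longlonglongrightarrow> t"
        proof -
          have "(\<lambda>n. max s (t - d n)) \<longlonglongrightarrow> max s (t - 0)" by (intro tendsto_intros d_lim)
          then show ?thesis using t by (simp add: m_def max_def)
        qed
        have "continuous_on {s..t} (\<lambda>x. integral {s..x} (\<lambda>r. S (t - r) (f r)))"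
          by (intro indefinite_integral_continuous_1 integrable_continuous_real continuous_intros fc)
        then show "(\<lambda>n. integral {s..m n t} (\<lambda>r. S (t - r) (f r))) \<longlonglongrightarrow> integral {s..t} (\<lambda>r. S (t - r) (f r))"
          by (rule continuous_on_tendsto_compose[OF _ m_lim]) (use t m(1,2) in auto)
        have "(\<lambda>n. S (t - m n t) (f t)) \<longlonglongrightarrow> S (t - t) (f t)"
          by (intro tendsto_S tendsto_intros m_lim)
        then show "(\<lambda>n. I n t + (S (t - s) (f t) - S (t - m n t) (f t))) \<longlonglongrightarrow> Z t + (S (t - s) (f t) - f t)"
          by (intro tendsto_intros I_Z t) simp
      qed
    qed
  qed
qed

end

context perturbed
begin

section \<open>Regularity in time and the energy estimate\<close>

definition b :: real where "b = onorm B"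

lemma b_nonneg: "0 \<le> b" unfolding b_def by (rule onorm_pos_le[OF bounded_linear_B])

lemma norm_force_diff:
  "norm (\<kappa> q *\<^sub>R B v - \<kappa> r *\<^sub>R B w) \<le> M * norm (v - w) + \<bar>\<kappa> q - \<kappa> r\<bar> * (b * norm w)"
proof -
  have "\<kappa> q *\<^sub>R B v - \<kappa> r *\<^sub>R B w = \<kappa> q *\<^sub>R B (v - w) + (\<kappa> q - \<kappa> r) *\<^sub>R B w"
    by (simp add: B_simps algebra_simps)
  then have "norm (\<kappa> q *\<^sub>R B v - \<kappa> r *\<^sub>R B w) \<le> norm (\<kappa> q *\<^sub>R B (v - w)) + norm ((\<kappa> q - \<kappa> r) *\<^sub>R B w)"
    by (metis norm_triangle_ineq)
  also have "norm ((\<kappa> q - \<kappa> r) *\<^sub>R B w) \<le> \<bar>\<kappa> q - \<kappa> r\<bar> * (b * norm w)"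
    unfolding norm_scaleR real_norm_def b_def by (intro mult_left_mono onorm[OF bounded_linear_B]) auto
  finally show ?thesis using norm_kappa_B[of q "v - w"] by linarith
qed

text \<open>Gronwall's inequality for \<open>norm (u (t + h) - u t)\<close>. The shifted solution
  solves the same integral equation up to two errors of order \<open>h\<close>: the displacement
  during the first step, where \<open>gen x y\<close> enters, and the change of
  \<open>\<kappa>\<close> over a time \<open>h\<close>.\<close>

lemma sol_lipschitz:
  assumes "gen x y" "s \<le> T"
  obtains C where "C-lipschitz_on {s..T} (sol s x)"
proof -
  define u where "u = sol s x"
  have mild: "mild s x u" unfolding u_def by (rule mild_sol)
  define R where "R = norm x * exp (M * (T - s))"
  have R: "norm (u t) \<le> R" if "t \<in> {s..T}" for t
  proof -
    have "norm (u t) \<le> norm x * exp (M * (t - s))" using norm_mild_le[OF mild] that by simp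
    also have "\<dots> \<le> R" unfolding R_def using that M_nonneg by (intro mult_left_mono) (auto intro: mult_left_mono)
    finally show ?thesis .
  qed
  have "0 \<le> R" by (simp add: R_def)
  obtain L where L: "L-lipschitz_on {..T} \<kappa>" using kappa_lipschitz by blast
  have "0 \<le> L" using L by (rule lipschitz_on_nonneg)
  define F where "F r = \<kappa> r *\<^sub>R B (u r)" for r
  have Fc: "continuous_on X F" for X
    unfolding F_def by (intro continuous_intros continuous_mild[OF mild])
  have Fcomp: "continuous_on X g \<Longrightarrow> continuous_on X (\<lambda>x. F (g x))" for g and X :: "real set"
    by (rule continuous_on_compose2[OF Fc[of UNIV]]) auto
  have uc: "continuous_on X g \<Longrightarrow> continuous_on X (\<lambda>x. u (g x))" for g and X :: "real set"
    by (rule continuous_mild[OF mild])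
  \<comment> \<open>\<open>norm y\<close> bounds the effect of the semigroup and
    \<open>M * R\<close> that of the forcing over the first step,
    \<open>(T - s) * (L * b * R)\<close> the accumulated change of \<open>\<kappa>\<close>; the
    exponential is from Gronwall's inequality.\<close>
  define C where "C = (norm y + M * R + (T - s) * (L * b * R)) * exp (M * (T - s))"
  have *: "norm (u (t + h) - u t) \<le> C * h" if h: "0 \<le> h" and t: "s \<le> t" "t + h \<le> T" for t h
  proof -
    define g where "g r = norm (u (r + h) - u r)" for r
    have gc: "continuous_on X g" for X
      unfolding g_def by (intro continuous_intros uc)
    define K where "K = h * (norm y + M * R + (T - s) * (L * b * R))"
    have "0 \<le> K" unfolding K_def using assms(2) M_nonneg b_nonneg \<open>0 \<le> R\<close> \<open>0 \<le> L\<close> h by auto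
    have "g t \<le> K * exp (M * (t - s))"
    proof (rule gronwall[where b = "T - h"])
      fix r assume r: "r \<in> {s..T - h}"
      have init: "norm (u (s + h) - x) \<le> h * (norm y + M * R)"
      proof -
        have "u (s + h) - x = (S h x - x) - integral {s..s + h} (\<lambda>q. S (s + h - q) (F q))"
          using mild h unfolding mild_def F_def by simp
        then have "norm (u (s + h) - x) \<le> norm (S h x - x) + norm (integral {s..s + h} (\<lambda>q. S (s + h - q) (F q)))"
          by (metis norm_triangle_ineq4)
        moreover have "norm (S h x - x) \<le> h * norm y"
          using norm_S_diff_gen[OF assms(1), of h 0] h by simp
        moreover have "norm (integral {s..s + h} (\<lambda>q. S (s + h - q) (F q))) \<le> M * R * (s + h - s)"
        proof (rule integral_bound)
          fix q assume "q \<in> {s..s + h}"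
          then have "norm (u q) \<le> R" using t by (intro R) auto
          then show "norm (S (s + h - q) (F q)) \<le> M * R"
            unfolding F_def
            by (intro order_trans[OF norm_S order_trans[OF norm_kappa_B mult_left_mono]] M_nonneg)
        qed (use h in \<open>auto intro!: continuous_intros Fc\<close>)
        ultimately show ?thesis by (simp add: algebra_simps)
      qed
      \<comment> \<open>Starting from \<open>s + h\<close> makes the shifted integral run over the
        same interval from \<open>s\<close> to \<open>r\<close> as the unshifted one.\<close>
      have "u (r + h) = S (r - s) (u (s + h)) - integral {s + h..r + h} (\<lambda>q. S (r + h - q) (F q))"
        using mild_step[OF mild, of "s + h" "r + h"] h r unfolding F_def by simp
      also have "integral {s + h..r + h} (\<lambda>q. S (r + h - q) (F q)) = integral {s..r} (\<lambda>q. S (r - q) (F (q + h)))"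
        using integral_shift_Icc_real[of s r "\<lambda>q. S (r + h - q) (F q)" h]
        by (simp add: o_def add.commute)
      finally have "u (r + h) - u r = S (r - s) (u (s + h) - x)
          - (integral {s..r} (\<lambda>q. S (r - q) (F (q + h))) - integral {s..r} (\<lambda>q. S (r - q) (F q)))"
        using mild r unfolding mild_def F_def by (simp add: S_simps)
      also have "integral {s..r} (\<lambda>q. S (r - q) (F (q + h))) - integral {s..r} (\<lambda>q. S (r - q) (F q)) =
          integral {s..r} (\<lambda>q. S (r - q) (F (q + h)) - S (r - q) (F q))"
        by (rule Henstock_Kurzweil_Integration.integral_diff[symmetric])
          (intro integrable_continuous_real continuous_intros Fc Fcomp)+
      finally have "g r \<le> norm (S (r - s) (u (s + h) - x)) + norm (integral {s..r} (\<lambda>q. S (r - q) (F (q + h)) - S (r - q) (F q)))"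
        unfolding g_def by (simp only: norm_triangle_ineq4)
      also have "norm (S (r - s) (u (s + h) - x)) \<le> h * (norm y + M * R)"
        by (rule order_trans[OF norm_S init])
      also have "norm (integral {s..r} (\<lambda>q. S (r - q) (F (q + h)) - S (r - q) (F q))) \<le>
          integral {s..r} (\<lambda>q. M * g q + L * h * (b * R))"
      proof (rule integral_norm_bound_integral)
        fix q assume q: "q \<in> {s..r}"
        have "norm (S (r - q) (F (q + h)) - S (r - q) (F q)) \<le> norm (F (q + h) - F q)"
          unfolding S_simps[symmetric] by (rule norm_S)
        also have "\<dots> \<le> M * g q + \<bar>\<kappa> (q + h) - \<kappa> q\<bar> * (b * norm (u q))"
          unfolding F_def g_def by (rule norm_force_diff)
        also have "\<bar>\<kappa> (q + h) - \<kappa> q\<bar> \<le> L * h"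
          using lipschitz_on_normD[OF L, of "q + h" q] q r h by simp
        also have "norm (u q) \<le> R" by (rule R) (use q r h in auto)
        finally show "norm (S (r - q) (F (q + h)) - S (r - q) (F q)) \<le> M * g q + L * h * (b * R)"
          using b_nonneg \<open>0 \<le> L\<close> h by (simp add: mult_left_mono mult_right_mono)
      qed (intro integrable_continuous_real continuous_intros Fc Fcomp gc)+
      also have "integral {s..r} (\<lambda>q. M * g q + L * h * (b * R)) = M * integral {s..r} g + (r - s) * (L * h * (b * R))"
        using r by (subst Henstock_Kurzweil_Integration.integral_add)
          (auto intro!: integrable_continuous_real continuous_intros gc)
      also have "(r - s) * (L * h * (b * R)) \<le> (T - s) * (L * h * (b * R))"
        using r h b_nonneg \<open>0 \<le> L\<close> \<open>0 \<le> R\<close> by (intro mult_right_mono) auto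
      finally show "g r \<le> K + M * integral {s..r} g" by (simp add: K_def algebra_simps)
    qed (use t h M_nonneg gc in auto)
    also have "\<dots> \<le> K * exp (M * (T - s))"
      using \<open>0 \<le> K\<close> M_nonneg t h by (intro mult_left_mono) (auto intro: mult_left_mono)
    finally show ?thesis by (simp add: g_def K_def C_def mult_ac)
  qed
  have "C-lipschitz_on {s..T} u"
  proof (rule lipschitz_onI)
    show "0 \<le> C" unfolding C_def using assms(2) M_nonneg b_nonneg \<open>0 \<le> R\<close> \<open>0 \<le> L\<close> by auto
    fix p q assume "p \<in> {s..T}" "q \<in> {s..T}"
    then show "dist (u p) (u q) \<le> C * dist p q"
    proof (induction p q rule: linorder_wlog)
      case (le p q)
      then show ?case using *[of "q - p" p] by (simp add: dist_norm norm_minus_commute)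
    next
      case (sym p q)
      then show ?case by (simp add: dist_commute)
    qed
  qed
  then show ?thesis using that by (simp add: u_def)
qed

text \<open>The forcing inherits a Lipschitz bound on each \<open>{s..T}\<close> from the solution
  and from \<open>\<kappa>\<close>, so that \<open>duhamel_gen\<close> applies there. The generator
  being single valued, the functions obtained on different intervals agree.\<close>

lemma sol_gen:
  assumes "gen x y"
  obtains z where "continuous_on {s..} z" "\<And>t. s \<le> t \<Longrightarrow> gen (sol s x t) (z t)"
proof -
  define u where "u = sol s x"
  have mild: "mild s x u" unfolding u_def by (rule mild_sol)
  define F where "F r = \<kappa> r *\<^sub>R B (u r)" for r
  have Fc: "continuous_on X F" for X
    unfolding F_def by (intro continuous_intros continuous_mild[OF mild])
  have *: "\<exists>z. continuous_on {s..T} z \<and> (\<forall>t\<in>{s..T}. gen (u t) (z t))" if T: "s \<le> T" for T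
  proof -
    obtain C where C: "C-lipschitz_on {s..T} u"
      using sol_lipschitz[OF assms T] unfolding u_def by blast
    obtain L where L: "L-lipschitz_on {..T} \<kappa>" using kappa_lipschitz by blast
    have "continuous_on {s..T} (\<lambda>t. norm (u t))" by (intro continuous_intros continuous_mild[OF mild])
    then obtain R where R: "\<And>t. t \<in> {s..T} \<Longrightarrow> norm (u t) \<le> R"
      using continuous_attains_sup[OF compact_Icc] T by (metis atLeastatMost_empty_iff2)
    have "0 \<le> R" using R[of s] T norm_ge_zero[of "u s"] by (smt (verit) atLeastAtMost_iff)
    have "(M * C + L * (b * R))-lipschitz_on {s..T} F"
    proof (rule lipschitz_onI)
      show "0 \<le> M * C + L * (b * R)"
        using lipschitz_on_nonneg[OF C] lipschitz_on_nonneg[OF L] M_nonneg b_nonneg \<open>0 \<le> R\<close> by auto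
      fix p q assume pq: "p \<in> {s..T}" "q \<in> {s..T}"
      have "dist (F p) (F q) \<le> M * norm (u p - u q) + \<bar>\<kappa> p - \<kappa> q\<bar> * (b * norm (u q))"
        unfolding F_def dist_norm by (rule norm_force_diff)
      also have "\<dots> \<le> M * (C * dist p q) + L * dist p q * (b * R)"
        using lipschitz_onD[OF C pq] lipschitz_onD[OF L, of p q] pq R[OF pq(2)] M_nonneg b_nonneg
          lipschitz_on_nonneg[OF L]
        by (intro add_mono mult_mono) (auto simp: dist_norm)
      finally show "dist (F p) (F q) \<le> (M * C + L * (b * R)) * dist p q" by (simp add: algebra_simps)
    qed
    from duhamel_gen[OF Fc this] obtain z where z: "continuous_on {s..T} z"
      "\<And>t. t \<in> {s..T} \<Longrightarrow> gen (integral {s..t} (\<lambda>r. S (t - r) (F r))) (z t)" by blast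
    have "gen (u t) (S (t - s) y - z t)" if t: "t \<in> {s..T}" for t
    proof -
      have "u t = S (t - s) x - integral {s..t} (\<lambda>r. S (t - r) (F r))"
        using mild t unfolding mild_def F_def by simp
      then show ?thesis using z(2)[OF t] gen_S[OF assms] by (simp add: gen_diff)
    qed
    moreover have "continuous_on {s..T} (\<lambda>t. S (t - s) y - z t)" by (intro continuous_intros z)
    ultimately show ?thesis by blast
  qed
  define z where "z t = (THE w. gen (u t) w)" for t
  have z_eq: "gen (u t) w \<Longrightarrow> z t = w" for t w
    unfolding z_def by (rule the_equality) (auto intro: gen_unique)
  show thesis
  proof
    show "gen (sol s x t) (z t)" if "s \<le> t" for t
      using *[OF that] z_eq that unfolding u_def by fastforce
    have "continuous_on {s..T} z" if T: "s \<le> T" for T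
    proof -
      obtain z' where z': "continuous_on {s..T} z'" "\<forall>t\<in>{s..T}. gen (u t) (z' t)" using *[OF T] by blast
      then show ?thesis by (subst continuous_on_cong[OF refl, of _ z z']) (auto intro: z_eq)
    qed
    then have cont: "continuous_on {s..max s T} z" for T by simp
    have "continuous (at t within {s..}) z" if "s \<le> t" for t
    proof -
      have "continuous (at t within {s..t + 1}) z" using cont[of "t + 1"] that
        by (simp add: continuous_on_eq_continuous_within max_def)
      moreover have "at t within {s..t + 1} = at t within {s..}"
        by (rule at_within_nhd[where S = "{t - 1<..<t + 1}"]) auto
      ultimately show ?thesis by simp
    qed
    then show "continuous_on {s..} z" by (simp add: continuous_on_eq_continuous_within)
  qed
qed

lemma sol_derivative:
  assumes z: "continuous_on {s..} z" "\<And>t. s \<le> t \<Longrightarrow> gen (sol s x t) (z t)" and t0: "s \<le> t0"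
  shows "(sol s x has_vector_derivative z t0 - \<kappa> t0 *\<^sub>R B (sol s x t0)) (at t0 within {s..})"
proof -
  define u where "u = sol s x"
  have mild: "mild s x u" unfolding u_def by (rule mild_sol)
  define F where "F r = \<kappa> r *\<^sub>R B (u r)" for r
  have Fc: "continuous_on X F" for X
    unfolding F_def by (intro continuous_intros continuous_mild[OF mild])
  define D where "D = z t0 - F t0"
  \<comment> \<open>Expanding around the left point \<open>t\<close>, where the solution lies in the
    domain, merges the semigroup term and the forcing into one integral over \<open>{t..t'}\<close>,
    whose integrand is small near \<open>t0\<close>.\<close>
  have step: "u t' - u t - (t' - t) *\<^sub>R D = integral {t..t'} (\<lambda>q. S (t' - q) (z t - F q) - D)"
    if "s \<le> t" "t \<le> t'" for t t'
  proof -
    have "u t' - u t = (S (t' - t) (u t) - u t) - integral {t..t'} (\<lambda>q. S (t' - q) (F q))"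
      using mild_step[OF mild that] by (simp add: F_def)
    also have "S (t' - t) (u t) - u t = integral {t..t'} (\<lambda>q. S (t' - q) (z t))"
      using integral_S_gen[of "u t" "z t" t t'] z(2) that by (simp add: u_def)
    also have "integral {t..t'} (\<lambda>q. S (t' - q) (z t)) - integral {t..t'} (\<lambda>q. S (t' - q) (F q)) =
        integral {t..t'} (\<lambda>q. S (t' - q) (z t - F q))"
      unfolding S_simps
      by (rule Henstock_Kurzweil_Integration.integral_diff[symmetric])
        (intro integrable_continuous_real continuous_intros Fc)+
    finally have "u t' - u t - (t' - t) *\<^sub>R D = integral {t..t'} (\<lambda>q. S (t' - q) (z t - F q)) - integral {t..t'} (\<lambda>q. D)"
      using that by simp
    also have "\<dots> = integral {t..t'} (\<lambda>q. S (t' - q) (z t - F q) - D)"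
      by (rule Henstock_Kurzweil_Integration.integral_diff[symmetric])
        (intro integrable_continuous_real continuous_intros Fc)+
    finally show ?thesis .
  qed
  \<comment> \<open>Mild solutions can be stepped forward only. An estimate for two arbitrary times
    near \<open>t0\<close> covers the right difference quotient with \<open>t = t0\<close> and the
    left one with \<open>t' = t0\<close>.\<close>
  have *: "\<exists>d>0. \<forall>t t'. s \<le> t \<longrightarrow> t0 - d < t \<longrightarrow> t \<le> t' \<longrightarrow> t' < t0 + d \<longrightarrow>
      norm (u t' - u t - (t' - t) *\<^sub>R D) \<le> e * (t' - t)" if "e > 0" for e
  proof -
    have e3: "e / 3 > 0" using that by simp
    obtain d1 where d1: "d1 > 0" "\<And>t. s \<le> t \<Longrightarrow> \<bar>t - t0\<bar> < d1 \<Longrightarrow> norm (z t - z t0) < e / 3"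
      using z(1) t0 e3 unfolding continuous_on_iff by (metis atLeast_iff dist_norm real_norm_def)
    obtain d2 where d2: "d2 > 0" "\<And>t. \<bar>t - t0\<bar> < d2 \<Longrightarrow> norm (F t - F t0) < e / 3"
      using Fc[of UNIV] e3 unfolding continuous_on_iff by (metis UNIV_I dist_norm real_norm_def)
    obtain d3 where d3: "d3 > 0" "\<And>t. \<bar>t\<bar> < d3 \<Longrightarrow> norm (S t D - D) < e / 3"
      using S_continuous[of UNIV D] e3 unfolding continuous_on_iff
      by (metis S_0 UNIV_I diff_zero dist_norm real_norm_def)
    \<comment> \<open>The half is there because the time \<open>t' - q\<close> can come close to
      \<open>2 * d\<close>.\<close>
    define d where "d = min (min d1 d2) (d3 / 2)"
    have "d > 0" "d \<le> d1" "d \<le> d2" "2 * d \<le> d3" using d1 d2 d3 by (auto simp: d_def)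
    show ?thesis
    proof (intro exI conjI allI impI)
      show "d > 0" by fact
      fix t t' assume t: "s \<le> t" "t0 - d < t" "t \<le> t'" "t' < t0 + d"
      show "norm (u t' - u t - (t' - t) *\<^sub>R D) \<le> e * (t' - t)"
        unfolding step[OF t(1,3)]
      proof (rule integral_bound)
        fix q assume q: "q \<in> {t..t'}"
        have "S (t' - q) (z t - F q) - D = S (t' - q) (z t - z t0) - S (t' - q) (F q - F t0) + (S (t' - q) D - D)"
          by (simp add: D_def S_simps)
        then have "norm (S (t' - q) (z t - F q) - D) \<le>
            norm (S (t' - q) (z t - z t0)) + norm (S (t' - q) (F q - F t0)) + norm (S (t' - q) D - D)"
          by (smt (verit) norm_triangle_ineq norm_triangle_ineq4)
        also have "\<dots> \<le> norm (z t - z t0) + norm (F q - F t0) + norm (S (t' - q) D - D)"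
          by (intro add_mono norm_S order_refl)
        also have "\<dots> \<le> e / 3 + e / 3 + e / 3"
          by (intro add_mono order.strict_implies_order[OF d1(2)] order.strict_implies_order[OF d2(2)]
              order.strict_implies_order[OF d3(2)]) (use t q \<open>d \<le> d1\<close> \<open>d \<le> d2\<close> \<open>2 * d \<le> d3\<close> in auto)
        finally show "norm (S (t' - q) (z t - F q) - D) \<le> e" by simp
      qed (use t in \<open>auto intro!: continuous_intros Fc\<close>)
    qed
  qed
  have "(u has_derivative (\<lambda>h. h *\<^sub>R D)) (at t0 within {s..})"
    unfolding has_derivative_within_alt
  proof (intro conjI allI impI)
    show "bounded_linear (\<lambda>h. h *\<^sub>R D)" by (rule bounded_linear_scaleR_left)
    fix e :: real assume "e > 0"
    from *[OF this] obtain d where d: "d > 0" "\<And>t t'. s \<le> t \<Longrightarrow> t0 - d < t \<Longrightarrow> t \<le> t' \<Longrightarrow> t' < t0 + d \<Longrightarrow>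
      norm (u t' - u t - (t' - t) *\<^sub>R D) \<le> e * (t' - t)" by blast
    have "norm (u t - u t0 - (t - t0) *\<^sub>R D) \<le> e * norm (t - t0)" if t: "s \<le> t" "\<bar>t - t0\<bar> < d" for t
    proof (cases "t0 \<le> t")
      case True
      then show ?thesis using d(2)[of t0 t] t t0 d(1) by simp
    next
      case False
      have "u t - u t0 - (t - t0) *\<^sub>R D = - (u t0 - u t - (t0 - t) *\<^sub>R D)" by (simp add: algebra_simps)
      then show ?thesis using d(2)[of t t0] t t0 d(1) False by (simp only: norm_minus_cancel) auto
    qed
    then show "\<exists>d>0. \<forall>y\<in>{s..}. norm (y - t0) < d \<longrightarrow> norm (u y - u t0 - (y - t0) *\<^sub>R D) \<le> e * norm (y - t0)"
      using d(1) by auto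
  qed
  then show ?thesis by (simp add: has_vector_derivative_def D_def F_def u_def)
qed

text \<open>\<open>\<alpha>\<close> is any real number, so that one estimate gives contractivity for
  the value 0 and exponential decay for the coercivity constant.\<close>

lemma norm_sol_le:
  assumes diss: "\<And>t v w. s \<le> t \<Longrightarrow> gen v w \<Longrightarrow> (w - \<kappa> t *\<^sub>R B v) \<bullet> v \<le> - \<alpha> * (norm v)\<^sup>2"
    and t: "s \<le> t"
  shows "norm (sol s x t) \<le> exp (- \<alpha> * (t - s)) * norm x"
proof -
  have gen: "norm (sol s x t) \<le> exp (- \<alpha> * (t - s)) * norm x" if xy: "gen x y" for x y
  proof -
    obtain z where z: "continuous_on {s..} z" "\<And>t. s \<le> t \<Longrightarrow> gen (sol s x t) (z t)"
      using sol_gen[OF xy] by blast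
    define u where "u = sol s x"
    define D where "D t = z t - \<kappa> t *\<^sub>R B (u t)" for t
    define h where "h t = exp (2 * \<alpha> * (t - s)) * (u t \<bullet> u t)" for t
    have u': "(u has_vector_derivative D t) (at t within {s..})" if "s \<le> t" for t
      unfolding u_def D_def by (rule sol_derivative[OF z that])
    have h': "(h has_real_derivative exp (2 * \<alpha> * (t - s)) * (2 * \<alpha> * (u t \<bullet> u t) + 2 * (D t \<bullet> u t))) (at t within {s..})"
      if "s \<le> t" for t
    proof -
      have "((\<lambda>t. u t \<bullet> u t) has_derivative (\<lambda>h. u t \<bullet> (h *\<^sub>R D t) + (h *\<^sub>R D t) \<bullet> u t)) (at t within {s..})"
        using u'[OF that] unfolding has_vector_derivative_def by (intro has_derivative_inner)
      then have "((\<lambda>t. u t \<bullet> u t) has_real_derivative 2 * (D t \<bullet> u t)) (at t within {s..})"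
        unfolding has_field_derivative_def
        by (rule has_derivative_eq_rhs) (auto simp: inner_commute)
      then show ?thesis unfolding h_def
        by (auto intro!: derivative_eq_intros simp: algebra_simps)
    qed
    have "h t \<le> h s"
    proof (rule DERIV_nonpos_imp_decreasing_open[OF t])
      show "continuous_on {s..t} h"
        unfolding h_def u_def by (intro continuous_intros continuous_mild[OF mild_sol])
      fix r assume r: "s < r" "r < t"
      then have "at r within {s..} = at r" by (intro at_within_interior) (simp add: interior_Ici)
      moreover have "2 * \<alpha> * (u r \<bullet> u r) + 2 * (D r \<bullet> u r) \<le> 0"
        using diss[OF _ z(2)[of r], of r] r by (simp add: D_def u_def power2_norm_eq_inner)
      ultimately show "\<exists>y. (h has_real_derivative y) (at r) \<and> y \<le> 0"
        using h'[of r] r by (auto intro!: exI mult_nonneg_nonpos)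
    qed
    also have "h s = (norm x)\<^sup>2" by (simp add: h_def u_def sol_init power2_norm_eq_inner)
    finally have "(exp (\<alpha> * (t - s)) * norm (u t))\<^sup>2 \<le> (norm x)\<^sup>2"
      by (simp add: h_def power_mult_distrib power2_norm_eq_inner exp_double[symmetric] mult.assoc)
    then have "exp (\<alpha> * (t - s)) * norm (u t) \<le> norm x" by (rule power2_le_imp_le) simp
    from mult_left_mono[OF this, of "exp (- \<alpha> * (t - s))"] show ?thesis
      by (simp add: u_def mult.assoc[symmetric] exp_add[symmetric])
  qed
  show ?thesis
  proof (rule field_le_epsilon)
    fix e :: real assume "e > 0"
    \<comment> \<open>\<open>E\<close> collects the factors of the approximation error: the crude
      growth bound for the solution started at \<open>x - w\<close>, and the decay factor that comes
      with replacing \<open>norm w\<close> by \<open>norm x\<close>.\<close>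
    define E where "E = exp (M * (t - s)) + exp (- \<alpha> * (t - s))"
    have "E > 0" by (simp add: E_def add_pos_pos)
    then obtain w y where wy: "gen w y" "norm (x - w) < e / E"
      using gen_dense[of "e / E" x] \<open>e > 0\<close> by auto
    have "sol s x t = sol s (x - w) t + sol s w t"
      using linear_add[OF bounded_linear.linear[OF bounded_linear_sol[OF t]], of "x - w" w] by simp
    then have "norm (sol s x t) \<le> norm (sol s (x - w) t) + norm (sol s w t)"
      by (metis norm_triangle_ineq)
    also have "\<dots> \<le> norm (x - w) * exp (M * (t - s)) + exp (- \<alpha> * (t - s)) * norm w"
      by (intro add_mono norm_mild_le[OF mild_sol t] gen[OF wy(1)])
    also have "exp (- \<alpha> * (t - s)) * norm w \<le> exp (- \<alpha> * (t - s)) * (norm x + norm (x - w))"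
      by (intro mult_left_mono) (auto intro: norm_triangle_sub[of w x, unfolded norm_minus_commute[of w]])
    finally have "norm (sol s x t) \<le> exp (- \<alpha> * (t - s)) * norm x + E * norm (x - w)"
      by (simp add: E_def algebra_simps)
    also have "E * norm (x - w) \<le> e" using wy(2) \<open>E > 0\<close> by (simp add: field_simps)
    finally show "norm (sol s x t) \<le> exp (- \<alpha> * (t - s)) * norm x + e" by simp
  qed
qed

section \<open>Contractivity and joint continuity\<close>

lemma norm_sol_le_1: "s \<le> t \<Longrightarrow> norm (sol s x t) \<le> norm x"
  using norm_sol_le[of s 0 t x] gen_nonpos B_nonneg kappa_nonneg
  by (simp add: inner_diff_left) (smt (verit) mult_nonneg_nonneg)

lemma sol_diff: "s \<le> t \<Longrightarrow> sol s x t - sol s y t = sol s (x - y) t"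
  using linear_diff[OF bounded_linear.linear[OF bounded_linear_sol]] by metis

text \<open>The bound depends on the times only through \<open>t - s\<close>. This makes continuity
  at the initial time uniform in the starting time, as joint continuity demands.\<close>

lemma norm_sol_minus_init:
  assumes "s \<le> t"
  shows "norm (sol s x t - x) \<le> norm (S (t - s) x - x) + M * norm x * (t - s)"
proof -
  have "sol s x t - x = (S (t - s) x - x) - integral {s..t} (\<lambda>r. S (t - r) (\<kappa> r *\<^sub>R B (sol s x r)))"
    using mild_sol[of s x] assms unfolding mild_def by simp
  then have "norm (sol s x t - x) \<le> norm (S (t - s) x - x) + norm (integral {s..t} (\<lambda>r. S (t - r) (\<kappa> r *\<^sub>R B (sol s x r))))"
    by (metis norm_triangle_ineq4)
  also have "norm (integral {s..t} (\<lambda>r. S (t - r) (\<kappa> r *\<^sub>R B (sol s x r)))) \<le> M * norm x * (t - s)"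
  proof (rule integral_bound[OF assms])
    show "norm (S (t - r) (\<kappa> r *\<^sub>R B (sol s x r))) \<le> M * norm x" if "r \<in> {s..t}" for r
      using that by (intro order_trans[OF norm_S order_trans[OF norm_kappa_B mult_left_mono]] M_nonneg norm_sol_le_1) auto
  qed (intro continuous_intros continuous_mild[OF mild_sol])
  finally show ?thesis by simp
qed

text \<open>Two starting times are compared at the later one, where the earlier trajectory has
  barely moved from \<open>x\<close>; contractivity keeps the gap small afterwards. The final time
  is handled by continuity of a single trajectory.\<close>

lemma sol_jointly_continuous:
  "continuous_on {(t, s). s \<le> t} (\<lambda>(t, s). sol s x t)"
  unfolding continuous_on_iff
proof (intro ballI allI impI)
  fix p :: "real \<times> real" and e :: real assume "p \<in> {(t, s). s \<le> t}" and e: "e > 0"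
  then obtain t s where [simp]: "p = (t, s)" and ts: "s \<le> t" by auto
  have "((\<lambda>h. norm (S h x - x) + M * norm x * h) \<longlongrightarrow> norm (S 0 x - x) + M * norm x * 0) (at 0)"
    by (intro tendsto_intros tendsto_S)
  then have "\<forall>\<^sub>F h in at 0. norm (S h x - x) + M * norm x * h < e / 2"
    by (rule order_tendstoD) (use e in simp)
  then obtain d1 where d1: "d1 > 0" "\<And>h. h \<noteq> 0 \<Longrightarrow> \<bar>h\<bar> < d1 \<Longrightarrow> norm (S h x - x) + M * norm x * h < e / 2"
    unfolding eventually_at by (auto simp: dist_real_def)
  have small: "norm (sol r x q - x) < e / 2" if "r \<le> q" "q - r < d1" for r q
    using norm_sol_minus_init[of r q x] d1(2)[of "q - r"] that e by (cases "q = r") (auto simp: sol_init)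
  obtain d2 where d2: "d2 > 0" "\<And>q. \<bar>q - t\<bar> < d2 \<Longrightarrow> norm (sol s x q - sol s x t) < e / 2"
    using mild_cont[OF mild_sol, of s x] e unfolding continuous_on_iff
    by (metis UNIV_I dist_norm half_gt_zero real_norm_def)
  have near: "norm (sol q x r - sol s x r) < e / 2" if "s \<le> r" "q \<le> r" "\<bar>q - s\<bar> < d1" for q r
  proof (cases "s \<le> q")
    case True
    have "norm (sol q x r - sol s x r) = norm (sol q (x - sol s x q) r)"
      using sol_sol[OF True that(2), of x] sol_diff[OF that(2)] by metis
    also have "\<dots> \<le> norm (sol s x q - x)" using norm_sol_le_1[OF that(2)] by (metis norm_minus_commute)
    also have "\<dots> < e / 2" using that by (intro small True) linarith
    finally show ?thesis .
  next
    case False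
    then have "q \<le> s" by simp
    have "norm (sol q x r - sol s x r) = norm (sol s (sol q x s - x) r)"
      using sol_sol[OF \<open>q \<le> s\<close> that(1), of x] sol_diff[OF that(1)] by metis
    also have "\<dots> \<le> norm (sol q x s - x)" using norm_sol_le_1[OF that(1)] .
    also have "\<dots> < e / 2" using that by (intro small \<open>q \<le> s\<close>) linarith
    finally show ?thesis .
  qed
  have "\<exists>d>0. \<forall>p'\<in>{(t, s). s \<le> t}. dist p' (t, s) < d \<longrightarrow>
      dist (case p' of (t, s) \<Rightarrow> sol s x t) (sol s x t) < e"
  \<comment> \<open>On the diagonal a neighbouring final time can lie before \<open>s\<close>, so
    there the value is compared with \<open>x\<close> directly.\<close>
  proof (cases "s = t")
    case True
    show ?thesis
    proof (intro exI[of _ "d1 / 2"] conjI ballI impI)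
      fix p' assume p': "p' \<in> {(t, s). s \<le> t}" "dist p' (t, s) < d1 / 2"
      obtain t' s' where [simp]: "p' = (t', s')" by (cases p')
      have "\<bar>t' - t\<bar> < d1 / 2" "\<bar>s' - s\<bar> < d1 / 2"
        using p'(2) dist_fst_le[of p' "(t, s)"] dist_snd_le[of p' "(t, s)"] by (auto simp: dist_real_def)
      then have "t' - s' < d1" using True by linarith
      then show "dist (case p' of (t, s) \<Rightarrow> sol s x t) (sol s x t) < e"
        using small[of s' t'] p'(1) True e by (auto simp: dist_norm sol_init)
    qed (use d1 in simp)
  next
    case False
    \<comment> \<open>The last entry keeps the perturbed final time after \<open>s\<close>, as
      \<open>near\<close> requires.\<close>
    define d where "d = min (min d1 d2) ((t - s) / 2)"
    have d: "d > 0" "d \<le> d1" "d \<le> d2" "2 * d \<le> t - s" using d1(1) d2(1) False ts by (auto simp: d_def min_def)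
    show ?thesis
    proof (intro exI[of _ d] conjI ballI impI)
      fix p' assume p': "p' \<in> {(t, s). s \<le> t}" "dist p' (t, s) < d"
      obtain t' s' where [simp]: "p' = (t', s')" by (cases p')
      have *: "\<bar>t' - t\<bar> < d" "\<bar>s' - s\<bar> < d"
        using p'(2) dist_fst_le[of p' "(t, s)"] dist_snd_le[of p' "(t, s)"] by (auto simp: dist_real_def)
      have "norm (sol s' x t' - sol s x t) \<le> norm (sol s' x t' - sol s x t') + norm (sol s x t' - sol s x t)"
        using norm_triangle_ineq[of "sol s' x t' - sol s x t'" "sol s x t' - sol s x t"] by simp
      also have "\<dots> < e / 2 + e / 2"
        using * d p'(1) by (intro add_strict_mono near d2(2)) auto
      finally show "dist (case p' of (t, s) \<Rightarrow> sol s x t) (sol s x t) < e" by (simp add: dist_norm)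
    qed (use d in simp)
  qed
  then show "\<exists>d>0. \<forall>p'\<in>{(t, s). s \<le> t}. dist p' p < d \<longrightarrow>
      dist (case p' of (t, s) \<Rightarrow> sol s x t) (case p of (t, s) \<Rightarrow> sol s x t) < e" by simp
qed

end

section \<open>Periodic functions and the trigonometric system\<close>

definition cube :: "(real^3) set" where "cube = {x. \<forall>i. 0 \<le> x $ i \<and> x $ i < 1}"

lemma torus_eq: "torus = lebesgue_on cube"
  by (simp add: torus_def cube_def)

lemma cube_sets [measurable]: "cube \<in> sets lebesgue"
proof -
  have "cube \<in> sets borel" unfolding cube_def by measurable
  then show ?thesis by simp
qed

lemma space_torus: "space torus = cube"
  by (simp add: torus_eq space_restrict_space)

lemma cube_subset: "cube \<subseteq> cbox 0 1" "box 0 1 \<subseteq> cube"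
  by (auto simp: cube_def mem_box_cart less_imp_le)

interpretation torus: finite_measure torus
  by (rule finite_measureI) (use emeasure_torus_finite in auto)

lemma continuous_integrable_torus:
  assumes "continuous_on UNIV (f :: real^3 \<Rightarrow> real)"
  shows "integrable torus f"
proof -
  have meas: "f \<in> borel_measurable torus"
    unfolding torus_def
    by (intro measurable_restrict_space1 measurable_completion)
      (use borel_measurable_continuous_onI[OF assms] in simp)
  have "bounded (f ` cbox 0 1)"
    by (intro compact_imp_bounded compact_continuous_image continuous_on_subset[OF assms]) auto
  then obtain B where "\<forall>x\<in>cbox 0 1. norm (f x) \<le> B" by (auto simp: bounded_iff)
  then show ?thesis
    using cube_subset by (intro torus.integrable_const_bound[OF _ meas, of B] AE_I2) (auto simp: space_torus)
qed

lemma integral_torus_continuous: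
  assumes "continuous_on UNIV (f :: real^3 \<Rightarrow> real)"
  shows "integral\<^sup>L torus f = integral (cbox 0 1) f"
proof -
  have "integral\<^sup>L torus f = integral cube f"
    unfolding torus_eq using continuous_integrable_torus[OF assms]
    by (intro lebesgue_integral_eq_integral) (auto simp: torus_eq)
  also have "\<dots> = integral (cbox 0 1) f"
    by (rule integral_spike_set; rule negligible_subset[OF negligible_frontier_interval[of "0 :: real^3" 1]])
      (use cube_subset in auto)
  finally show ?thesis .
qed

text \<open>The box extended by \<open>s\<close> along the axis is cut in two ways, at
  \<open>s\<close> and at 1. The cubes that remain are the translated and the original one, and the
  two slabs cut off differ by a full period.\<close>

lemma integral_cube_translate:
  fixes g :: "real^3 \<Rightarrow> real"
  assumes g: "continuous_on UNIV g" and per: "\<And>x. g (x + axis i 1) = g x" and s: "0 \<le> s" "s \<le> 1"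
  shows "integral (cbox 0 1) (\<lambda>x. g (x + s *\<^sub>R axis i 1)) = integral (cbox 0 1) g"
proof -
  let ?e = "axis i 1 :: real^3"
  have e: "?e \<in> Basis" by (simp add: axis_in_Basis_iff)
  have int: "g integrable_on cbox a b" for a b
    by (rule integrable_continuous) (rule continuous_on_subset[OF g], simp)
  have ax: "x \<bullet> ?e = x $ i" for x by (simp add: inner_axis)
  have s1: "cbox 0 (1 + s *\<^sub>R ?e) \<inter> {x. x \<bullet> ?e \<le> s} = cbox 0 (1 + s *\<^sub>R ?e - ?e)"
    "cbox 0 (1 + s *\<^sub>R ?e) \<inter> {x. x \<bullet> ?e \<ge> s} = cbox (0 + s *\<^sub>R ?e) (1 + s *\<^sub>R ?e)"
    "cbox 0 (1 + s *\<^sub>R ?e) \<inter> {x. x \<bullet> ?e \<le> 1} = cbox 0 1"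
    "cbox 0 (1 + s *\<^sub>R ?e) \<inter> {x. x \<bullet> ?e \<ge> 1} = cbox ?e (1 + s *\<^sub>R ?e)"
    unfolding ax using s
    by (auto simp: mem_box_cart axis_def vec_eq_iff split: if_splits; smt (verit, best))+
  have "integral (cbox 0 (1 + s *\<^sub>R ?e - ?e)) g = integral (cbox (?e - ?e) (1 + s *\<^sub>R ?e - ?e)) (\<lambda>x. g (x + ?e))"
    by (simp add: per)
  also have "\<dots> = integral (cbox ?e (1 + s *\<^sub>R ?e)) g" by (rule integral_shift_cbox)
  finally have 1: "integral (cbox 0 (1 + s *\<^sub>R ?e - ?e)) g = integral (cbox ?e (1 + s *\<^sub>R ?e)) g" .
  have 2: "integral (cbox 0 1) (\<lambda>x. g (x + s *\<^sub>R ?e)) = integral (cbox (0 + s *\<^sub>R ?e) (1 + s *\<^sub>R ?e)) g"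
    using integral_shift_cbox[of "0 + s *\<^sub>R ?e" "s *\<^sub>R ?e" "1 + s *\<^sub>R ?e" g] by simp
  show ?thesis
    using integral_split[OF int e, of 0 "1 + s *\<^sub>R ?e" s] integral_split[OF int e, of 0 "1 + s *\<^sub>R ?e" 1] 1 2
    unfolding s1 by simp
qed

text \<open>This class is closed under products by the first-order product rule alone, and it is
  enough for integration by parts.\<close>

definition periodic_C1 :: "(real^3 \<Rightarrow> real) \<Rightarrow> bool" where
  "periodic_C1 \<phi> \<longleftrightarrow> (\<forall>x. \<phi> differentiable (at x)) \<and>
     (\<forall>i. continuous_on UNIV (partial_deriv i \<phi>)) \<and> (\<forall>x i. \<phi> (x + axis i 1) = \<phi> x)"

lemma torus_smooth_imp_periodic_C1: "torus_smooth \<phi> \<Longrightarrow> periodic_C1 \<phi>"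
proof -
  assume s: "torus_smooth \<phi>"
  then have "continuously_differentiable (Suc 0) \<phi>" unfolding torus_smooth_def by blast
  then have "\<forall>x. \<phi> differentiable (at x)" "\<forall>i. continuous_on UNIV (partial_deriv i \<phi>)" by simp_all
  with s show ?thesis by (simp add: periodic_C1_def torus_smooth_def)
qed

lemma periodic_C1_continuous: "periodic_C1 \<phi> \<Longrightarrow> continuous_on UNIV \<phi>"
  by (simp add: periodic_C1_def continuous_at_imp_continuous_on differentiable_imp_continuous_within)

lemma has_derivative_partial:
  "\<phi> differentiable (at x) \<Longrightarrow> (\<phi> has_derivative (\<lambda>h. \<Sum>i\<in>UNIV. h $ i * partial_deriv i \<phi> x)) (at x)"
proof -
  assume "\<phi> differentiable (at x)"
  then have d: "(\<phi> has_derivative frechet_derivative \<phi> (at x)) (at x)"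
    by (simp add: frechet_derivative_works)
  have "frechet_derivative \<phi> (at x) h = (\<Sum>i\<in>UNIV. h $ i * partial_deriv i \<phi> x)" for h
  proof -
    have "linear (frechet_derivative \<phi> (at x))" using d by (rule has_derivative_linear)
    then have "frechet_derivative \<phi> (at x) (\<Sum>i\<in>UNIV. h $ i *\<^sub>R axis i 1) = (\<Sum>i\<in>UNIV. h $ i * partial_deriv i \<phi> x)"
      by (simp add: linear_sum linear_scale partial_deriv_def)
    then show ?thesis using basis_expansion[of h] by (simp add: scalar_mult_eq_scaleR)
  qed
  then show ?thesis using d by presburger
qed

lemma partial_derivI:
  assumes "(\<phi> has_derivative D) (at x)"
  shows "partial_deriv i \<phi> x = D (axis i 1)"
  unfolding partial_deriv_def by (simp add: frechet_derivative_at[OF assms, symmetric])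

lemma partial_deriv_periodic:
  assumes "periodic_C1 \<phi>"
  shows "partial_deriv i \<phi> (x + axis j 1) = partial_deriv i \<phi> x"
proof -
  have "(\<phi> has_derivative frechet_derivative \<phi> (at (x + axis j 1))) (at (x + axis j 1))"
    using assms by (simp add: periodic_C1_def frechet_derivative_works)
  then have "((\<lambda>x. \<phi> (x + axis j 1)) has_derivative frechet_derivative \<phi> (at (x + axis j 1))) (at x)"
    by (rule has_derivative_compose[rotated, of _ _ "\<lambda>x. x + axis j 1", simplified o_def])
      (auto intro!: derivative_eq_intros)
  moreover have "(\<lambda>x. \<phi> (x + axis j 1)) = \<phi>" using assms by (auto simp: periodic_C1_def)
  ultimately have "(\<phi> has_derivative frechet_derivative \<phi> (at (x + axis j 1))) (at x)" by simp
  from partial_derivI[OF this, of i] show ?thesis by (simp add: partial_deriv_def)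
qed

text \<open>By periodicity the integral equals its average over all translates along the axis. After
  exchanging the integrals, the inner one is the increment of \<open>\<phi>\<close> over a
  period.\<close>

lemma integral_partial_deriv:
  assumes "periodic_C1 \<phi>"
  shows "integral\<^sup>L torus (partial_deriv i \<phi>) = 0"
proof -
  let ?e = "axis i 1 :: real^3"
  have pd: "continuous_on UNIV (partial_deriv i \<phi>)" using assms by (simp add: periodic_C1_def)
  have tr: "integral (cbox 0 1) (\<lambda>x. partial_deriv i \<phi> (x + s *\<^sub>R ?e)) = integral (cbox 0 1) (partial_deriv i \<phi>)"
    if "s \<in> cbox 0 1" for s
    using that by (intro integral_cube_translate pd partial_deriv_periodic assms) auto
  have "integral (cbox 0 1) (partial_deriv i \<phi>) = integral (cbox 0 (1::real)) (\<lambda>s. integral (cbox 0 1) (partial_deriv i \<phi>))"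
    by simp
  also have "\<dots> = integral (cbox 0 (1::real)) (\<lambda>s. integral (cbox 0 1) (\<lambda>x. partial_deriv i \<phi> (x + s *\<^sub>R ?e)))"
    by (rule integral_cong) (simp only: tr)
  also have "\<dots> = integral (cbox 0 1) (\<lambda>x. integral (cbox 0 (1::real)) (\<lambda>s. partial_deriv i \<phi> (x + s *\<^sub>R ?e)))"
    by (rule integral_swap_continuous)
      (auto intro!: continuous_on_compose2[OF pd] continuous_intros simp: split_def)
  also have "\<dots> = integral (cbox 0 1) (\<lambda>x :: real^3. 0)"
  proof (rule integral_cong)
    fix x :: "real^3"
    have "((\<lambda>s. partial_deriv i \<phi> (x + s *\<^sub>R ?e)) has_integral \<phi> (x + 1 *\<^sub>R ?e) - \<phi> (x + 0 *\<^sub>R ?e)) {0..1}"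
    proof (rule fundamental_theorem_of_calculus)
      fix s :: real
      have "(\<phi> has_derivative (\<lambda>h. \<Sum>i\<in>UNIV. h $ i * partial_deriv i \<phi> (x + s *\<^sub>R ?e))) (at (x + s *\<^sub>R ?e))"
        using assms by (intro has_derivative_partial) (simp add: periodic_C1_def)
      then have "((\<lambda>s. \<phi> (x + s *\<^sub>R ?e)) has_derivative (\<lambda>h. \<Sum>j\<in>UNIV. (h *\<^sub>R ?e) $ j * partial_deriv j \<phi> (x + s *\<^sub>R ?e)))
          (at s within {0..1})"
        by (rule has_derivative_compose[rotated]) (auto intro!: derivative_eq_intros)
      moreover have "(\<Sum>j\<in>UNIV. (h *\<^sub>R ?e) $ j * partial_deriv j \<phi> (x + s *\<^sub>R ?e)) = h *\<^sub>R partial_deriv i \<phi> (x + s *\<^sub>R ?e)" for h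
        by (simp add: axis_def if_distrib if_distribR cong: if_cong)
      ultimately show "((\<lambda>s. \<phi> (x + s *\<^sub>R ?e)) has_vector_derivative partial_deriv i \<phi> (x + s *\<^sub>R ?e)) (at s within {0..1})"
        by (simp add: has_vector_derivative_def)
    qed simp
    moreover have "\<phi> (x + 1 *\<^sub>R ?e) - \<phi> (x + 0 *\<^sub>R ?e) = 0" using assms by (simp add: periodic_C1_def)
    ultimately show "integral (cbox 0 (1::real)) (\<lambda>s. partial_deriv i \<phi> (x + s *\<^sub>R ?e)) = 0"
      by (simp add: integral_unique)
  qed
  finally show ?thesis by (simp add: integral_torus_continuous[OF pd])
qed

lemma partial_deriv_mult:
  assumes "\<phi> differentiable (at x)" "\<psi> differentiable (at x)"
  shows "partial_deriv i (\<lambda>x. \<phi> x * \<psi> x) x = partial_deriv i \<phi> x * \<psi> x + \<phi> x * partial_deriv i \<psi> x"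
  using partial_derivI[OF has_derivative_mult[OF assms[unfolded frechet_derivative_works]], of i]
  by (simp add: partial_deriv_def algebra_simps)

lemma periodic_C1_mult:
  assumes "periodic_C1 \<phi>" "periodic_C1 \<psi>"
  shows "periodic_C1 (\<lambda>x. \<phi> x * \<psi> x)"
proof -
  have "partial_deriv i (\<lambda>x. \<phi> x * \<psi> x) = (\<lambda>x. partial_deriv i \<phi> x * \<psi> x + \<phi> x * partial_deriv i \<psi> x)" for i
    using assms by (intro ext partial_deriv_mult) (auto simp: periodic_C1_def)
  moreover have "continuous_on UNIV (\<lambda>x. partial_deriv i \<phi> x * \<psi> x + \<phi> x * partial_deriv i \<psi> x)" for i
    using assms by (intro continuous_on_add continuous_on_mult periodic_C1_continuous[OF assms(1)]
        periodic_C1_continuous[OF assms(2)]) (auto simp: periodic_C1_def)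
  ultimately show ?thesis using assms by (auto simp: periodic_C1_def)
qed

lemma integration_by_parts:
  assumes "periodic_C1 \<phi>" "periodic_C1 \<psi>"
  shows "integral\<^sup>L torus (\<lambda>x. partial_deriv i \<phi> x * \<psi> x) = - integral\<^sup>L torus (\<lambda>x. \<phi> x * partial_deriv i \<psi> x)"
proof -
  have "partial_deriv i (\<lambda>x. \<phi> x * \<psi> x) = (\<lambda>x. partial_deriv i \<phi> x * \<psi> x + \<phi> x * partial_deriv i \<psi> x)"
    using assms by (intro ext partial_deriv_mult) (auto simp: periodic_C1_def)
  then have "integral\<^sup>L torus (\<lambda>x. partial_deriv i \<phi> x * \<psi> x + \<phi> x * partial_deriv i \<psi> x) = 0"
    using integral_partial_deriv[OF periodic_C1_mult[OF assms], of i] by simp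
  moreover have "integrable torus (\<lambda>x. partial_deriv i \<phi> x * \<psi> x)" "integrable torus (\<lambda>x. \<phi> x * partial_deriv i \<psi> x)"
    using assms by (intro continuous_integrable_torus continuous_on_mult periodic_C1_continuous[OF assms(1)]
        periodic_C1_continuous[OF assms(2)]; simp add: periodic_C1_def)+
  ultimately show ?thesis by simp
qed

section \<open>The real trigonometric system\<close>

definition phase :: "int^3 \<Rightarrow> real^3 \<Rightarrow> real" where
  "phase k x = 2 * pi * (\<Sum>i\<in>UNIV. of_int (k $ i) * x $ i)"

text \<open>Hartley's function.  Unlike the sines and cosines separately, it is orthonormal without
  normalising factors, and each partial derivative of \<open>cas k\<close> is a multiple of \<open>cas (- k)\<close>.\<close>

definition cas :: "int^3 \<Rightarrow> real^3 \<Rightarrow> real" where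
  "cas k x = cos (phase k x) + sin (phase k x)"

lemma phase_simps: "phase (k + l) x = phase k x + phase l x" "phase (k - l) x = phase k x - phase l x"
  "phase (- k) x = - phase k x" "phase 0 x = 0"
  by (simp_all add: phase_def algebra_simps sum.distrib sum_subtractf sum_negf)

lemma phase_periodic: "phase k (x + axis i 1) = phase k x + 2 * pi * of_int (k $ i)"
proof -
  have "(\<Sum>j\<in>UNIV. of_int (k $ j) * (axis i 1 :: real^3) $ j) = of_int (k $ i)"
    by (simp add: axis_def if_distrib cong: if_cong)
  then show ?thesis by (simp add: phase_def algebra_simps sum.distrib)
qed

lemma cas_periodic: "cas k (x + axis i 1) = cas k x"
  unfolding cas_def phase_periodic by (simp add: cos_add sin_add)

lemma phase_deriv: "(phase k has_derivative phase k) (at x)"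
proof -
  have "bounded_linear (phase k)"
    unfolding phase_def
    by (intro bounded_linear_const_mult bounded_linear_sum bounded_linear_vec_nth)
  then show ?thesis by (rule bounded_linear_imp_has_derivative)
qed

lemma cas_deriv: "(cas k has_derivative (\<lambda>h. phase k h * cas (- k) x)) (at x)"
  unfolding cas_def phase_simps
  by (auto intro!: derivative_eq_intros phase_deriv simp: algebra_simps)

lemma partial_deriv_cas: "partial_deriv i (\<lambda>x. a * cas k x) = (\<lambda>x. (a * (2 * pi * of_int (k $ i))) * cas (- k) x)"
proof
  fix x
  have "phase k (axis i 1) = 2 * pi * of_int (k $ i)" using phase_periodic[of k 0 i] by (simp add: phase_def)
  moreover have "((\<lambda>x. a * cas k x) has_derivative (\<lambda>h. a * (phase k h * cas (- k) x))) (at x)"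
    by (intro has_derivative_mult_right cas_deriv)
  ultimately show "partial_deriv i (\<lambda>x. a * cas k x) x = (a * (2 * pi * of_int (k $ i))) * cas (- k) x"
    by (simp add: partial_derivI)
qed

lemma continuous_cas: "continuous_on X (cas k)"
  by (intro continuous_at_imp_continuous_on ballI has_derivative_continuous[OF cas_deriv])

lemma torus_smooth_cas: "torus_smooth (cas k)"
proof -
  have "continuously_differentiable m (\<lambda>x. a * cas k x)" for m a k
  proof (induction m arbitrary: a k)
    case 0
    show ?case by (auto intro!: continuous_intros continuous_cas)
  next
    case (Suc m)
    have "(\<lambda>x. a * cas k x) differentiable (at x)" for x
      using has_derivative_mult_right[OF cas_deriv] by (rule differentiableI)
    then show ?case using Suc by (simp add: partial_deriv_cas)
  qed
  from this[of _ 1 k] show ?thesis by (simp add: torus_smooth_def cas_periodic)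
qed

lemmas periodic_C1_cas = torus_smooth_imp_periodic_C1[OF torus_smooth_cas]

lemma measure_torus: "measure torus (space torus) = 1"
proof -
  have "integral\<^sup>L torus (\<lambda>x. 1 :: real) = integral (cbox 0 1) (\<lambda>x :: real^3. 1 :: real)"
    by (rule integral_torus_continuous) (rule continuous_on_const)
  also have "\<dots> = 1"
    by (simp add: content_cbox_if_cart interval_ne_empty_cart)
  finally show ?thesis by simp
qed

lemma cas_0: "cas 0 = (\<lambda>x. 1)"
  by (simp add: fun_eq_iff cas_def phase_simps)

text \<open>For nonzero \<open>k\<close> the function is, up to a nonzero factor, a partial
  derivative of \<open>cas (- k)\<close>.\<close>

lemma integral_cas: "integral\<^sup>L torus (cas k) = (if k = 0 then 1 else 0)"
proof (cases "k = 0")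
  case True
  then show ?thesis by (simp add: cas_0 measure_torus)
next
  case False
  then obtain i where i: "k $ i \<noteq> 0" by (auto simp: vec_eq_iff)
  have "partial_deriv i (cas (- k)) = (\<lambda>x. (- 2 * pi * of_int (k $ i)) * cas k x)"
    using partial_deriv_cas[of i 1 "- k"] by simp
  then have "integral\<^sup>L torus (\<lambda>x. (- 2 * pi * of_int (k $ i)) * cas k x) = 0"
    using integral_partial_deriv[OF periodic_C1_cas, of i "- k"] by simp
  then show ?thesis using i False by simp
qed

lemma cas_mult: "cas k x * cas l x = 1/2 * (cas (k - l) x + cas (l - k) x + cas (k + l) x - cas (- (k + l)) x)"
  by (simp add: cas_def phase_simps cos_add sin_add cos_diff sin_diff algebra_simps)

text \<open>In \<open>cas_mult\<close> the contributions of \<open>k + l\<close> and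
  \<open>- (k + l)\<close> always cancel, and the two differences contribute 1/2 each exactly when
  \<open>k = l\<close>.\<close>

lemma integral_cas_cas: "integral\<^sup>L torus (\<lambda>x. cas k x * cas l x) = (if k = l then 1 else 0)"
proof -
  have int: "integrable torus (cas k)" for k by (rule continuous_integrable_torus[OF continuous_cas])
  have "- (k + l) = 0 \<longleftrightarrow> k + l = 0" "k - l = 0 \<longleftrightarrow> k = l" "l - k = 0 \<longleftrightarrow> k = l"
    by (auto simp only: neg_equal_0_iff_equal right_minus_eq)
  then show ?thesis unfolding cas_mult using int by (simp only: integral_cas Bochner_Integration.integral_mult_right_zero
    Bochner_Integration.integral_add Bochner_Integration.integral_diff Bochner_Integration.integrable_add) simp
qed

text \<open>The real trigonometric polynomials, as the linear span of the functions
  \<open>cas k\<close>.\<close>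

inductive trig :: "(real^3 \<Rightarrow> real) \<Rightarrow> bool" where
  trig_cas: "trig (cas k)"
| trig_add: "trig f \<Longrightarrow> trig g \<Longrightarrow> trig (\<lambda>x. f x + g x)"
| trig_cmult: "trig f \<Longrightarrow> trig (\<lambda>x. c * f x)"

lemma trig_sum: "finite A \<Longrightarrow> (\<And>i. i \<in> A \<Longrightarrow> trig (g i)) \<Longrightarrow> trig (\<lambda>x. \<Sum>i\<in>A. g i x)"
proof (induction A rule: finite_induct)
  case empty
  show ?case using trig_cmult[OF trig_cas, of 0 0] by simp
next
  case (insert i A)
  then show ?case using trig_add[of "g i" "\<lambda>x. \<Sum>i\<in>A. g i x"] by simp
qed

lemma trig_multI:
  assumes "trig g" "\<And>k. trig (\<lambda>x. cas k x * w x)"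
  shows "trig (\<lambda>x. g x * w x)"
  using assms(1)
proof induction
  case (trig_cas k)
  show ?case by (rule assms(2))
next
  case (trig_add f g)
  from trig.trig_add[OF trig_add.IH] show ?case by (simp add: distrib_right)
next
  case (trig_cmult f c)
  from trig.trig_cmult[OF trig_cmult.IH, of c] show ?case by (simp add: mult.assoc)
qed

lemma trig_mult_exp:
  assumes "trig g"
  shows "trig (\<lambda>x. g x * cos (2 * pi * x $ i))" "trig (\<lambda>x. g x * sin (2 * pi * x $ i))"
proof -
  have ph: "phase (axis i 1) x = 2 * pi * x $ i" for x
    by (simp add: phase_def axis_def if_distrib if_distribR cong: if_cong)
  have lin: "trig (\<lambda>x. c * cas k x + d * cas l x)" for c d k l
    by (intro trig_add trig_cmult trig_cas)
  have "cas k x * cos (2 * pi * x $ i) = 1/2 * cas (k + axis i 1) x + 1/2 * cas (k - axis i 1) x"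
    "cas k x * sin (2 * pi * x $ i) = 1/2 * cas (- (k - axis i 1)) x + (-1/2) * cas (- (k + axis i 1)) x" for k x
    unfolding cas_def phase_simps ph
    by (simp_all add: cos_add sin_add cos_diff sin_diff algebra_simps)
  then have cas: "trig (\<lambda>x. cas k x * cos (2 * pi * x $ i))" "trig (\<lambda>x. cas k x * sin (2 * pi * x $ i))" for k
    by (simp_all only: lin)
  from trig_multI[OF assms this(1)] show "trig (\<lambda>x. g x * cos (2 * pi * x $ i))" .
  from trig_multI[OF assms cas(2)] show "trig (\<lambda>x. g x * sin (2 * pi * x $ i))" .
qed

text \<open>The torus as a product of three circles. The image of the closed cube is compact, and
  real polynomials on the ambient space pull back to trigonometric polynomials.\<close>

definition embed :: "real^3 \<Rightarrow> complex^3" where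
  "embed x = (\<chi> i. cis (2 * pi * x $ i))"

lemma continuous_embed: "continuous_on X embed"
  unfolding embed_def by (intro continuous_on_vec_lambda continuous_intros)

lemma inj_on_embed: "inj_on embed cube"
proof (rule inj_onI)
  fix x y assume xy: "x \<in> cube" "y \<in> cube" and eq: "embed x = embed y"
  have "x $ i = y $ i" for i
  proof -
    have "cis (2 * pi * x $ i) = cis (2 * pi * y $ i)" using eq by (simp add: embed_def vec_eq_iff)
    then have "cis (2 * pi * x $ i - 2 * pi * y $ i) = 1" by (simp add: cis_divide[symmetric])
    then have "cos (2 * pi * x $ i - 2 * pi * y $ i) = 1" by (simp add: complex_eq_iff)
    then obtain n :: int where "2 * pi * x $ i - 2 * pi * y $ i = of_int n * 2 * pi"
      by (auto simp: cos_one_2pi_int)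
    then have "2 * pi * (x $ i - y $ i - of_int n) = 0" by (simp add: algebra_simps)
    then have n: "x $ i - y $ i = of_int n" by simp
    moreover have "\<bar>x $ i - y $ i\<bar> < 1" using xy unfolding cube_def by (smt (verit) mem_Collect_eq)
    ultimately have "n = 0" by linarith
    then show ?thesis using n by simp
  qed
  then show "x = y" by (simp add: vec_eq_iff)
qed

text \<open>The factor \<open>g\<close> is carried along for the product case: the induction
  hypothesis for one polynomial is applied to \<open>g\<close> times the other.\<close>

lemma trig_mult_polynomial:
  assumes "real_polynomial_function q" "trig g"
  shows "trig (\<lambda>x. g x * q (embed x))"
  using assms
proof (induction arbitrary: g rule: real_polynomial_function.induct)
  case (linear h)
  have lin: "linear h" using linear(1) by (rule bounded_linear.linear)
  have "h (embed x) = (\<Sum>i\<in>UNIV. cos (2 * pi * x $ i) * h (axis i 1) + sin (2 * pi * x $ i) * h (axis i \<i>))" for x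
  proof -
    have "embed x = (\<Sum>i\<in>UNIV. cos (2 * pi * x $ i) *\<^sub>R axis i 1 + sin (2 * pi * x $ i) *\<^sub>R axis i \<i>)"
      by (simp add: vec_eq_iff embed_def axis_def if_distrib if_distribR sum.distrib complex_eq_iff cong: if_cong)
    then show ?thesis by (simp add: linear_sum[OF lin] linear_add[OF lin] linear_scale[OF lin])
  qed
  then have "(\<lambda>x. g x * h (embed x)) = (\<lambda>x. \<Sum>i\<in>UNIV.
      h (axis i 1) * (g x * cos (2 * pi * x $ i)) + h (axis i \<i>) * (g x * sin (2 * pi * x $ i)))"
    by (simp add: sum_distrib_left algebra_simps)
  then show ?case
    by (simp only:) (intro trig_sum trig_add trig_cmult trig_mult_exp linear; simp)
next
  case (const c)
  then show ?case using trig_cmult[of g c] by (simp add: mult.commute)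
next
  case (add f h)
  then show ?case using trig_add[OF add.IH(1)[of g] add.IH(2)[of g]] by (simp add: distrib_left)
next
  case (mult f h)
  show ?case using mult.IH(2)[OF mult.IH(1)[OF mult.prems]] by (simp add: mult.assoc)
qed

lemma trig_continuous: "trig g \<Longrightarrow> continuous_on UNIV g"
  by (induction rule: trig.induct) (auto intro!: continuous_intros continuous_cas)

lemma integrable_mult_continuous:
  assumes f: "integrable torus f" and g: "continuous_on UNIV (g :: real^3 \<Rightarrow> real)"
  shows "integrable torus (\<lambda>x. f x * g x :: real)"
proof -
  have gm: "g \<in> borel_measurable torus"
    using continuous_integrable_torus[OF g] by (rule borel_measurable_integrable)
  have "bounded (g ` cbox 0 1)"
    by (intro compact_imp_bounded compact_continuous_image continuous_on_subset[OF g]) auto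
  then obtain B where B: "\<forall>x\<in>cbox 0 1. norm (g x) \<le> B" by (auto simp: bounded_iff)
  show ?thesis
  proof (rule Bochner_Integration.integrable_bound)
    show "integrable torus (\<lambda>x. B * f x)" using f by simp
    show "(\<lambda>x. f x * g x) \<in> borel_measurable torus" using borel_measurable_integrable[OF f] gm by measurable
    show "AE x in torus. norm (f x * g x) \<le> norm (B * f x)"
    proof (rule AE_I2)
      fix x assume "x \<in> space torus"
      then have "\<bar>g x\<bar> \<le> B" using B cube_subset by (auto simp: space_torus)
      then have "\<bar>f x\<bar> * \<bar>g x\<bar> \<le> \<bar>f x\<bar> * \<bar>B\<bar>" by (intro mult_left_mono) auto
      then show "norm (f x * g x) \<le> norm (B * f x)" by (simp add: abs_mult mult.commute)
    qed
  qed
qed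

lemma integral_trig_zero:
  assumes f: "integrable torus f" and 0: "\<And>k. integral\<^sup>L torus (\<lambda>x. f x * cas k x) = 0" and "trig g"
  shows "integral\<^sup>L torus (\<lambda>x. f x * g x) = 0"
  using \<open>trig g\<close>
proof induction
  case (trig_cas k)
  show ?case by (rule 0)
next
  case (trig_add g h)
  then show ?case
    by (simp add: distrib_left integrable_mult_continuous f trig_continuous)
next
  case (trig_cmult g c)
  then show ?case by (simp add: mult.left_commute)
qed

text \<open>Stone--Weierstrass on the embedded torus, which is compact: the indicator of \<open>D\<close> is a bounded
  pointwise limit of polynomials in \<open>embed\<close>, and these are trigonometric.\<close>

lemma integral_box_zero:
  assumes f: "integrable torus f" and 0: "\<And>k. integral\<^sup>L torus (\<lambda>x. f x * cas k x) = 0"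
    and D: "compact D" "D \<subseteq> cube"
  shows "integral\<^sup>L torus (\<lambda>x. f x * indicator D x) = 0"
proof (cases "D = {}")
  case False
  define T where "T = embed ` cbox 0 1"
  have T: "compact T" unfolding T_def by (intro compact_continuous_image continuous_embed compact_cbox)
  \<comment> \<open>A tent around the image of \<open>D\<close>: equal to 1 on it and, for positive
    \<open>n\<close>, to 0 beyond distance \<open>1 / n\<close>.\<close>
  define \<psi> where "\<psi> n z = max 0 (1 - real n * infdist z (embed ` D))" for n z
  have "\<exists>q. real_polynomial_function q \<and> (\<forall>z\<in>T. \<bar>\<psi> n z - q z\<bar> < inverse (real (Suc n)))" for n
  proof -
    have "continuous_on T (\<psi> n)" unfolding \<psi>_def by (intro continuous_intros)
    from Stone_Weierstrass_real_polynomial_function[OF T this, of "inverse (real (Suc n))"] show ?thesis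
      by (metis inverse_positive_iff_positive of_nat_0_less_iff zero_less_Suc)
  qed
  then obtain q where q: "\<And>n. real_polynomial_function (q n)"
    "\<And>n z. z \<in> T \<Longrightarrow> \<bar>\<psi> n z - q n z\<bar> < inverse (real (Suc n))" by metis
  have embed_T: "embed x \<in> T" if "x \<in> cube" for x using that cube_subset by (auto simp: T_def)
  have q0: "integral\<^sup>L torus (\<lambda>x. f x * q n (embed x)) = 0" for n
  proof -
    have "trig (\<lambda>x. cas 0 x * q n (embed x))" by (intro trig_mult_polynomial q trig_cas)
    then have "trig (\<lambda>x. q n (embed x))" by (simp add: cas_def phase_simps)
    then show ?thesis by (rule integral_trig_zero[OF f 0])
  qed
  have qc: "continuous_on UNIV (\<lambda>x. q n (embed x))" for n
    using q(1)[of n] by (intro continuous_on_compose2[OF continuous_on_polymonial_function continuous_embed, of _ UNIV])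
      (auto simp: real_polynomial_function_eq)
  have lim: "(\<lambda>n. q n (embed x)) \<longlonglongrightarrow> indicator D x" if x: "x \<in> cube" for x
  proof -
    have "(\<lambda>n. \<psi> n (embed x)) \<longlonglongrightarrow> indicator D x"
    proof (cases "x \<in> D")
      case True
      then show ?thesis by (simp add: \<psi>_def)
    next
      case False
      \<comment> \<open>Both \<open>D\<close> and \<open>x\<close> are in the half-open cube, on
        which the embedding is injective; opposite faces of the closed cube would be
        identified.\<close>
      then have "embed x \<notin> embed ` D" using inj_on_embed D x by (auto dest: inj_onD)
      moreover have "closed (embed ` D)"
        by (intro compact_imp_closed compact_continuous_image continuous_embed D)
      ultimately have pos: "infdist (embed x) (embed ` D) > 0"
        using \<open>D \<noteq> {}\<close> by (intro infdist_pos_not_in_closed) auto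
      obtain N where N: "1 < real N * infdist (embed x) (embed ` D)" using ex_less_of_nat_mult[OF pos] by blast
      have "\<psi> n (embed x) = 0" if "n \<ge> N" for n
      proof -
        have "real N * infdist (embed x) (embed ` D) \<le> real n * infdist (embed x) (embed ` D)"
          using that pos by (intro mult_right_mono) auto
        then show ?thesis using N by (simp add: \<psi>_def)
      qed
      then have "\<forall>\<^sub>F n in sequentially. \<psi> n (embed x) = 0" by (auto simp: eventually_sequentially)
      then show ?thesis using False by (simp add: tendsto_eventually)
    qed
    moreover have "(\<lambda>n. q n (embed x) - \<psi> n (embed x)) \<longlonglongrightarrow> 0"
    proof (rule Lim_null_comparison)
      show "\<forall>\<^sub>F n in sequentially. norm (q n (embed x) - \<psi> n (embed x)) \<le> inverse (real (Suc n))"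
        using q(2)[OF embed_T[OF x]] by (auto intro!: always_eventually less_imp_le simp: abs_minus_commute)
      show "(\<lambda>n. inverse (real (Suc n))) \<longlonglongrightarrow> 0" by (rule LIMSEQ_inverse_real_of_nat)
    qed
    ultimately show ?thesis by (rule Lim_transform)
  qed
  have "(\<lambda>n. integral\<^sup>L torus (\<lambda>x. f x * q n (embed x))) \<longlonglongrightarrow> integral\<^sup>L torus (\<lambda>x. f x * indicator D x)"
  proof (rule integral_dominated_convergence[where w = "\<lambda>x. 2 * \<bar>f x\<bar>"])
    have "D \<in> sets lebesgue" using D(1) compact_imp_closed borel_closed sets_completionI_sets by (metis sets_lborel)
    then have "D \<in> sets torus" using D(2) by (auto simp: torus_eq sets_restrict_space)
    then show "(\<lambda>x. f x * indicator D x) \<in> borel_measurable torus"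
      using borel_measurable_integrable[OF f] by measurable
    show "(\<lambda>x. f x * q n (embed x)) \<in> borel_measurable torus" for n
      by (intro borel_measurable_integrable integrable_mult_continuous f qc)
    show "integrable torus (\<lambda>x. 2 * \<bar>f x\<bar>)" using f by simp
    show "AE x in torus. (\<lambda>n. f x * q n (embed x)) \<longlonglongrightarrow> f x * indicator D x"
      by (rule AE_I2) (auto intro!: tendsto_intros lim simp: space_torus)
    show "AE x in torus. norm (f x * q n (embed x)) \<le> 2 * \<bar>f x\<bar>" for n
    proof (rule AE_I2)
      fix x assume "x \<in> space torus"
      then have "\<bar>\<psi> n (embed x) - q n (embed x)\<bar> < inverse (real (Suc n))" by (intro q embed_T) (simp add: space_torus)
      moreover have "inverse (real (Suc n)) \<le> 1" by (simp add: field_simps)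
      moreover have "0 \<le> \<psi> n (embed x)" "\<psi> n (embed x) \<le> 1" by (auto simp: \<psi>_def infdist_nonneg)
      ultimately have "\<bar>q n (embed x)\<bar> \<le> 2" by linarith
      from mult_left_mono[OF this abs_ge_zero[of "f x"]]
      show "norm (f x * q n (embed x)) \<le> 2 * \<bar>f x\<bar>" by (simp add: abs_mult mult.commute)
    qed
  qed
  then show ?thesis by (simp add: q0 LIMSEQ_const_iff)
qed simp

text \<open>All integrals over closed boxes inside the cube vanish by
  \<open>integral_box_zero\<close>; Lebesgue differentiation then recovers \<open>f\<close> almost
  everywhere.\<close>

lemma cas_total:
  fixes f :: "real^3 \<Rightarrow> real"
  assumes f: "integrable torus f" and 0: "\<And>k. integral\<^sup>L torus (\<lambda>x. f x * cas k x) = 0"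
  shows "AE x in torus. f x = 0"
proof -
  define F where "F x = (if x \<in> cube then f x else 0)" for x
  have F: "integrable lebesgue F"
    unfolding F_def using f by (subst Lebesgue_Measure.integrable_restrict_UNIV) (auto simp: torus_eq)
  have Fset: "set_integrable lebesgue (cbox a b) F" for a b
    unfolding set_integrable_def using F by (intro integrable_mult_indicator) auto
  have Fint: "F integrable_on cbox a b" for a b
    using set_lebesgue_integral_eq_integral(1)[OF Fset] .
  have zero: "integral (cbox a b) F = 0" if "cbox a b \<subseteq> cube" for a b
  proof -
    have "integral (cbox a b) F = (LINT x:cbox a b|lebesgue. F x)"
      by (rule set_lebesgue_integral_eq_integral(2)[OF Fset, symmetric])
    also have "\<dots> = integral\<^sup>L lebesgue (\<lambda>x. if x \<in> cube then f x * indicator (cbox a b) x else 0)"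
      unfolding set_lebesgue_integral_def by (rule Bochner_Integration.integral_cong) (auto simp: F_def)
    also have "\<dots> = integral\<^sup>L torus (\<lambda>x. f x * indicator (cbox a b) x)"
      by (subst Lebesgue_Measure.integral_restrict_UNIV) (auto simp: torus_eq)
    also have "\<dots> = 0" by (rule integral_box_zero[OF f 0 compact_cbox that])
    finally show ?thesis .
  qed
  obtain N where N: "negligible N" "\<And>x e. x \<notin> N \<Longrightarrow> 0 < e \<Longrightarrow>
      \<exists>d>0. \<forall>h. 0 < h \<and> h < d \<longrightarrow>
        norm (integral (cbox x (x + h *\<^sub>R One)) F /\<^sub>R h ^ DIM(real^3) - F x) < e"
    using integrable_ccontinuous_explicit[OF Fint] by metis
  have F0: "F x = 0" if x: "x \<in> cube" "x \<notin> N" for x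
  proof (rule ccontr)
    assume "F x \<noteq> 0"
    then obtain d where d: "d > 0" "\<And>h. 0 < h \<Longrightarrow> h < d \<Longrightarrow>
        norm (integral (cbox x (x + h *\<^sub>R One)) F /\<^sub>R h ^ DIM(real^3) - F x) < norm (F x)"
      using N(2)[OF x(2), of "norm (F x)"] by auto
    define m where "m = Max (range (\<lambda>i. x $ i))"
    have m: "x $ i \<le> m" for i unfolding m_def by (rule Max_ge) auto
    have "m < 1" using x(1) unfolding m_def by (subst Max_less_iff) (auto simp: cube_def)
    \<comment> \<open>\<open>1 - m\<close> is the distance of \<open>x\<close> from the upper faces;
      the shrinking boxes extend upwards from \<open>x\<close> and so stay inside the half-open
      cube.\<close>
    define h where "h = min (d / 2) ((1 - m) / 2)"
    have h: "0 < h" "h < d" "m + h < 1" using d(1) \<open>m < 1\<close> by (auto simp: h_def min_def field_simps)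
    have One: "(One :: real^3) $ i = 1" for i
      by (simp add: cart_eq_inner_axis inner_sum_left_Basis axis_in_Basis_iff)
    have "cbox x (x + h *\<^sub>R One) \<subseteq> cube"
    proof
      fix y assume y: "y \<in> cbox x (x + h *\<^sub>R One)"
      have "0 \<le> y $ i \<and> y $ i < 1" for i
      proof -
        have "(x + h *\<^sub>R One) $ i = x $ i + h"
          using One[of i] by (simp only: vector_add_component vector_scaleR_component) simp
        then have "x $ i \<le> y $ i" "y $ i \<le> x $ i + h" using y unfolding mem_box_cart by metis+
        moreover have "0 \<le> x $ i" using x(1) by (simp add: cube_def)
        ultimately show ?thesis using h(3) m[of i] by linarith
      qed
      then show "y \<in> cube" by (simp add: cube_def)
    qed
    from zero[OF this] d(2)[OF h(1,2)] show False by simp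
  qed
  have "{x \<in> cube. f x \<noteq> 0} \<subseteq> N" using F0 by (auto simp: F_def)
  then have "negligible {x \<in> cube. f x \<noteq> 0}" using N(1) negligible_subset by blast
  then have "{x \<in> cube. f x \<noteq> 0} \<in> null_sets lebesgue" by (simp add: negligible_iff_null_sets)
  then have "AE x in lebesgue. x \<in> cube \<longrightarrow> f x = 0"
    by (rule AE_I'[where N = "{x \<in> cube. f x \<noteq> 0}"]) auto
  then show ?thesis unfolding torus_eq by (subst AE_restrict_space_iff) auto
qed

section \<open>Hilbert spaces and completeness\<close>

text \<open>A minimising sequence for the distance is Cauchy by the parallelogram identity, and
  minimality along the lines \<open>p + t *\<^sub>R h\<close> is orthogonality.\<close>

lemma orthogonal_projection_exists:
  fixes V :: "'a::{real_inner,complete_space} set"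
  assumes V: "subspace V" "closed V"
  obtains p where "p \<in> V" "\<And>h. h \<in> V \<Longrightarrow> (v - p) \<bullet> h = 0"
proof -
  define d where "d = infdist v V"
  have "V \<noteq> {}" using subspace_0[OF V(1)] by auto
  have d_le: "d \<le> norm (v - x)" if "x \<in> V" for x
    using infdist_le[OF that, of v] by (simp add: d_def dist_norm)
  have "0 \<le> d" by (simp add: d_def infdist_nonneg)
  have "\<exists>x\<in>V. (norm (v - x))\<^sup>2 < d\<^sup>2 + inverse (real (Suc n))" for n
  proof -
    have lt: "d < sqrt (d\<^sup>2 + inverse (real (Suc n)))" using \<open>0 \<le> d\<close> by (intro real_less_rsqrt) simp
    obtain x where x: "x \<in> V" "norm (v - x) < sqrt (d\<^sup>2 + inverse (real (Suc n)))"
    proof (rule ccontr)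
      assume "\<not> thesis"
      then have "\<And>x. x \<in> V \<Longrightarrow> sqrt (d\<^sup>2 + inverse (real (Suc n))) \<le> dist v x"
        using that by (force simp: dist_norm)
      then have "sqrt (d\<^sup>2 + inverse (real (Suc n))) \<le> d"
        unfolding d_def infdist_def using \<open>V \<noteq> {}\<close> by (auto intro!: cINF_greatest)
      with lt show False by simp
    qed
    have "(norm (v - x))\<^sup>2 < (sqrt (d\<^sup>2 + inverse (real (Suc n))))\<^sup>2"
      using x(2) by (intro power_strict_mono) auto
    then show ?thesis using x(1) by auto
  qed
  then obtain x where x: "\<And>n. x n \<in> V" "\<And>n. (norm (v - x n))\<^sup>2 < d\<^sup>2 + inverse (real (Suc n))" by metis
  have par: "(norm (x n - x m))\<^sup>2 \<le> 2 * (inverse (real (Suc n)) + inverse (real (Suc m)))" for n m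
  proof -
    have "(1/2) *\<^sub>R (x n + x m) \<in> V" using V(1) x(1) by (intro subspace_scale subspace_add)
    from power_mono[OF d_le[OF this] \<open>0 \<le> d\<close>, of 2]
    have "d\<^sup>2 \<le> (norm (v - (1/2) *\<^sub>R (x n + x m)))\<^sup>2" .
    moreover have "(norm (x n - x m))\<^sup>2 = 2 * (norm (v - x n))\<^sup>2 + 2 * (norm (v - x m))\<^sup>2
        - 4 * (norm (v - (1/2) *\<^sub>R (x n + x m)))\<^sup>2"
      unfolding power2_norm_eq_inner by (simp add: inner_diff inner_add inner_commute algebra_simps)
    ultimately have "(norm (x n - x m))\<^sup>2 \<le> 2 * ((norm (v - x n))\<^sup>2 - d\<^sup>2) + 2 * ((norm (v - x m))\<^sup>2 - d\<^sup>2)"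
      by simp
    also have "\<dots> \<le> 2 * inverse (real (Suc n)) + 2 * inverse (real (Suc m))"
      using x(2)[of n] x(2)[of m] by (intro add_mono mult_left_mono) (auto simp del: of_nat_Suc)
    finally show ?thesis by simp
  qed
  have "Cauchy x"
  proof (rule CauchyI')
    fix e :: real assume "e > 0"
    then obtain N where N: "inverse (real (Suc N)) < e\<^sup>2 / 4"
      using reals_Archimedean[of "e\<^sup>2 / 4"] by auto
    have "dist (x m) (x n) < e" if "m \<ge> N" "n > m" for m n
    proof -
      have "inverse (real (Suc m)) \<le> inverse (real (Suc N))" "inverse (real (Suc n)) \<le> inverse (real (Suc N))"
        using that by (auto simp: field_simps)
      then have "2 * (inverse (real (Suc m)) + inverse (real (Suc n))) \<le> 2 * (inverse (real (Suc N)) + inverse (real (Suc N)))"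
        by (intro mult_left_mono add_mono) auto
      also have "\<dots> < e\<^sup>2" using N by simp
      finally have "(norm (x m - x n))\<^sup>2 < e\<^sup>2" using par[of m n] by (rule le_less_trans[rotated])
      then show ?thesis using \<open>e > 0\<close> by (simp add: dist_norm power2_less_imp_less)
    qed
    then show "\<exists>M. \<forall>m\<ge>M. \<forall>n>m. dist (x m) (x n) < e" by blast
  qed
  then obtain p where p: "x \<longlonglongrightarrow> p" by (auto simp: Cauchy_convergent_iff convergent_def)
  have pV: "p \<in> V" using closed_sequentially[OF V(2) x(1) p] .
  have "(norm (v - p))\<^sup>2 \<le> d\<^sup>2 + 0"
  proof (rule LIMSEQ_le)
    show "(\<lambda>n. (norm (v - x n))\<^sup>2) \<longlonglongrightarrow> (norm (v - p))\<^sup>2" by (intro tendsto_intros p)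
    show "(\<lambda>n. d\<^sup>2 + inverse (real (Suc n))) \<longlonglongrightarrow> d\<^sup>2 + 0" by (intro tendsto_intros LIMSEQ_inverse_real_of_nat)
  qed (use x(2) in \<open>auto intro: less_imp_le\<close>)
  then have p_le: "(norm (v - p))\<^sup>2 \<le> d\<^sup>2" by simp
  have min: "(norm (v - p))\<^sup>2 \<le> (norm (v - y))\<^sup>2" if "y \<in> V" for y
    by (rule order_trans[OF p_le power_mono[OF d_le[OF that] \<open>0 \<le> d\<close>]])
  have "(v - p) \<bullet> h = 0" if h: "h \<in> V" for h
  proof (cases "h = 0")
    case False
    \<comment> \<open>This \<open>t\<close> minimises the quadratic, so that minimality at 0 forces
      it to be 0.\<close>
    define t where "t = ((v - p) \<bullet> h) / (h \<bullet> h)"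
    have "p + t *\<^sub>R h \<in> V" using V(1) pV h by (intro subspace_add subspace_scale)
    from min[OF this] have "(norm (v - p))\<^sup>2 \<le> (norm (v - (p + t *\<^sub>R h)))\<^sup>2" .
    also have "\<dots> = (norm (v - p))\<^sup>2 - 2 * t * ((v - p) \<bullet> h) + t\<^sup>2 * (h \<bullet> h)"
      unfolding power2_norm_eq_inner by (simp add: inner_diff inner_add inner_commute algebra_simps power2_eq_square)
    also have "2 * t * ((v - p) \<bullet> h) = 2 * (t\<^sup>2 * (h \<bullet> h))"
      using False by (simp add: t_def power2_eq_square)
    finally have "t\<^sup>2 * (h \<bullet> h) \<le> 0" by (simp add: mult.commute)
    then have "t = 0" using False by (metis inner_gt_zero_iff mult_le_0_iff not_less power2_less_eq_zero_iff zero_le_power2)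
    then show ?thesis using False by (simp add: t_def)
  qed simp
  then show ?thesis using that[OF pV] by blast
qed

section \<open>Orthonormal bases over an arbitrary index type\<close>

locale orthonormal_basis =
  fixes E :: "'i \<Rightarrow> 'a::{real_inner,complete_space}"
  assumes orthonormal: "E i \<bullet> E j = (if i = j then 1 else 0)"
    and total: "(\<And>i. v \<bullet> E i = 0) \<Longrightarrow> v = 0"
begin

lemma inner_sum_E: "finite F \<Longrightarrow> (\<Sum>i\<in>F. a i *\<^sub>R E i) \<bullet> E j = (if j \<in> F then a j else 0)"
  by (simp add: inner_sum_left orthonormal if_distrib sum.delta cong: if_cong)

lemma norm_sum_E: assumes "finite F" shows "(norm (\<Sum>i\<in>F. a i *\<^sub>R E i))\<^sup>2 = (\<Sum>i\<in>F. (a i)\<^sup>2)"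
  unfolding power2_norm_eq_inner
  by (subst inner_sum_right) (simp add: inner_sum_E assms power2_eq_square)

lemma bessel: assumes "finite F" shows "(\<Sum>i\<in>F. (v \<bullet> E i)\<^sup>2) \<le> (norm v)\<^sup>2"
proof -
  define p where "p = (\<Sum>i\<in>F. (v \<bullet> E i) *\<^sub>R E i)"
  have "v \<bullet> p = (\<Sum>i\<in>F. (v \<bullet> E i)\<^sup>2)" by (simp add: p_def inner_sum_right power2_eq_square)
  moreover have "(norm p)\<^sup>2 = (\<Sum>i\<in>F. (v \<bullet> E i)\<^sup>2)" unfolding p_def by (rule norm_sum_E[OF assms])
  moreover have "(norm (v - p))\<^sup>2 = (norm v)\<^sup>2 - 2 * (v \<bullet> p) + (norm p)\<^sup>2"
    unfolding power2_norm_eq_inner by (simp add: inner_diff inner_commute)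
  ultimately show ?thesis using zero_le_power2[of "norm (v - p)"] by linarith
qed

text \<open>The index type carries no order, so the partial sums run over an increasing sequence of
  finite sets chosen to come within \<open>inverse (real (Suc n))\<close> of the total. The norm of
  the limit is part of the result because \<open>parseval_E\<close> reads Parseval's identity off
  it.\<close>

lemma riesz_fischer_parseval:
  assumes "((\<lambda>i. (a i)\<^sup>2) has_sum s) UNIV"
  obtains w where "\<And>i. w \<bullet> E i = a i" "(norm w)\<^sup>2 = s"
proof -
  have le: "(\<Sum>i\<in>F. (a i)\<^sup>2) \<le> s" if "finite F" for F
    by (rule finite_sum_le_has_sum[OF assms that]) auto
  have "\<exists>F. finite F \<and> s - inverse (real (Suc n)) < (\<Sum>i\<in>F. (a i)\<^sup>2)" for n
  proof -
    have "((\<lambda>F. \<Sum>i\<in>F. (a i)\<^sup>2) \<longlongrightarrow> s) (finite_subsets_at_top UNIV)"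
      using assms by (simp add: has_sum_def)
    then have "\<forall>\<^sub>F F in finite_subsets_at_top UNIV. s - inverse (real (Suc n)) < (\<Sum>i\<in>F. (a i)\<^sup>2)"
      by (rule order_tendstoD) simp
    then show ?thesis unfolding eventually_finite_subsets_at_top by blast
  qed
  then obtain F where F: "\<And>n. finite (F n)" "\<And>n. s - inverse (real (Suc n)) < (\<Sum>i\<in>F n. (a i)\<^sup>2)" by metis
  define G where "G n = (\<Union>k\<le>n. F k)" for n
  have G: "finite (G n)" "n \<le> m \<Longrightarrow> G n \<subseteq> G m" for n m using F(1) by (auto simp: G_def intro: order_trans)
  have Gs: "s - inverse (real (Suc n)) < (\<Sum>i\<in>G n. (a i)\<^sup>2)" for n
  proof -
    have "(\<Sum>i\<in>F n. (a i)\<^sup>2) \<le> (\<Sum>i\<in>G n. (a i)\<^sup>2)"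
      using G(1) by (intro sum_mono2) (auto simp: G_def)
    then show ?thesis using F(2)[of n] by linarith
  qed
  define S where "S n = (\<Sum>i\<in>G n. a i *\<^sub>R E i)" for n
  have diff: "(norm (S m - S n))\<^sup>2 \<le> inverse (real (Suc n))" if "n \<le> m" for n m
  proof -
    have "S m - S n = (\<Sum>i\<in>G m - G n. a i *\<^sub>R E i)"
      unfolding S_def using G that by (simp add: sum_diff)
    then have "(norm (S m - S n))\<^sup>2 = (\<Sum>i\<in>G m - G n. (a i)\<^sup>2)" using G by (simp add: norm_sum_E)
    also have "\<dots> = (\<Sum>i\<in>G m. (a i)\<^sup>2) - (\<Sum>i\<in>G n. (a i)\<^sup>2)" using G that by (simp add: sum_diff)
    finally show ?thesis using le[OF G(1), of m] Gs[of n] by linarith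
  qed
  have "Cauchy S"
  proof (rule CauchyI')
    fix e :: real assume "e > 0"
    then obtain N where N: "inverse (real (Suc N)) < e\<^sup>2"
      using reals_Archimedean[of "e\<^sup>2"] by auto
    have "dist (S m) (S n) < e" if "m \<ge> N" "n > m" for m n
    proof -
      have "inverse (real (Suc m)) \<le> inverse (real (Suc N))" using that by (auto simp: field_simps)
      then have "(norm (S n - S m))\<^sup>2 < e\<^sup>2" using diff[of m n] that N by linarith
      then show ?thesis using \<open>e > 0\<close> by (simp add: dist_norm norm_minus_commute power2_less_imp_less)
    qed
    then show "\<exists>M. \<forall>m\<ge>M. \<forall>n>m. dist (S m) (S n) < e" by blast
  qed
  then obtain w where w: "S \<longlonglongrightarrow> w" by (auto simp: Cauchy_convergent_iff convergent_def)
  have sums: "(\<lambda>n. \<Sum>i\<in>G n. (a i)\<^sup>2) \<longlonglongrightarrow> s"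
  proof (rule tendsto_sandwich)
    show "\<forall>\<^sub>F n in sequentially. s - inverse (real (Suc n)) \<le> (\<Sum>i\<in>G n. (a i)\<^sup>2)"
      using Gs by (auto intro!: always_eventually less_imp_le)
    have "(\<lambda>n. s - inverse (real (Suc n))) \<longlonglongrightarrow> s - 0" by (intro tendsto_intros LIMSEQ_inverse_real_of_nat)
    then show "(\<lambda>n. s - inverse (real (Suc n))) \<longlonglongrightarrow> s" by simp
  qed (auto simp: le G)
  show ?thesis
  proof
    fix i
    have S_i: "(\<lambda>n. S n \<bullet> E i) \<longlonglongrightarrow> w \<bullet> E i" by (intro tendsto_intros w)
    show "w \<bullet> E i = a i"
    proof (cases "\<exists>N. i \<in> G N")
      case True
      then obtain N where "i \<in> G N" by blast
      then have "\<forall>\<^sub>F n in sequentially. S n \<bullet> E i = a i"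
        using G(2) by (auto simp: eventually_sequentially S_def inner_sum_E G(1) intro!: exI[of _ N])
      then have "(\<lambda>n. S n \<bullet> E i) \<longlonglongrightarrow> a i" by (rule tendsto_eventually)
      then show ?thesis using S_i LIMSEQ_unique by blast
    next
      \<comment> \<open>An index outside every \<open>G n\<close> could only add to the sum, which
        leaves less than \<open>inverse (real (Suc n))\<close> of room for each
        \<open>n\<close>.\<close>
      case False
      have "(a i)\<^sup>2 \<le> inverse (real (Suc n))" for n
      proof -
        have "(a i)\<^sup>2 + (\<Sum>i\<in>G n. (a i)\<^sup>2) \<le> s" using le[of "insert i (G n)"] False G(1) by simp
        then show ?thesis using Gs[of n] by linarith
      qed
      then have "(a i)\<^sup>2 \<le> 0" by (intro LIMSEQ_le_const[OF LIMSEQ_inverse_real_of_nat]) auto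
      then have "a i = 0" by simp
      moreover have "S n \<bullet> E i = 0" for n using False by (simp add: S_def inner_sum_E G(1))
      ultimately show ?thesis using S_i by (simp add: LIMSEQ_const_iff)
    qed
  next
    have "(\<lambda>n. (norm (S n))\<^sup>2) \<longlonglongrightarrow> (norm w)\<^sup>2" by (intro tendsto_intros w)
    then show "(norm w)\<^sup>2 = s" using sums by (simp add: S_def norm_sum_E G(1) LIMSEQ_unique)
  qed
qed

lemma riesz_fischer:
  assumes "(\<lambda>i. (a i)\<^sup>2) summable_on UNIV"
  obtains w where "\<And>i. w \<bullet> E i = a i"
  using assms riesz_fischer_parseval unfolding summable_on_def by metis

lemma eqI: "(\<And>i. v \<bullet> E i = w \<bullet> E i) \<Longrightarrow> v = w"
  using total[of "v - w"] by (simp add: inner_diff_left)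

lemma parseval_E: "((\<lambda>i. (v \<bullet> E i)\<^sup>2) has_sum (norm v)\<^sup>2) UNIV"
proof -
  have "(\<lambda>i. (v \<bullet> E i)\<^sup>2) summable_on UNIV"
    by (rule nonneg_bdd_above_summable_on) (auto intro!: bdd_aboveI2 bessel)
  then obtain s where s: "((\<lambda>i. (v \<bullet> E i)\<^sup>2) has_sum s) UNIV" by (auto simp: summable_on_def)
  then obtain w where "\<And>i. w \<bullet> E i = v \<bullet> E i" "(norm w)\<^sup>2 = s" using riesz_fischer_parseval by metis
  then have "(norm v)\<^sup>2 = s" using eqI by metis
  with s show ?thesis by simp
qed

lemma parseval_inner: "((\<lambda>i. (v \<bullet> E i) * (w \<bullet> E i)) has_sum v \<bullet> w) UNIV"
proof -
  have "((\<lambda>i. 1/4 * (((v + w) \<bullet> E i)\<^sup>2 + - 1 * ((v - w) \<bullet> E i)\<^sup>2)) has_sum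
      1/4 * ((norm (v + w))\<^sup>2 + - 1 * (norm (v - w))\<^sup>2)) UNIV"
    by (intro has_sum_cmult_right has_sum_add parseval_E)
  moreover have "1/4 * (((v + w) \<bullet> E i)\<^sup>2 + - 1 * ((v - w) \<bullet> E i)\<^sup>2) = (v \<bullet> E i) * (w \<bullet> E i)" for i
    by (simp add: inner_add_left inner_diff_left power2_eq_square algebra_simps)
  moreover have "1/4 * ((norm (v + w))\<^sup>2 + - 1 * (norm (v - w))\<^sup>2) = v \<bullet> w"
    unfolding power2_norm_eq_inner by (simp add: inner_add inner_diff inner_commute)
  ultimately show ?thesis by simp
qed

end

section \<open>Completeness of the space of square integrable fields\<close>

lemma rep_l2_field_diff:
  "AE x in torus. rep_l2_field (v - w) x = rep_l2_field v x - rep_l2_field w x"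
proof -
  have "v - w = v + (-1) *\<^sub>R w" by (rule minus_l2_field_def)
  then have "AE x in torus. rep_l2_field (v - w) x = rep_l2_field v x + rep_l2_field ((-1) *\<^sub>R w) x"
    using rep_l2_field_add[of v "(-1) *\<^sub>R w"] by (simp only:)
  then show ?thesis using rep_l2_field_scaleR[of "-1" w]
    by eventually_elim simp
qed

lemma norm_l2_field_rep:
  "(norm v)\<^sup>2 = integral\<^sup>L torus (\<lambda>x. (norm (rep_l2_field v x))\<^sup>2)"
  by (simp add: power2_norm_eq_inner inner_l2_field_rep)

lemma square_integrable_diff:
  "square_integrable f \<Longrightarrow> square_integrable g \<Longrightarrow> square_integrable (\<lambda>x. f x - g x)"
  using square_integrable_add[OF _ square_integrable_scaleR[of g "-1"], of f] by simp

lemma norm_l2_field_diff: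
  "(norm (v - w))\<^sup>2 = integral\<^sup>L torus (\<lambda>x. (norm (rep_l2_field v x - rep_l2_field w x))\<^sup>2)"
proof -
  have "(norm (v - w))\<^sup>2 = integral\<^sup>L torus (\<lambda>x. (norm (rep_l2_field (v - w) x))\<^sup>2)"
    by (rule norm_l2_field_rep)
  also have "\<dots> = integral\<^sup>L torus (\<lambda>x. (norm (rep_l2_field v x - rep_l2_field w x))\<^sup>2)"
  proof (rule integral_cong_AE)
    show "AE x in torus. (norm (rep_l2_field (v - w) x))\<^sup>2 = (norm (rep_l2_field v x - rep_l2_field w x))\<^sup>2"
      using rep_l2_field_diff[of v w] by eventually_elim simp
  qed (use square_integrable_rep square_integrable_diff[OF square_integrable_rep square_integrable_rep] in
      \<open>auto simp: square_integrable_def\<close>)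
  finally show ?thesis .
qed

text \<open>The increments of the representatives are summable in mean, hence the representatives
  converge almost everywhere; Fatou's lemma then bounds the distance to the limit in square
  mean.\<close>

lemma l2_rapid_convergent:
  assumes X: "\<And>n m. n \<le> m \<Longrightarrow> norm (X m - X n :: l2_field) \<le> (1/2) ^ n"
  shows "convergent X"
proof -
  define f where "f n = rep_l2_field (X n)" for n
  have sq: "square_integrable (f n)" for n unfolding f_def by (rule square_integrable_rep)
  have sqd: "square_integrable (\<lambda>x. f m x - f n x)" for m n by (intro square_integrable_diff sq)
  have meas [measurable]: "f n \<in> borel_measurable torus" for n using sq by (simp add: square_integrable_def)
  have norm_X: "(norm (X m - X n))\<^sup>2 = integral\<^sup>L torus (\<lambda>x. (norm (f m x - f n x))\<^sup>2)" for m n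
    unfolding f_def by (rule norm_l2_field_diff)
  have int2: "integrable torus (\<lambda>x. (norm (f m x - f n x))\<^sup>2)" for m n
    using sqd by (simp add: square_integrable_def)
  have step: "(\<integral>\<^sup>+x. ennreal (norm (f (Suc n) x - f n x)) \<partial>torus) \<le> ennreal ((1/2) ^ n)" for n
  proof -
    \<comment> \<open>By \<open>y \<le> a / 2 + y\<^sup>2 / (2 * a)\<close> and total mass 1, a
      bound \<open>a\<close> on the norm in square mean gives the same bound on the
      integral.\<close>
    define a :: real where "a = (1/2) ^ n"
    have "a > 0" by (simp add: a_def)
    have "(\<integral>\<^sup>+x. ennreal (norm (f (Suc n) x - f n x)) \<partial>torus) \<le>
        (\<integral>\<^sup>+x. ennreal (a / 2 + (norm (f (Suc n) x - f n x))\<^sup>2 / (2 * a)) \<partial>torus)"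
    proof (intro nn_integral_mono ennreal_leI)
      fix x
      define y where "y = norm (f (Suc n) x - f n x)"
      have "0 \<le> (a - y)\<^sup>2" by simp
      then show "norm (f (Suc n) x - f n x) \<le> a / 2 + (norm (f (Suc n) x - f n x))\<^sup>2 / (2 * a)"
        using \<open>a > 0\<close> unfolding y_def[symmetric] by (simp add: field_simps power2_eq_square)
    qed
    also have "\<dots> = ennreal (integral\<^sup>L torus (\<lambda>x. a / 2 + (norm (f (Suc n) x - f n x))\<^sup>2 / (2 * a)))"
      using \<open>a > 0\<close> by (intro nn_integral_eq_integral) (auto intro!: int2)
    also have "integral\<^sup>L torus (\<lambda>x. a / 2 + (norm (f (Suc n) x - f n x))\<^sup>2 / (2 * a)) = a / 2 + (norm (X (Suc n) - X n))\<^sup>2 / (2 * a)"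
      by (subst Bochner_Integration.integral_add) (auto simp: int2 norm_X measure_torus)
    also have "\<dots> \<le> a / 2 + a\<^sup>2 / (2 * a)"
      using X[of n "Suc n"] \<open>a > 0\<close> by (intro add_left_mono divide_right_mono power_mono) (auto simp: a_def)
    also have "\<dots> = a" using \<open>a > 0\<close> by (simp add: power2_eq_square)
    finally show ?thesis by (simp add: a_def ennreal_leI)
  qed
  have "AE x in torus. (\<Sum>n. ennreal (norm (f (Suc n) x - f n x))) \<noteq> \<infinity>"
  proof (rule nn_integral_noteq_infinite)
    have "(\<integral>\<^sup>+x. (\<Sum>n. ennreal (norm (f (Suc n) x - f n x))) \<partial>torus) = (\<Sum>n. \<integral>\<^sup>+x. ennreal (norm (f (Suc n) x - f n x)) \<partial>torus)"
      by (rule nn_integral_suminf) measurable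
    also have "\<dots> \<le> (\<Sum>n. ennreal ((1/2) ^ n))" by (intro suminf_le step) auto
    also have "\<dots> = ennreal (\<Sum>n. (1/2) ^ n)" by (rule suminf_ennreal2) (auto intro: summable_geometric)
    also have "\<dots> < \<infinity>" by simp
    finally show "(\<integral>\<^sup>+x. (\<Sum>n. ennreal (norm (f (Suc n) x - f n x))) \<partial>torus) \<noteq> \<infinity>" by simp
  qed measurable
  then have conv: "AE x in torus. convergent (\<lambda>n. f n x)"
  proof eventually_elim
    case (elim x)
    then have "summable (\<lambda>n. norm (f (Suc n) x - f n x))" by (intro summable_suminf_not_top) auto
    then have "summable (\<lambda>n. f (Suc n) x - f n x)" by (rule summable_norm_cancel)
    then have "convergent (\<lambda>n. \<Sum>k<n. f (Suc k) x - f k x)" by (simp add: summable_iff_convergent)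
    moreover have "(\<Sum>k<n. f (Suc k) x - f k x) = f n x - f 0 x" for n by (rule sum_lessThan_telescope)
    ultimately have "convergent (\<lambda>n. f n x - f 0 x)" by simp
    then show ?case by (simp add: convergent_diff_const_right_iff)
  qed
  define F where "F x = lim (\<lambda>n. f n x)" for x
  have Fm [measurable]: "F \<in> borel_measurable torus" unfolding F_def by (rule borel_measurable_lim_metric) measurable
  have bound: "(\<integral>\<^sup>+x. ennreal ((norm (F x - f n x))\<^sup>2) \<partial>torus) \<le> ennreal (((1/2) ^ n)\<^sup>2)" for n
  proof -
    have "(\<integral>\<^sup>+x. ennreal ((norm (F x - f n x))\<^sup>2) \<partial>torus) = (\<integral>\<^sup>+x. liminf (\<lambda>m. ennreal ((norm (f m x - f n x))\<^sup>2)) \<partial>torus)"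
    proof (rule nn_integral_cong_AE)
      show "AE x in torus. ennreal ((norm (F x - f n x))\<^sup>2) = liminf (\<lambda>m. ennreal ((norm (f m x - f n x))\<^sup>2))"
        using conv
      proof eventually_elim
        case (elim x)
        then have "(\<lambda>m. f m x) \<longlonglongrightarrow> F x" by (simp add: F_def convergent_LIMSEQ_iff)
        then have "(\<lambda>m. ennreal ((norm (f m x - f n x))\<^sup>2)) \<longlonglongrightarrow> ennreal ((norm (F x - f n x))\<^sup>2)"
          by (intro tendsto_ennrealI tendsto_intros)
        then show ?case by (intro lim_imp_Liminf[symmetric]) auto
      qed
    qed
    also have "\<dots> \<le> liminf (\<lambda>m. \<integral>\<^sup>+x. ennreal ((norm (f m x - f n x))\<^sup>2) \<partial>torus)"
      by (rule nn_integral_liminf) measurable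
    also have "\<dots> \<le> limsup (\<lambda>m. \<integral>\<^sup>+x. ennreal ((norm (f m x - f n x))\<^sup>2) \<partial>torus)"
      by (rule Liminf_le_Limsup) simp
    also have "\<dots> \<le> ennreal (((1/2) ^ n)\<^sup>2)"
    proof (rule Limsup_bounded)
      show "\<forall>\<^sub>F m in sequentially. (\<integral>\<^sup>+x. ennreal ((norm (f m x - f n x))\<^sup>2) \<partial>torus) \<le> ennreal (((1/2) ^ n)\<^sup>2)"
        unfolding eventually_sequentially
      proof (intro exI allI impI)
        fix m assume "n \<le> m"
        have "(\<integral>\<^sup>+x. ennreal ((norm (f m x - f n x))\<^sup>2) \<partial>torus) = ennreal ((norm (X m - X n))\<^sup>2)"
          unfolding norm_X by (rule nn_integral_eq_integral[OF int2]) simp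
        also have "\<dots> \<le> ennreal (((1/2) ^ n)\<^sup>2)" by (intro ennreal_leI power_mono X \<open>n \<le> m\<close>) simp
        finally show "(\<integral>\<^sup>+x. ennreal ((norm (f m x - f n x))\<^sup>2) \<partial>torus) \<le> ennreal (((1/2) ^ n)\<^sup>2)" .
      qed
    qed
    finally show ?thesis .
  qed
  have Fint: "integrable torus (\<lambda>x. (norm (F x - f n x))\<^sup>2)" for n
    by (rule integrableI_bounded) (use bound[of n] in \<open>auto simp: le_less_trans\<close>)
  have "square_integrable (\<lambda>x. F x - f 0 x)" using Fint by (simp add: square_integrable_def)
  from square_integrable_add[OF this sq[of 0]] have FS: "square_integrable F" by simp
  have le: "norm (abs_l2_field F - X n) \<le> (1/2) ^ n" for n
  proof -
    have "(norm (abs_l2_field F - X n))\<^sup>2 = integral\<^sup>L torus (\<lambda>x. (norm (rep_l2_field (abs_l2_field F) x - f n x))\<^sup>2)"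
      unfolding f_def by (rule norm_l2_field_diff)
    also have "\<dots> = integral\<^sup>L torus (\<lambda>x. (norm (F x - f n x))\<^sup>2)"
    proof (rule integral_cong_AE)
      show "AE x in torus. (norm (rep_l2_field (abs_l2_field F) x - f n x))\<^sup>2 = (norm (F x - f n x))\<^sup>2"
        using rep_abs_l2_field[OF FS] by eventually_elim simp
      have [measurable]: "rep_l2_field (abs_l2_field F) \<in> borel_measurable torus"
        using square_integrable_rep by (simp add: square_integrable_def)
      show "(\<lambda>x. (norm (rep_l2_field (abs_l2_field F) x - f n x))\<^sup>2) \<in> borel_measurable torus" by measurable
    qed measurable
    also have "ennreal \<dots> = (\<integral>\<^sup>+x. ennreal ((norm (F x - f n x))\<^sup>2) \<partial>torus)"
      by (rule nn_integral_eq_integral[OF Fint, symmetric]) simp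
    finally have "(norm (abs_l2_field F - X n))\<^sup>2 \<le> ((1/2) ^ n)\<^sup>2" using bound[of n] by (metis ennreal_le_iff zero_le_power2)
    then show ?thesis by (rule power2_le_imp_le) simp
  qed
  have "(\<lambda>n. X n - abs_l2_field F) \<longlonglongrightarrow> 0"
  proof (rule Lim_null_comparison)
    show "\<forall>\<^sub>F n in sequentially. norm (X n - abs_l2_field F) \<le> (1/2) ^ n"
      using le by (simp add: norm_minus_commute)
    show "(\<lambda>n. (1/2) ^ n :: real) \<longlonglongrightarrow> 0" by (rule LIMSEQ_power_zero) simp
  qed
  then show ?thesis using LIM_zero_cancel convergent_def by blast
qed

instance l2_field :: complete_space
proof
  fix X :: "nat \<Rightarrow> l2_field" assume C: "Cauchy X"
  have "\<exists>N. \<forall>m\<ge>N. \<forall>n\<ge>N. dist (X m) (X n) < (1/2) ^ k" for k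
    using C unfolding Cauchy_def by simp
  then obtain N where N: "\<And>k m n. m \<ge> N k \<Longrightarrow> n \<ge> N k \<Longrightarrow> dist (X m) (X n) < (1/2) ^ k" by metis
  \<comment> \<open>The summand \<open>k\<close> makes \<open>r\<close> strictly increasing, and the
    sum puts \<open>r k\<close> beyond \<open>N k\<close>.\<close>
  define r where "r k = k + (\<Sum>i\<le>k. N i)" for k
  have r: "strict_mono r" unfolding r_def by (auto simp: strict_mono_Suc_iff)
  have rN: "N k \<le> r k" for k unfolding r_def by (simp add: trans_le_add2 member_le_sum)
  have "convergent (X \<circ> r)"
  proof (rule l2_rapid_convergent)
    fix n m :: nat assume "n \<le> m"
    then have "N n \<le> r m" using rN[of n] strict_mono_less_eq[OF r, of n m] by linarith
    from N[OF this rN[of n]] show "norm ((X \<circ> r) m - (X \<circ> r) n) \<le> (1/2) ^ n" by (simp add: dist_norm)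
  qed
  then obtain L where "(X \<circ> r) \<longlonglongrightarrow> L" by (auto simp: convergent_def)
  then have "X \<longlonglongrightarrow> L" using Cauchy_converges_subseq[OF C r] by (simp add: o_def)
  then show "convergent X" by (auto simp: convergent_def)
qed

section \<open>Fourier coefficients of vector fields\<close>

definition scalar_field :: "(real^3 \<Rightarrow> real) \<Rightarrow> 3 \<Rightarrow> l2_field" where
  "scalar_field g j = abs_l2_field (\<lambda>x. g x *\<^sub>R axis j 1)"

lemma square_integrable_scalar_field:
  "continuous_on UNIV g \<Longrightarrow> square_integrable (\<lambda>x. g x *\<^sub>R axis j 1)"
  by (intro square_integrable_continuous continuous_intros)

lemma inner_scalar_field:
  assumes "continuous_on UNIV g"
  shows "v \<bullet> scalar_field g j = integral\<^sup>L torus (\<lambda>x. g x * rep_l2_field v x $ j)"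
  unfolding scalar_field_def
  by (subst integral_rep_l2_field[symmetric, OF square_integrable_scalar_field[OF assms]])
    (simp add: inner_axis)

lemma rep_component_integrable: "integrable torus (\<lambda>x. rep_l2_field v x $ j)"
proof -
  have m: "rep_l2_field v \<in> borel_measurable torus" and
    s: "integrable torus (\<lambda>x. (norm (rep_l2_field v x))\<^sup>2)"
    using square_integrable_rep[of v] by (auto simp: square_integrable_def)
  have "integrable torus (rep_l2_field v)"
    using torus.square_integrable_imp_integrable[OF measurable_compose[OF m borel_measurable_norm] s] m
    by (rule integrable_norm_cancel)
  then show ?thesis by (rule integrable_bounded_linear[OF bounded_linear_vec_nth])
qed

lemma inner_scalar_field_scalar_field:
  assumes g: "continuous_on UNIV g" and h: "continuous_on UNIV h"
  shows "scalar_field g i \<bullet> scalar_field h j = (if i = j then integral\<^sup>L torus (\<lambda>x. g x * h x) else 0)"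
proof -
  have "scalar_field g i \<bullet> scalar_field h j =
      integral\<^sup>L torus (\<lambda>x. rep_l2_field (scalar_field g i) x \<bullet> (h x *\<^sub>R axis j 1))"
    unfolding scalar_field_def[of h]
    by (rule integral_rep_l2_field[symmetric, OF square_integrable_scalar_field[OF h]])
  also have "\<dots> = integral\<^sup>L torus (\<lambda>x. (g x *\<^sub>R axis i 1) \<bullet> (h x *\<^sub>R (axis j 1 :: real^3)))"
  proof (rule integral_cong_AE)
    show "AE x in torus. rep_l2_field (scalar_field g i) x \<bullet> (h x *\<^sub>R axis j 1) = (g x *\<^sub>R axis i 1) \<bullet> (h x *\<^sub>R (axis j 1 :: real^3))"
      using rep_abs_l2_field[OF square_integrable_scalar_field[OF g, of i]] unfolding scalar_field_def
      by eventually_elim simp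
  qed (intro borel_measurable_integrable square_integrable_inner square_integrable_rep
      square_integrable_scalar_field g h)+
  also have "\<dots> = (if i = j then integral\<^sup>L torus (\<lambda>x. g x * h x) else 0)"
    by (simp add: inner_axis_axis mult.commute)
  finally show ?thesis .
qed

lemma l2_eq_0I: "AE x in torus. rep_l2_field v x = 0 \<Longrightarrow> v = 0"
proof -
  assume "AE x in torus. rep_l2_field v x = 0"
  then have "integral\<^sup>L torus (\<lambda>x. rep_l2_field v x \<bullet> rep_l2_field v x) = integral\<^sup>L torus (\<lambda>x. 0)"
    by (intro integral_cong_AE borel_measurable_integrable square_integrable_inner square_integrable_rep)
      (auto elim: AE_mp)
  then have "v \<bullet> v = 0" by (simp add: inner_l2_field_rep)
  then show ?thesis by simp
qed

definition cas_field :: "(int^3) \<times> 3 \<Rightarrow> l2_field" where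
  "cas_field = (\<lambda>(k, j). scalar_field (cas k) j)"

interpretation cas: orthonormal_basis cas_field
proof
  fix p q
  show "cas_field p \<bullet> cas_field q = (if p = q then 1 else 0)"
    by (cases p, cases q)
      (auto simp: cas_field_def inner_scalar_field_scalar_field continuous_cas integral_cas_cas)
next
  fix v assume v: "\<And>p. v \<bullet> cas_field p = 0"
  have "AE x in torus. rep_l2_field v x $ j = 0" for j
  proof (rule cas_total[OF rep_component_integrable])
    show "integral\<^sup>L torus (\<lambda>x. rep_l2_field v x $ j * cas k x) = 0" for k
      using v[of "(k, j)"] by (simp add: cas_field_def inner_scalar_field[OF continuous_cas] mult.commute)
  qed
  then have "AE x in torus. \<forall>j. rep_l2_field v x $ j = 0" by (simp add: AE_all_countable)
  then show "v = 0" by (intro l2_eq_0I) (simp add: vec_eq_iff)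
qed

section \<open>Weak derivatives and constraints in terms of coefficients\<close>

lemma smooth_continuous: "torus_smooth \<phi> \<Longrightarrow> continuous_on UNIV \<phi>"
  by (intro periodic_C1_continuous torus_smooth_imp_periodic_C1)

lemma smooth_partial_continuous: "torus_smooth \<phi> \<Longrightarrow> continuous_on UNIV (partial_deriv i \<phi>)"
  using torus_smooth_imp_periodic_C1[of \<phi>] by (simp add: periodic_C1_def)

lemma integral_scaleR_rep_component:
  assumes "continuous_on UNIV g"
  shows "integral\<^sup>L torus (\<lambda>x. g x *\<^sub>R rep_l2_field v x) $ j = v \<bullet> scalar_field g j"
proof -
  have "integrable torus (\<lambda>x. g x *\<^sub>R rep_l2_field v x)"
  proof -
    have "integrable torus (\<lambda>x. (g x *\<^sub>R rep_l2_field v x) $ i)" for i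
      using integrable_mult_continuous[OF rep_component_integrable assms, of v i] by (simp add: mult.commute)
    then have "integrable torus (\<lambda>x. \<Sum>i\<in>UNIV. (g x *\<^sub>R rep_l2_field v x) $ i *\<^sub>R (axis i 1 :: real^3))"
      by (intro Bochner_Integration.integrable_sum integrable_scaleR_left)
    moreover have "(\<Sum>i\<in>UNIV. y $ i *\<^sub>R (axis i 1 :: real^3)) = y" for y :: "real^3"
      using basis_expansion[of y] by (simp add: scalar_mult_eq_scaleR)
    ultimately show ?thesis by (simp only:)
  qed
  from integral_bounded_linear[OF bounded_linear_vec_nth this, of j]
  show ?thesis by (simp add: inner_scalar_field[OF assms])
qed

lemma weak_partial_inner:
  "weak_partial i v w \<longleftrightarrow> (\<forall>\<phi> j. torus_smooth \<phi> \<longrightarrow>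
     v \<bullet> scalar_field (partial_deriv i \<phi>) j = - (w \<bullet> scalar_field \<phi> j))"
  unfolding weak_partial_def
  by (auto simp: vec_eq_iff[where 'b = 3] integral_scaleR_rep_component smooth_continuous smooth_partial_continuous)

lemma scalar_field_cmult:
  assumes "continuous_on UNIV g"
  shows "v \<bullet> scalar_field (\<lambda>x. a * g x) j = a * (v \<bullet> scalar_field g j)"
  by (subst (1 2) inner_scalar_field) (auto intro!: continuous_intros assms simp: mult.assoc)

lemma partial_deriv_cas_1: "partial_deriv i (cas k) = (\<lambda>x. (2 * pi * of_int (k $ i)) * cas (- k) x)"
  using partial_deriv_cas[of i 1 k] by simp

lemma coeff_partial_deriv:
  assumes "torus_smooth \<phi>"
  shows "scalar_field (partial_deriv i \<phi>) j \<bullet> cas_field (k, l) =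
    - (2 * pi * of_int (k $ i)) * (scalar_field \<phi> j \<bullet> cas_field (- k, l))"
proof -
  have "integral\<^sup>L torus (\<lambda>x. partial_deriv i \<phi> x * cas k x) = - (2 * pi * of_int (k $ i)) * integral\<^sup>L torus (\<lambda>x. \<phi> x * cas (- k) x)"
    using integration_by_parts[OF torus_smooth_imp_periodic_C1[OF assms] periodic_C1_cas, of i k]
    by (simp add: partial_deriv_cas_1 mult.left_commute[of "\<phi> _"])
  then show ?thesis
    by (simp add: cas_field_def inner_scalar_field_scalar_field continuous_cas smooth_continuous
        smooth_partial_continuous assms)
qed

text \<open>Testing with the functions \<open>cas k\<close> alone determines the coefficients, with
  the frequency reversed since the derivative of \<open>cas k\<close> is a multiple of
  \<open>cas (- k)\<close>. Conversely, Parseval's identity moves the symbol from \<open>w\<close>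
  to the test function.\<close>

lemma weak_partial_iff:
  "weak_partial i v w \<longleftrightarrow>
    (\<forall>k j. w \<bullet> cas_field (k, j) = - (2 * pi * of_int (k $ i)) * (v \<bullet> cas_field (- k, j)))"
proof
  assume wp: "weak_partial i v w"
  show "\<forall>k j. w \<bullet> cas_field (k, j) = - (2 * pi * of_int (k $ i)) * (v \<bullet> cas_field (- k, j))"
  proof (intro allI)
    fix k j
    have "v \<bullet> scalar_field (partial_deriv i (cas k)) j = - (w \<bullet> scalar_field (cas k) j)"
      using wp torus_smooth_cas by (simp add: weak_partial_inner)
    then show "w \<bullet> cas_field (k, j) = - (2 * pi * of_int (k $ i)) * (v \<bullet> cas_field (- k, j))"
      by (simp add: partial_deriv_cas_1 scalar_field_cmult continuous_cas cas_field_def)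
  qed
next
  assume c: "\<forall>k j. w \<bullet> cas_field (k, j) = - (2 * pi * of_int (k $ i)) * (v \<bullet> cas_field (- k, j))"
  show "weak_partial i v w" unfolding weak_partial_inner
  proof (intro allI impI)
    fix \<phi> j assume \<phi>: "torus_smooth \<phi>"
    define n :: "(int^3) \<times> 3 \<Rightarrow> (int^3) \<times> 3" where "n = (\<lambda>(k, l). (- k, l))"
    have n: "bij_betw n UNIV UNIV" by (rule bij_betw_byWitness[where f' = n]) (auto simp: n_def)
    have "((\<lambda>p. (w \<bullet> cas_field p) * (scalar_field \<phi> j \<bullet> cas_field p)) has_sum w \<bullet> scalar_field \<phi> j) UNIV"
      by (rule cas.parseval_inner)
    then have "((\<lambda>p. (w \<bullet> cas_field (n p)) * (scalar_field \<phi> j \<bullet> cas_field (n p))) has_sum w \<bullet> scalar_field \<phi> j) UNIV"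
      using has_sum_reindex_bij_betw[OF n, of "\<lambda>p. (w \<bullet> cas_field p) * (scalar_field \<phi> j \<bullet> cas_field p)"] by simp
    then have "((\<lambda>p. - ((w \<bullet> cas_field (n p)) * (scalar_field \<phi> j \<bullet> cas_field (n p)))) has_sum - (w \<bullet> scalar_field \<phi> j)) UNIV"
      by (simp add: has_sum_uminus)
    moreover have "- ((w \<bullet> cas_field (n p)) * (scalar_field \<phi> j \<bullet> cas_field (n p))) =
        (v \<bullet> cas_field p) * (scalar_field (partial_deriv i \<phi>) j \<bullet> cas_field p)" for p
      by (cases p) (simp add: n_def c coeff_partial_deriv[OF \<phi>])
    ultimately have "((\<lambda>p. (v \<bullet> cas_field p) * (scalar_field (partial_deriv i \<phi>) j \<bullet> cas_field p)) has_sum - (w \<bullet> scalar_field \<phi> j)) UNIV"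
      by simp
    then show "v \<bullet> scalar_field (partial_deriv i \<phi>) j = - (w \<bullet> scalar_field \<phi> j)"
      using cas.parseval_inner has_sum_unique by blast
  qed
qed

lemma weak_pderiv_eq: "weak_partial i v w \<Longrightarrow> weak_pderiv i v = w"
  unfolding weak_pderiv_def
  by (rule the_equality) (auto simp: weak_partial_iff intro!: cas.eqI split: prod.split)

definition lap_symbol :: "int^3 \<Rightarrow> real" where
  "lap_symbol k = (\<Sum>i\<in>UNIV. (2 * pi * of_int (k $ i))\<^sup>2)"

lemma sobolev_2_iff:
  "v \<in> sobolev 2 \<longleftrightarrow> (\<forall>i. \<exists>w. weak_partial i v w \<and> (\<forall>j. \<exists>z. weak_partial j w z))"
  by (simp add: numeral_2_eq_2) blast

lemma coeff_laplacian:
  assumes "v \<in> sobolev 2"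
  shows "laplacian v \<bullet> cas_field (k, j) = - lap_symbol k * (v \<bullet> cas_field (k, j))"
proof -
  have "weak_pderiv i (weak_pderiv i v) \<bullet> cas_field (k, j) = - (2 * pi * of_int (k $ i))\<^sup>2 * (v \<bullet> cas_field (k, j))" for i
  proof -
    obtain w z where w: "weak_partial i v w" "weak_partial i w z"
      using assms unfolding sobolev_2_iff by blast
    then show ?thesis unfolding weak_pderiv_eq[OF w(1)] weak_pderiv_eq[OF w(2)]
      by (simp add: weak_partial_iff power2_eq_square)
  qed
  then show ?thesis
    by (simp add: laplacian_def lap_symbol_def inner_sum_left sum_distrib_right sum_negf)
qed

lemma coeff_exists:
  assumes "\<And>k j. \<bar>a (k, j)\<bar> \<le> \<bar>z \<bullet> cas_field (k, j)\<bar>"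
  obtains w where "\<And>k j. w \<bullet> cas_field (k, j) = a (k, j)"
proof -
  have "(\<lambda>p. (a p)\<^sup>2) summable_on UNIV"
  proof (rule summable_on_comparison_test)
    show "(\<lambda>p. (z \<bullet> cas_field p)\<^sup>2) summable_on UNIV"
      using cas.parseval_E[of z] by (auto simp: summable_on_def)
    show "(a p)\<^sup>2 \<le> (z \<bullet> cas_field p)\<^sup>2" for p
      using assms[of "fst p" "snd p"] by (simp add: abs_le_square_iff)
  qed auto
  from cas.riesz_fischer[OF this] that show ?thesis by metis
qed

text \<open>This is \<open>v\<close> composed with the map from \<open>x\<close> to
  \<open>- x\<close>, produced from its coefficients by Riesz-Fischer.\<close>

lemma reflection:
  obtains w where "\<And>k j. w \<bullet> cas_field (k, j) = v \<bullet> cas_field (- k, j)"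
proof -
  define n :: "(int^3) \<times> 3 \<Rightarrow> (int^3) \<times> 3" where "n = (\<lambda>(k, l). (- k, l))"
  have n: "bij_betw n UNIV UNIV" by (rule bij_betw_byWitness[where f' = n]) (auto simp: n_def)
  have "(\<lambda>p. (v \<bullet> cas_field (n p))\<^sup>2) summable_on UNIV"
    using summable_on_reindex_bij_betw[OF n, of "\<lambda>p. (v \<bullet> cas_field p)\<^sup>2"] cas.parseval_E[of v]
    by (auto simp: summable_on_def)
  then obtain w where "\<And>p. w \<bullet> cas_field p = v \<bullet> cas_field (n p)" using cas.riesz_fischer by metis
  then have "w \<bullet> cas_field (k, j) = v \<bullet> cas_field (- k, j)" for k j by (simp add: n_def)
  then show ?thesis by (rule that)
qed

lemma abs_symbol_le: "\<bar>2 * pi * of_int (k $ i) * (2 * pi * of_int (k $ j))\<bar> \<le> lap_symbol k"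
proof -
  define a where "a l = 2 * pi * real_of_int (k $ l)" for l
  have sq: "(a l)\<^sup>2 \<le> lap_symbol k" for l
    unfolding lap_symbol_def a_def by (rule member_le_sum) auto
  have "2 * (\<bar>a i\<bar> * \<bar>a j\<bar>) \<le> (a i)\<^sup>2 + (a j)\<^sup>2"
    using sum_squares_bound[of "\<bar>a i\<bar>" "\<bar>a j\<bar>"] by simp
  then show ?thesis using sq[of i] sq[of j] by (simp add: a_def[symmetric] abs_mult)
qed

text \<open>Frequencies are integers: each component is 0 or at least 1 in absolute value, so the
  first-order symbol is below its own square.\<close>

lemma abs_symbol_le_1: "\<bar>2 * pi * of_int (k $ i)\<bar> \<le> lap_symbol k"
proof (cases "k $ i = 0")
  case True
  then show ?thesis by (simp add: lap_symbol_def sum_nonneg)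
next
  case False
  then have "1 \<le> \<bar>real_of_int (k $ i)\<bar>" by linarith
  then have "1 * 1 \<le> (2 * pi) * \<bar>real_of_int (k $ i)\<bar>" using pi_gt3 by (intro mult_mono) auto
  then have "1 * \<bar>2 * pi * real_of_int (k $ i)\<bar> \<le> \<bar>2 * pi * real_of_int (k $ i)\<bar> * \<bar>2 * pi * real_of_int (k $ i)\<bar>"
    by (intro mult_right_mono) (auto simp: abs_mult)
  also have "\<dots> \<le> lap_symbol k" using abs_symbol_le[of k i i] by (simp only: abs_mult)
  finally show ?thesis by simp
qed

text \<open>The symbols of all derivatives of order one and two are dominated by
  \<open>lap_symbol\<close>, so square summability of the coefficients of \<open>z\<close> yields
  each of these derivatives through \<open>coeff_exists\<close>.\<close>

lemma sobolev_2I: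
  assumes z: "\<And>k j. z \<bullet> cas_field (k, j) = - lap_symbol k * (v \<bullet> cas_field (k, j))"
  shows "v \<in> sobolev 2"
  unfolding sobolev_2_iff
proof
  fix i
  have sym: "lap_symbol (- k) = lap_symbol k" for k by (simp add: lap_symbol_def)
  \<comment> \<open>The coefficient of a first derivative at \<open>k\<close> involves
    \<open>v\<close> at \<open>- k\<close>, hence the comparison with a reflected field.\<close>
  obtain z' where z': "\<And>k j. z' \<bullet> cas_field (k, j) = z \<bullet> cas_field (- k, j)" using reflection[of z] by metis
  have "\<bar>- (2 * pi * of_int (k $ i)) * (v \<bullet> cas_field (- k, j))\<bar> \<le> \<bar>z' \<bullet> cas_field (k, j)\<bar>" for k j
    using mult_right_mono[OF abs_symbol_le_1[of k i] abs_ge_zero[of "v \<bullet> cas_field (- k, j)"]]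
    by (simp only: z' z sym abs_mult abs_minus_cancel)
      (simp add: abs_mult lap_symbol_def sum_nonneg)
  from coeff_exists[of "\<lambda>(k, j). - (2 * pi * of_int (k $ i)) * (v \<bullet> cas_field (- k, j))", unfolded prod.case, OF this]
  obtain w where w: "\<And>k j. w \<bullet> cas_field (k, j) = - (2 * pi * of_int (k $ i)) * (v \<bullet> cas_field (- k, j))"
    by blast
  show "\<exists>w. weak_partial i v w \<and> (\<forall>j. \<exists>z. weak_partial j w z)"
  proof (rule exI[of _ w], intro conjI allI)
    show "weak_partial i v w" using w by (simp add: weak_partial_iff)
    fix j
    have "\<bar>- (2 * pi * of_int (k $ j)) * (w \<bullet> cas_field (- k, l))\<bar> \<le> \<bar>z \<bullet> cas_field (k, l)\<bar>" for k l
      using mult_right_mono[OF abs_symbol_le[of k j i] abs_ge_zero[of "v \<bullet> cas_field (k, l)"]]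
      by (simp add: w z abs_mult lap_symbol_def sum_nonneg mult.assoc)
    from coeff_exists[of "\<lambda>(k, l). - (2 * pi * of_int (k $ j)) * (w \<bullet> cas_field (- k, l))", unfolded prod.case, OF this]
    obtain y where "\<And>k l. y \<bullet> cas_field (k, l) = - (2 * pi * of_int (k $ j)) * (w \<bullet> cas_field (- k, l))"
      by blast
    then show "\<exists>z. weak_partial j w z" by (auto simp: weak_partial_iff)
  qed
qed

lemma inner_gradient:
  assumes "torus_smooth \<phi>"
  shows "v \<bullet> abs_l2_field (gradient \<phi>) = (\<Sum>i\<in>UNIV. v \<bullet> scalar_field (partial_deriv i \<phi>) i)"
proof -
  have int: "integrable torus (\<lambda>x. partial_deriv i \<phi> x * rep_l2_field v x $ i)" for i
    using integrable_mult_continuous[OF rep_component_integrable smooth_partial_continuous[OF assms]]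
    by (simp add: mult.commute)
  have "v \<bullet> abs_l2_field (gradient \<phi>) = integral\<^sup>L torus (\<lambda>x. rep_l2_field v x \<bullet> gradient \<phi> x)"
    by (rule integral_rep_l2_field[symmetric, OF square_integrable_gradient[OF assms]])
  also have "\<dots> = integral\<^sup>L torus (\<lambda>x. \<Sum>i\<in>UNIV. partial_deriv i \<phi> x * rep_l2_field v x $ i)"
    by (simp add: gradient_def inner_vec_def mult.commute)
  also have "\<dots> = (\<Sum>i\<in>UNIV. v \<bullet> scalar_field (partial_deriv i \<phi>) i)"
    by (subst Bochner_Integration.integral_sum)
      (auto simp: int inner_scalar_field smooth_partial_continuous assms)
  finally show ?thesis .
qed

lemma has_sum_sum:
  fixes f :: "'i \<Rightarrow> 'a \<Rightarrow> real"
  assumes "finite I" "\<And>i. i \<in> I \<Longrightarrow> (f i has_sum s i) A"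
  shows "((\<lambda>x. \<Sum>i\<in>I. f i x) has_sum (\<Sum>i\<in>I. s i)) A"
  using assms by (induction I rule: finite_induct) (auto intro: has_sum_add)

text \<open>The coefficients of a gradient at frequency \<open>k\<close> form a multiple of
  \<open>k\<close> itself, so orthogonality to all gradients is orthogonality of the coefficient
  vector to \<open>k\<close> at every frequency.\<close>

lemma divergence_free_coeff:
  "divergence_free v \<longleftrightarrow> (\<forall>k. (\<Sum>j\<in>UNIV. of_int (k $ j) * (v \<bullet> cas_field (k, j))) = 0)"
proof
  assume df: "divergence_free v"
  show "\<forall>k. (\<Sum>j\<in>UNIV. of_int (k $ j) * (v \<bullet> cas_field (k, j))) = 0"
  proof
    fix k
    have "0 = v \<bullet> abs_l2_field (gradient (cas (- k)))"
      using df torus_smooth_cas by (simp add: divergence_free_iff)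
    also have "\<dots> = - (2 * pi) * (\<Sum>j\<in>UNIV. of_int (k $ j) * (v \<bullet> cas_field (k, j)))"
      unfolding inner_gradient[OF torus_smooth_cas] partial_deriv_cas_1 scalar_field_cmult[OF continuous_cas]
      by (simp add: cas_field_def sum_distrib_left sum_negf mult.assoc)
    finally show "(\<Sum>j\<in>UNIV. of_int (k $ j) * (v \<bullet> cas_field (k, j))) = 0" by simp
  qed
next
  assume c: "\<forall>k. (\<Sum>j\<in>UNIV. of_int (k $ j) * (v \<bullet> cas_field (k, j))) = 0"
  show "divergence_free v" unfolding divergence_free_iff
  proof (intro allI impI)
    fix \<phi> assume \<phi>: "torus_smooth \<phi>"
    define h where "h k = integral\<^sup>L torus (\<lambda>x. \<phi> x * cas k x)" for k
    have h: "scalar_field \<phi> i \<bullet> cas_field (k, j) = (if i = j then h k else 0)" for i j k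
      by (simp add: cas_field_def inner_scalar_field_scalar_field smooth_continuous[OF \<phi>] continuous_cas h_def)
    have "((\<lambda>p. \<Sum>i\<in>UNIV. (v \<bullet> cas_field p) * (scalar_field (partial_deriv i \<phi>) i \<bullet> cas_field p)) has_sum
        v \<bullet> abs_l2_field (gradient \<phi>)) UNIV"
      unfolding inner_gradient[OF \<phi>] by (rule has_sum_sum) (auto intro: cas.parseval_inner)
    moreover have "(\<Sum>i\<in>UNIV. (v \<bullet> cas_field p) * (scalar_field (partial_deriv i \<phi>) i \<bullet> cas_field p)) =
        (case p of (k, j) \<Rightarrow> - (2 * pi) * h (- k) * (of_int (k $ j) * (v \<bullet> cas_field (k, j))))" for p
    proof -
      obtain k j where p: "p = (k, j)" by (cases p)
      have "(\<Sum>i\<in>UNIV. (v \<bullet> cas_field p) * (scalar_field (partial_deriv i \<phi>) i \<bullet> cas_field p)) =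
          (\<Sum>i\<in>UNIV. if i = j then - (2 * pi) * h (- k) * (of_int (k $ j) * (v \<bullet> cas_field (k, j))) else 0)"
        by (rule sum.cong) (auto simp: p coeff_partial_deriv[OF \<phi>] h)
      then show ?thesis by (simp add: p)
    qed
    ultimately have "((\<lambda>(k, j). - (2 * pi) * h (- k) * (of_int (k $ j) * (v \<bullet> cas_field (k, j)))) has_sum
        v \<bullet> abs_l2_field (gradient \<phi>)) (Sigma UNIV (\<lambda>_. UNIV))" by simp
    \<comment> \<open>Summing over the three components first turns each block into the assumed
      vanishing sum.\<close>
    then have "((\<lambda>k. 0) has_sum v \<bullet> abs_l2_field (gradient \<phi>)) (UNIV :: (int^3) set)"
    proof (rule has_sum_SigmaD)
      fix k :: "int^3"
      have "((\<lambda>j. - (2 * pi) * h (- k) * (of_int (k $ j) * (v \<bullet> cas_field (k, j)))) has_sum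
          (\<Sum>j\<in>UNIV. - (2 * pi) * h (- k) * (of_int (k $ j) * (v \<bullet> cas_field (k, j))))) UNIV"
        by (rule has_sum_finite) simp
      then show "((\<lambda>j. case (k, j) of (k, j) \<Rightarrow> - (2 * pi) * h (- k) * (of_int (k $ j) * (v \<bullet> cas_field (k, j)))) has_sum 0) UNIV"
        using c by (simp only: prod.case sum_distrib_left[symmetric] mult_zero_right)
    qed
    then show "v \<bullet> abs_l2_field (gradient \<phi>) = 0" using has_sum_0 has_sum_unique by metis
  qed
qed

lemma mean_free_coeff: "mean_free v \<longleftrightarrow> (\<forall>j. v \<bullet> cas_field (0, j) = 0)"
proof -
  have const: "square_integrable (\<lambda>x. c)" for c
    by (rule square_integrable_continuous[OF continuous_on_const])
  have ax: "cas_field (0, j) = abs_l2_field (\<lambda>x. axis j 1)" for j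
    by (simp add: cas_field_def scalar_field_def cas_0)
  have "v \<bullet> abs_l2_field (\<lambda>x. c) = (\<Sum>j\<in>UNIV. c $ j * (v \<bullet> cas_field (0, j)))" for c
  proof -
    have "v \<bullet> abs_l2_field (\<lambda>x. c) = integral\<^sup>L torus (\<lambda>x. \<Sum>j\<in>UNIV. c $ j * rep_l2_field v x $ j)"
      unfolding integral_rep_l2_field[OF const, symmetric] by (simp add: inner_vec_def mult.commute)
    also have "\<dots> = (\<Sum>j\<in>UNIV. c $ j * (v \<bullet> cas_field (0, j)))"
      by (subst Bochner_Integration.integral_sum)
        (auto simp: rep_component_integrable cas_field_def inner_scalar_field continuous_cas cas_0)
    finally show ?thesis .
  qed
  moreover have "v \<bullet> cas_field (0, j) = 0" if "\<forall>c. v \<bullet> abs_l2_field (\<lambda>x. c) = 0" for j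
    unfolding ax using that by blast
  ultimately show ?thesis unfolding mean_free_iff by auto
qed

section \<open>The solenoidal space and its projector\<close>

lemma norm_field_of: "norm (field_of v) = norm v"
  by (simp add: norm_solenoidal.rep_eq)

lemma inner_field_of: "field_of v \<bullet> field_of w = v \<bullet> w"
  by (simp add: inner_solenoidal.rep_eq)

lemma solenoidal_field_of: "divergence_free (field_of v)" "mean_free (field_of v)"
  using field_of[of v] by auto

lemma solenoidal_closed: "closed {v. divergence_free v \<and> mean_free v}"
proof -
  have "{v. divergence_free v \<and> mean_free v} =
      (\<Inter>\<phi>\<in>Collect torus_smooth. {v. v \<bullet> abs_l2_field (gradient \<phi>) = 0}) \<inter> (\<Inter>c. {v. v \<bullet> abs_l2_field (\<lambda>x. c) = 0})"
    by (auto simp: divergence_free_iff mean_free_iff)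
  also have "closed \<dots>"
    by (intro closed_Int closed_INT ballI closed_Collect_eq continuous_intros)
  finally show ?thesis .
qed

instance solenoidal :: complete_space
proof
  fix X :: "nat \<Rightarrow> solenoidal" assume C: "Cauchy X"
  have "Cauchy (\<lambda>n. field_of (X n))" using C unfolding Cauchy_def by (simp add: dist_solenoidal.rep_eq)
  then obtain L where L: "(\<lambda>n. field_of (X n)) \<longlonglongrightarrow> L" by (auto simp: Cauchy_convergent_iff convergent_def)
  have "L \<in> {v. divergence_free v \<and> mean_free v}"
    using solenoidal_closed _ L by (rule closed_sequentially) (rule field_of)
  then obtain u where "L = field_of u" by (metis Abs_solenoidal_inverse)
  then have "X \<longlonglongrightarrow> u" using L by (simp add: tendsto_iff dist_solenoidal.rep_eq)
  then show "convergent X" by (auto simp: convergent_def)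
qed

instance solenoidal :: banach ..

text \<open>The definite description is meaningful since the projection exists and is unique. All
  later facts about \<open>leray\<close> are derived from this identity.\<close>

lemma leray_inner: "leray v \<bullet> h = v \<bullet> field_of h"
proof -
  have sub: "subspace {v. divergence_free v \<and> mean_free v}"
    by (auto simp: subspace_def divergence_free_iff mean_free_iff inner_add_left)
  obtain p where p: "p \<in> {v. divergence_free v \<and> mean_free v}"
    "\<And>h. h \<in> {v. divergence_free v \<and> mean_free v} \<Longrightarrow> (v - p) \<bullet> h = 0"
    using orthogonal_projection_exists[OF sub solenoidal_closed] by blast
  obtain w where w: "p = field_of w" using p(1) by (metis Abs_solenoidal_inverse)
  have "\<forall>h. (v - field_of (leray v)) \<bullet> field_of h = 0"
    unfolding leray_def
  proof (rule theI)
    show "\<forall>h. (v - field_of w) \<bullet> field_of h = 0" using p(2) field_of w by blast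
    fix w' assume w': "\<forall>h. (v - field_of w') \<bullet> field_of h = 0"
    have "(w' - w) \<bullet> h = 0" for h
      using w'[rule_format, of h] p(2)[OF field_of, of h]
      by (simp add: w inner_diff_left inner_field_of)
    from this[of "w' - w"] show "w' = w" by simp
  qed
  then show ?thesis by (simp add: inner_diff_left inner_field_of)
qed

lemma inner_ext: "(\<And>h. v \<bullet> h = w \<bullet> h) \<Longrightarrow> v = (w :: 'a::real_inner)"
  using inner_eq_zero_iff[of "v - w"] by (simp add: inner_diff_left)

lemma leray_field_of: "leray (field_of w) = w"
  by (rule inner_ext) (simp add: leray_inner inner_field_of)

definition fourier_coeff :: "(int^3) \<times> 3 \<Rightarrow> solenoidal \<Rightarrow> real" where
  "fourier_coeff p v = field_of v \<bullet> cas_field p"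

definition eigenvalue :: "real \<Rightarrow> (int^3) \<times> 3 \<Rightarrow> real" where
  "eigenvalue \<nu> p = \<nu> * lap_symbol (fst p)"

text \<open>A factor that depends on \<open>k\<close> alone rescales the coefficient vector at each
  frequency and so keeps it orthogonal to \<open>k\<close>. Hence the Laplacian of a solenoidal
  field in the domain is solenoidal, and the projector acts on it as the identity.\<close>

lemma solenoidal_multiplier:
  assumes "\<And>k j. w \<bullet> cas_field (k, j) = m k * fourier_coeff (k, j) v"
  obtains u where "w = field_of u"
proof -
  have df: "(\<Sum>j\<in>UNIV. of_int (k $ j) * fourier_coeff (k, j) v) = 0" for k
    using solenoidal_field_of(1)[of v] unfolding divergence_free_coeff fourier_coeff_def by blast
  have "(\<Sum>j\<in>UNIV. of_int (k $ j) * (w \<bullet> cas_field (k, j))) = m k * (\<Sum>j\<in>UNIV. of_int (k $ j) * fourier_coeff (k, j) v)" for k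
    by (simp add: assms sum_distrib_left mult.left_commute)
  then have "divergence_free w" by (simp add: divergence_free_coeff df)
  moreover have "mean_free w"
    using solenoidal_field_of(2)[of v] by (simp add: mean_free_coeff assms fourier_coeff_def)
  ultimately show ?thesis using that[of "Abs_solenoidal w"] by (simp add: Abs_solenoidal_inverse)
qed

section \<open>The Stokes operator and the damping\<close>

lemma linear_fourier_coeff: "linear (fourier_coeff p)"
  by (rule linearI) (simp_all add: fourier_coeff_def plus_solenoidal.rep_eq scaleR_solenoidal.rep_eq inner_add_left)

lemma spectral_coeff:
  assumes "0 < \<nu>"
  shows "spectral fourier_coeff (eigenvalue \<nu>)"
  unfolding spectral_def
proof (intro conjI allI impI)
  fix p v
  show "linear (fourier_coeff p)" by (rule linear_fourier_coeff)
  show "((\<lambda>p. (fourier_coeff p v)\<^sup>2) has_sum (norm v)\<^sup>2) UNIV"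
    unfolding fourier_coeff_def norm_field_of[symmetric] by (rule cas.parseval_E)
  show "0 \<le> eigenvalue \<nu> p" using assms by (simp add: eigenvalue_def lap_symbol_def sum_nonneg)
next
  fix v and g :: "real \<Rightarrow> real"
  assume "(\<lambda>p. (g (eigenvalue \<nu> p) * fourier_coeff p v)\<^sup>2) summable_on UNIV"
  from cas.riesz_fischer[OF this] obtain w where w: "\<And>p. w \<bullet> cas_field p = g (eigenvalue \<nu> p) * fourier_coeff p v"
    by blast
  have "w \<bullet> cas_field (k, j) = g (\<nu> * lap_symbol k) * fourier_coeff (k, j) v" for k j
    by (simp add: w eigenvalue_def)
  from solenoidal_multiplier[OF this] obtain u where "w = field_of u" by blast
  then show "\<exists>w. \<forall>p. fourier_coeff p w = g (eigenvalue \<nu> p) * fourier_coeff p v" using w unfolding fourier_coeff_def by metis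
qed

lemma stokes_gen:
  assumes "0 < \<nu>" "v \<in> stokes_domain"
  shows "spectral.gen fourier_coeff (eigenvalue \<nu>) v (stokes \<nu> v)"
proof -
  interpret spectral fourier_coeff "eigenvalue \<nu>" by (rule spectral_coeff[OF assms(1)])
  have lap: "laplacian (field_of v) \<bullet> cas_field (k, j) = - lap_symbol k * fourier_coeff (k, j) v" for k j
    using coeff_laplacian assms(2) by (simp add: stokes_domain_def fourier_coeff_def)
  obtain u where u: "laplacian (field_of v) = field_of u"
    using solenoidal_multiplier[of "laplacian (field_of v)" "\<lambda>k. - lap_symbol k" v] lap by metis
  have "fourier_coeff p u = - lap_symbol (fst p) * fourier_coeff p v" for p
    using lap[of "fst p" "snd p"] by (simp add: u fourier_coeff_def)
  then show ?thesis
    by (simp add: gen_def stokes_def u leray_field_of eigenvalue_def)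
qed

text \<open>The field \<open>(1 / \<nu>) *\<^sub>R w\<close> has the coefficients of a Laplacian,
  which is what \<open>sobolev_2I\<close> asks for: the Sobolev domain is the full domain of the
  multiplication operator.\<close>

lemma gen_stokes:
  assumes "0 < \<nu>" "spectral.gen fourier_coeff (eigenvalue \<nu>) v w"
  shows "v \<in> stokes_domain" "stokes \<nu> v = w"
proof -
  interpret spectral fourier_coeff "eigenvalue \<nu>" by (rule spectral_coeff[OF assms(1)])
  show v: "v \<in> stokes_domain" unfolding stokes_domain_def mem_Collect_eq
  proof (rule sobolev_2I)
    fix k j
    have "fourier_coeff (k, j) w = - (\<nu> * lap_symbol k) * fourier_coeff (k, j) v"
      using assms(2) by (simp add: gen_def eigenvalue_def)
    then show "field_of ((1 / \<nu>) *\<^sub>R w) \<bullet> cas_field (k, j) = - lap_symbol k * (field_of v \<bullet> cas_field (k, j))"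
      using assms(1) by (simp add: fourier_coeff_def scaleR_solenoidal.rep_eq)
  qed
  show "stokes \<nu> v = w" using gen_unique[OF stokes_gen[OF assms(1) v] assms(2)] .
qed

section \<open>The damping operator\<close>

lemma square_integrable_multiply:
  assumes "ess_bounded torus chi"
  shows "square_integrable (\<lambda>x. (chi x * k) *\<^sub>R rep_l2_field v x)"
    and "\<exists>C\<ge>0. \<forall>v. norm (abs_l2_field (\<lambda>x. (chi x * k) *\<^sub>R rep_l2_field v x)) \<le> C * norm v"
proof -
  have chi [measurable]: "chi \<in> borel_measurable torus" using assms by (simp add: ess_bounded_def)
  have rep [measurable]: "rep_l2_field v \<in> borel_measurable torus" for v
    using square_integrable_rep by (simp add: square_integrable_def)
  obtain C where C: "AE x in torus. \<bar>chi x\<bar> \<le> C" using assms by (auto simp: ess_bounded_def)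
  define c where "c = max C 0 * \<bar>k\<bar>"
  have "0 \<le> c" by (simp add: c_def)
  have bound: "AE x in torus. (norm ((chi x * k) *\<^sub>R rep_l2_field v x))\<^sup>2 \<le> c\<^sup>2 * (norm (rep_l2_field v x))\<^sup>2" for v
    using C
  proof eventually_elim
    case (elim x)
    have "\<bar>chi x * k\<bar> \<le> c" using elim unfolding c_def abs_mult by (intro mult_right_mono) auto
    then have "norm ((chi x * k) *\<^sub>R rep_l2_field v x) \<le> c * norm (rep_l2_field v x)"
      unfolding norm_scaleR by (intro mult_right_mono) auto
    then show ?case by (metis norm_ge_zero power_mono power_mult_distrib)
  qed
  have int: "integrable torus (\<lambda>x. c\<^sup>2 * (norm (rep_l2_field v x))\<^sup>2)" for v
    using square_integrable_rep[of v] by (simp add: square_integrable_def)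
  have int2: "integrable torus (\<lambda>x. (norm ((chi x * k) *\<^sub>R rep_l2_field v x))\<^sup>2)" for v
  proof (rule Bochner_Integration.integrable_bound[OF int[of v]])
    show "(\<lambda>x. (norm ((chi x * k) *\<^sub>R rep_l2_field v x))\<^sup>2) \<in> borel_measurable torus" by measurable
    show "AE x in torus. norm ((norm ((chi x * k) *\<^sub>R rep_l2_field v x))\<^sup>2) \<le> norm (c\<^sup>2 * (norm (rep_l2_field v x))\<^sup>2)"
      using bound[of v] by eventually_elim simp
  qed
  show sq: "square_integrable (\<lambda>x. (chi x * k) *\<^sub>R rep_l2_field v x)" for v
    using int2 by (simp add: square_integrable_def)
  show "\<exists>C\<ge>0. \<forall>v. norm (abs_l2_field (\<lambda>x. (chi x * k) *\<^sub>R rep_l2_field v x)) \<le> C * norm v"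
  proof (intro exI[of _ c] conjI allI)
    fix v
    let ?f = "\<lambda>x. (chi x * k) *\<^sub>R rep_l2_field v x"
    have "(norm (abs_l2_field ?f))\<^sup>2 = integral\<^sup>L torus (\<lambda>x. (norm (?f x))\<^sup>2)"
      unfolding norm_l2_field_rep
    proof (rule integral_cong_AE)
      show "AE x in torus. (norm (rep_l2_field (abs_l2_field ?f) x))\<^sup>2 = (norm (?f x))\<^sup>2"
        using rep_abs_l2_field[OF sq[of v]] by eventually_elim simp
    qed measurable
    also have "\<dots> \<le> integral\<^sup>L torus (\<lambda>x. c\<^sup>2 * (norm (rep_l2_field v x))\<^sup>2)"
      by (rule integral_mono_AE[OF int2 int bound])
    also have "\<dots> = (c * norm v)\<^sup>2" by (simp add: norm_l2_field_rep[of v] power_mult_distrib)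
    finally show "norm (abs_l2_field ?f) \<le> c * norm v"
      by (rule power2_le_imp_le) (use \<open>0 \<le> c\<close> in simp)
  qed fact
qed

lemma damping_inner:
  assumes "ess_bounded torus chi"
  shows "damping chi k v \<bullet> h = k * integral\<^sup>L torus (\<lambda>x. chi x * (rep_l2_field (field_of v) x \<bullet> rep_l2_field (field_of h) x))"
proof -
  have "damping chi k v \<bullet> h = integral\<^sup>L torus (\<lambda>x. ((chi x * k) *\<^sub>R rep_l2_field (field_of v) x) \<bullet> rep_l2_field (field_of h) x)"
    unfolding damping_def leray_inner
    by (subst inner_commute, subst integral_rep_l2_field[symmetric, OF square_integrable_multiply(1)[OF assms]])
      (simp add: inner_commute)
  also have "\<dots> = k * integral\<^sup>L torus (\<lambda>x. chi x * (rep_l2_field (field_of v) x \<bullet> rep_l2_field (field_of h) x))"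
    by (simp add: mult.assoc mult.left_commute[of _ k])
  finally show ?thesis .
qed

lemma damping_scale:
  assumes "ess_bounded torus chi"
  shows "damping chi k v = k *\<^sub>R damping chi 1 v"
  by (rule inner_ext) (simp add: damping_inner[OF assms])

lemma damping_symmetric:
  assumes "ess_bounded torus chi"
  shows "damping chi k v \<bullet> h = v \<bullet> damping chi k h"
proof -
  have "damping chi k v \<bullet> h = damping chi k h \<bullet> v"
    unfolding damping_inner[OF assms] by (simp only: inner_commute[of "rep_l2_field (field_of v) _"])
  then show ?thesis by (simp only: inner_commute[of v])
qed

lemma bounded_linear_damping:
  assumes "ess_bounded torus chi"
  shows "bounded_linear (damping chi k)"
proof -
  obtain C where C: "C \<ge> 0" "\<And>v. norm (abs_l2_field (\<lambda>x. (chi x * k) *\<^sub>R rep_l2_field v x)) \<le> C * norm v"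
    using square_integrable_multiply(2)[OF assms] by blast
  show ?thesis
  proof (rule bounded_linear_intro[where K = C])
    fix v w :: solenoidal and a :: real
    \<comment> \<open>Symmetry moves the damping to the other factor, where linearity is that of the
      inner product.\<close>
    show "damping chi k (v + w) = damping chi k v + damping chi k w"
      by (rule inner_ext) (simp add: damping_symmetric[OF assms] inner_add_left)
    show "damping chi k (a *\<^sub>R v) = a *\<^sub>R damping chi k v"
      by (rule inner_ext) (simp add: damping_symmetric[OF assms])
    have "(norm (damping chi k v))\<^sup>2 = damping chi k v \<bullet> damping chi k v" by (simp add: power2_norm_eq_inner)
    also have "\<dots> = abs_l2_field (\<lambda>x. (chi x * k) *\<^sub>R rep_l2_field (field_of v) x) \<bullet> field_of (damping chi k v)"
      unfolding damping_def[of chi k v] leray_inner ..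
    also have "\<dots> \<le> norm (abs_l2_field (\<lambda>x. (chi x * k) *\<^sub>R rep_l2_field (field_of v) x)) * norm (field_of (damping chi k v))"
      by (rule norm_cauchy_schwarz)
    also have "\<dots> \<le> (C * norm v) * norm (damping chi k v)"
      using C(2)[of "field_of v"] unfolding norm_field_of by (intro mult_right_mono) auto
    finally show "norm (damping chi k v) \<le> norm v * C"
      by (cases "norm (damping chi k v) = 0") (use C(1) in \<open>auto simp: power2_eq_square mult.commute\<close>)
  qed
qed

lemma damping_nonneg:
  assumes "ess_bounded torus chi" "AE x in torus. 0 \<le> chi x"
  shows "0 \<le> damping chi 1 v \<bullet> v"
proof -
  have "0 \<le> integral\<^sup>L torus (\<lambda>x. chi x * (rep_l2_field (field_of v) x \<bullet> rep_l2_field (field_of v) x))"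
    by (rule integral_nonneg_AE) (use assms(2) in eventually_elim, simp)
  then show ?thesis by (simp add: damping_inner[OF assms(1)])
qed

section \<open>Absolutely continuous functions\<close>

text \<open>A gauge argument: near a point of differentiability the increment of \<open>f\<close> is at most
  \<open>\<epsilon>\<close> times the length, and the exceptional points are tags of intervals lying in an open set of
  small measure, where absolute continuity applies.\<close>

lemma absolutely_continuous_nonincreasing:
  fixes f :: "real \<Rightarrow> real"
  assumes ab: "a \<le> b" and ac: "absolutely_continuous_on_interval a b f" and N: "negligible N"
    and deriv: "\<And>t. t \<in> {a..b} \<Longrightarrow> t \<notin> N \<Longrightarrow> \<exists>D\<le>0. (f has_real_derivative D) (at t within {a..b})"
  shows "f b \<le> f a"
proof (rule field_le_epsilon)
  fix e' :: real assume "e' > 0"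
  \<comment> \<open>The good intervals will contribute at most \<open>e * (b - a)\<close> and the
    bad ones less than \<open>e\<close>.\<close>
  define e where "e = e' / (b - a + 1)"
  have "e > 0" using \<open>e' > 0\<close> ab by (simp add: e_def)
  obtain \<delta> where \<delta>: "\<delta> > 0" "\<And>n (l :: nat \<Rightarrow> real) r. (\<forall>i<n. a \<le> l i \<and> l i \<le> r i \<and> r i \<le> b) \<Longrightarrow>
        (\<forall>i<n. \<forall>j<n. i \<noteq> j \<longrightarrow> {l i<..<r i} \<inter> {l j<..<r j} = {}) \<Longrightarrow>
        (\<Sum>i<n. r i - l i) < \<delta> \<Longrightarrow> (\<Sum>i<n. dist (f (r i)) (f (l i))) < e"
    using ac[unfolded absolutely_continuous_on_interval_def, rule_format, OF \<open>e > 0\<close>] by blast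
  have Nm: "N \<in> lmeasurable" "measure lebesgue N = 0"
    using N negligible_iff_measure by blast+
  then have "N \<in> sets lebesgue" by auto
  from sets_lebesgue_outer_open[OF this \<delta>(1)] obtain G where G: "open G" "N \<subseteq> G"
    "G - N \<in> lmeasurable" "emeasure lebesgue (G - N) < ennreal \<delta>" by blast
  have "G = (G - N) \<union> N" using G(2) by blast
  then have Gm: "G \<in> lmeasurable" "measure lebesgue G \<le> measure lebesgue (G - N) + measure lebesgue N"
    using fmeasurable.Un[OF G(3) Nm(1)] measure_Un_le[of "G - N" lebesgue N] G(3) Nm(1) by auto
  have "measure lebesgue (G - N) < \<delta>"
    using G(4) \<delta>(1) unfolding emeasure_eq_measure2[OF G(3)] by (simp add: ennreal_less_iff)
  then have G\<delta>: "measure lebesgue G < \<delta>" using Gm(2) Nm(2) by linarith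
  \<comment> \<open>The factor \<open>sgn (y - t)\<close> orients the increment in the direction of
    increasing time, so one bound serves for points on either side of the tag.\<close>
  have "\<exists>d>0. \<forall>y\<in>{a..b}. \<bar>y - t\<bar> < d \<longrightarrow> (f y - f t) * sgn (y - t) \<le> e * \<bar>y - t\<bar>" if t: "t \<in> {a..b}" "t \<notin> N" for t
  proof -
    obtain D where D: "D \<le> 0" "(f has_real_derivative D) (at t within {a..b})" using deriv[OF t] by blast
    then obtain d where d: "d > 0" "\<And>y. y \<in> {a..b} \<Longrightarrow> \<bar>y - t\<bar> < d \<Longrightarrow> \<bar>f y - f t - D * (y - t)\<bar> \<le> e * \<bar>y - t\<bar>"
      using \<open>e > 0\<close> unfolding has_field_derivative_def has_derivative_within_alt real_norm_def by metis
    have "(f y - f t) * sgn (y - t) \<le> e * \<bar>y - t\<bar>" if "y \<in> {a..b}" "\<bar>y - t\<bar> < d" for y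
    proof -
      consider "y < t" | "y = t" | "t < y" by linarith
      then show ?thesis
      proof cases
        case 1
        have "0 \<le> D * (y - t)" using D(1) 1 by (intro mult_nonpos_nonpos) auto
        then show ?thesis using d(2)[OF that] 1 by (simp add: abs_le_iff)
      next
        case 3
        have "D * (y - t) \<le> 0" using D(1) 3 by (intro mult_nonpos_nonneg) auto
        then show ?thesis using d(2)[OF that] 3 by (simp add: abs_le_iff)
      qed simp
    qed
    with d(1) show ?thesis by blast
  qed
  then obtain d where d: "\<And>t. t \<in> {a..b} \<Longrightarrow> t \<notin> N \<Longrightarrow> d t > 0"
    "\<And>t y. t \<in> {a..b} \<Longrightarrow> t \<notin> N \<Longrightarrow> y \<in> {a..b} \<Longrightarrow> \<bar>y - t\<bar> < d t \<Longrightarrow> (f y - f t) * sgn (y - t) \<le> e * \<bar>y - t\<bar>"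
    by metis
  have "\<exists>r>0. ball t r \<subseteq> G" if "t \<in> N" for t using G that openE by blast
  then obtain \<rho> where \<rho>: "\<And>t. t \<in> N \<Longrightarrow> \<rho> t > 0" "\<And>t. t \<in> N \<Longrightarrow> ball t (\<rho> t) \<subseteq> G" by metis
  \<comment> \<open>An exceptional tag gets a radius that keeps its interval inside the open set
    \<open>G\<close> of measure less than \<open>\<delta>\<close>.\<close>
  define g where "g t = ball t (if t \<in> N then \<rho> t else if t \<in> {a..b} then d t else 1)" for t
  have "gauge g" unfolding g_def by (rule gauge_ball_dependent) (use \<rho> d in auto)
  then obtain p where p: "p tagged_division_of {a..b}" "g fine p" by (rule fine_division_exists_real)
  have fin: "finite p" using p(1) by (rule tagged_division_of_finite)
  have K: "\<exists>l r. K = {l..r} \<and> l \<le> x \<and> x \<le> r \<and> a \<le> l \<and> r \<le> b \<and> {l..r} \<subseteq> g x" if xK: "(x, K) \<in> p" for x K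
  proof -
    obtain l r where "K = {l..r}" using tagged_division_ofD(4)[OF p(1) xK] by auto
    moreover have "x \<in> K" "K \<subseteq> {a..b}" using tagged_division_ofD(2,3)[OF p(1) xK] .
    moreover have "K \<subseteq> g x" using p(2) xK by (auto simp: fine_def)
    ultimately show ?thesis by auto
  qed
  define inc where "inc = (\<lambda>(x :: real, K). f (Sup K) - f (Inf K))"
  define B where "B = {q \<in> p. fst q \<in> N}"
  have finB: "finite B" using fin by (simp add: B_def)
  have good: "inc q \<le> e * measure lborel (snd q)" if q: "q \<in> p - B" for q
  proof -
    obtain x K0 where [simp]: "q = (x, K0)" by (cases q)
    obtain l r where lr: "K0 = {l..r}" "l \<le> x" "x \<le> r" "a \<le> l" "r \<le> b" "{l..r} \<subseteq> g x"
      using K[of x K0] q by auto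
    have x: "x \<in> {a..b}" "x \<notin> N" using lr q by (auto simp: B_def)
    have lx: "l \<in> g x" "r \<in> g x" using lr by auto
    have "(f l - f x) * sgn (l - x) \<le> e * \<bar>l - x\<bar>" "(f r - f x) * sgn (r - x) \<le> e * \<bar>r - x\<bar>"
      by (rule d(2)[OF x]; use lr lx x in \<open>auto simp: g_def dist_real_def\<close>)+
    then have "f x - f l \<le> e * (x - l)" "f r - f x \<le> e * (r - x)"
      using lr(2,3) by (auto simp: sgn_if split: if_splits)
    then have "f r - f l \<le> e * (r - l)" by (simp add: algebra_simps)
    then show ?thesis using lr by (simp add: inc_def)
  qed
  have bad: "sum inc B < e"
  proof -
    \<comment> \<open>The bad intervals are enumerated because absolute continuity is stated for
      finite sequences.\<close>
    obtain h where h: "bij_betw h {..<card B} B" using ex_bij_betw_nat_finite[OF finB] by (auto simp: atLeast0LessThan)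
    define l where "l i = Inf (snd (h i))" for i
    define r where "r i = Sup (snd (h i))" for i
    have hK: "\<exists>x. h i = (x, {l i..r i}) \<and> x \<in> N \<and> l i \<le> x \<and> x \<le> r i \<and> a \<le> l i \<and> r i \<le> b \<and> {l i..r i} \<subseteq> g x"
      if "i < card B" for i
    proof -
      have "h i \<in> B" using h that by (auto simp: bij_betw_def)
      then obtain x K0 where xK: "h i = (x, K0)" "(x, K0) \<in> p" "x \<in> N" by (cases "h i") (auto simp: B_def)
      with K[OF xK(2)] show ?thesis by (auto simp: l_def r_def)
    qed
    have disj: "{l i<..<r i} \<inter> {l j<..<r j} = {}" if ij: "i < card B" "j < card B" "i \<noteq> j" for i j
    proof -
      have "h i \<noteq> h j" using h ij by (auto simp: bij_betw_def inj_on_def)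
      moreover obtain x y where "h i = (x, {l i..r i})" "h j = (y, {l j..r j})"
        using hK[OF ij(1)] hK[OF ij(2)] by blast
      moreover have "h i \<in> p" "h j \<in> p" using h ij by (auto simp: bij_betw_def B_def)
      ultimately have "interior {l i..r i} \<inter> interior {l j..r j} = {}"
        using tagged_division_ofD(5)[OF p(1)] by metis
      then show ?thesis by simp
    qed
    then have pw: "pairwise (\<lambda>i j. disjnt {l i<..<r i} {l j<..<r j}) {..<card B}"
      unfolding pairwise_def disjnt_def by blast
    have "(\<Sum>i<card B. r i - l i) = (\<Sum>i<card B. measure lebesgue {l i<..<r i})"
      by (rule sum.cong) (use hK in fastforce)+
    also have "\<dots> = measure lebesgue (\<Union>i<card B. {l i<..<r i})"
      by (rule measure_UNION'[OF _ _ pw, symmetric]) auto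
    also have "\<dots> \<le> measure lebesgue G"
    proof (rule measure_mono_fmeasurable[OF _ _ Gm(1)])
      show "(\<Union>i<card B. {l i<..<r i}) \<subseteq> G"
      proof
        fix y assume "y \<in> (\<Union>i<card B. {l i<..<r i})"
        then obtain i where i: "i < card B" "y \<in> {l i<..<r i}" by blast
        obtain x where x: "x \<in> N" "{l i..r i} \<subseteq> g x" using hK[OF i(1)] by blast
        then have "y \<in> g x" using i(2) by auto
        then show "y \<in> G" using x(1) \<rho>(2)[of x] by (auto simp: g_def)
      qed
    qed auto
    also have "\<dots> < \<delta>" by (rule G\<delta>)
    finally have small: "(\<Sum>i<card B. r i - l i) < \<delta>" .
    have "(\<Sum>i<card B. dist (f (r i)) (f (l i))) < e"
      by (rule \<delta>(2)[OF _ _ small]) (use hK disj in \<open>fastforce+\<close>)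
    moreover have "sum inc B = (\<Sum>i<card B. inc (h i))"
      using sum.reindex_bij_betw[OF h] by metis
    moreover have "\<dots> \<le> (\<Sum>i<card B. dist (f (r i)) (f (l i)))"
    proof (rule sum_mono)
      fix i assume "i \<in> {..<card B}"
      then obtain x where "h i = (x, {l i..r i})" using hK by blast
      then have "inc (h i) = f (r i) - f (l i)" by (simp add: inc_def l_def r_def split_def)
      then show "inc (h i) \<le> dist (f (r i)) (f (l i))" by (simp add: dist_real_def)
    qed
    ultimately show ?thesis by linarith
  qed
  have "f b - f a = sum inc p"
    unfolding inc_def by (rule additive_tagged_division_1[OF ab p(1), symmetric])
  also have "\<dots> = sum inc (p - B) + sum inc B" by (rule sum.subset_diff) (auto simp: B_def fin)
  also have "sum inc (p - B) \<le> (\<Sum>q\<in>p - B. e * measure lborel (snd q))" by (rule sum_mono) (rule good)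
  also have "\<dots> \<le> (\<Sum>q\<in>p. e * measure lborel (snd q))"
    using fin \<open>e > 0\<close> by (intro sum_mono2) auto
  also have "\<dots> = e * (b - a)"
    using additive_content_tagged_division[of p a b] p(1) ab
    by (simp add: sum_distrib_left[symmetric] split_def)
  finally have "f b - f a \<le> e * (b - a) + e" using bad by linarith
  also have "\<dots> = e * (b - a + 1)" by (simp add: algebra_simps)
  also have "\<dots> = e'" using ab unfolding e_def by simp
  finally show "f b \<le> f a + e'" by simp
qed

text \<open>A difference of squares is the difference of the norms times their sum, and the sum is
  at most \<open>2 * \<bar>R\<bar>\<close>.\<close>

lemma absolutely_continuous_norm_square_diff:
  fixes u v :: "real \<Rightarrow> 'a::real_inner"
  assumes u: "absolutely_continuous_on_interval a b u" and v: "absolutely_continuous_on_interval a b v"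
    and R: "\<And>t. t \<in> {a..b} \<Longrightarrow> norm (u t - v t) \<le> R"
  shows "absolutely_continuous_on_interval a b (\<lambda>t. (norm (u t - v t))\<^sup>2)"
  unfolding absolutely_continuous_on_interval_def
proof (intro allI impI)
  fix e :: real assume "e > 0"
  \<comment> \<open>Two functions with error \<open>e'\<close> and the factor
    \<open>2 * \<bar>R\<bar>\<close> give \<open>4 * \<bar>R\<bar> * e'\<close>; the added 1 covers
    \<open>R = 0\<close> and makes the final bound strict.\<close>
  define e' where "e' = e / (4 * (\<bar>R\<bar> + 1))"
  have "e' > 0" using \<open>e > 0\<close> by (simp add: e'_def)
  let ?adm = "\<lambda>n (l :: nat \<Rightarrow> real) r. (\<forall>i<n. a \<le> l i \<and> l i \<le> r i \<and> r i \<le> b) \<and>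
        (\<forall>i<n. \<forall>j<n. i \<noteq> j \<longrightarrow> {l i<..<r i} \<inter> {l j<..<r j} = {})"
  obtain d1 where d1: "d1 > 0" "\<And>n l r. ?adm n l r \<Longrightarrow> (\<Sum>i<n. r i - l i) < d1 \<Longrightarrow> (\<Sum>i<n. dist (u (r i)) (u (l i))) < e'"
    using u[unfolded absolutely_continuous_on_interval_def, rule_format, OF \<open>e' > 0\<close>] by blast
  obtain d2 where d2: "d2 > 0" "\<And>n l r. ?adm n l r \<Longrightarrow> (\<Sum>i<n. r i - l i) < d2 \<Longrightarrow> (\<Sum>i<n. dist (v (r i)) (v (l i))) < e'"
    using v[unfolded absolutely_continuous_on_interval_def, rule_format, OF \<open>e' > 0\<close>] by blast
  show "\<exists>\<delta>>0. \<forall>n (l :: nat \<Rightarrow> real) r. (\<forall>i<n. a \<le> l i \<and> l i \<le> r i \<and> r i \<le> b) \<and>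
      (\<forall>i<n. \<forall>j<n. i \<noteq> j \<longrightarrow> {l i<..<r i} \<inter> {l j<..<r j} = {}) \<and> (\<Sum>i<n. r i - l i) < \<delta> \<longrightarrow>
      (\<Sum>i<n. dist ((norm (u (r i) - v (r i)))\<^sup>2) ((norm (u (l i) - v (l i)))\<^sup>2)) < e"
  proof (intro exI[of _ "min d1 d2"] conjI allI impI)
    show "min d1 d2 > 0" using d1 d2 by simp
    fix n and l r :: "nat \<Rightarrow> real"
    assume H: "(\<forall>i<n. a \<le> l i \<and> l i \<le> r i \<and> r i \<le> b) \<and>
      (\<forall>i<n. \<forall>j<n. i \<noteq> j \<longrightarrow> {l i<..<r i} \<inter> {l j<..<r j} = {}) \<and> (\<Sum>i<n. r i - l i) < min d1 d2"
    have le: "dist ((norm (u t - v t))\<^sup>2) ((norm (u q - v q))\<^sup>2) \<le> 2 * \<bar>R\<bar> * (dist (u t) (u q) + dist (v t) (v q))"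
      if "t \<in> {a..b}" "q \<in> {a..b}" for t q
    proof -
      define z w where "z = u t - v t" and "w = u q - v q"
      have "dist ((norm z)\<^sup>2) ((norm w)\<^sup>2) = (norm z + norm w) * \<bar>norm z - norm w\<bar>"
        by (simp add: dist_real_def power2_eq_square square_diff_square_factored abs_mult)
      also have "\<dots> \<le> (2 * \<bar>R\<bar>) * norm (z - w)"
        using R[OF that(1)] R[OF that(2)] unfolding z_def[symmetric] w_def[symmetric]
        by (intro mult_mono norm_triangle_ineq3) auto
      also have "norm (z - w) \<le> dist (u t) (u q) + dist (v t) (v q)"
        using norm_triangle_ineq4[of "u t - u q" "v t - v q"]
        by (simp add: z_def w_def dist_norm algebra_simps)
      finally show ?thesis by (simp add: z_def w_def mult_left_mono)
    qed
    have "(\<Sum>i<n. dist ((norm (u (r i) - v (r i)))\<^sup>2) ((norm (u (l i) - v (l i)))\<^sup>2)) \<le>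
        (\<Sum>i<n. 2 * \<bar>R\<bar> * (dist (u (r i)) (u (l i)) + dist (v (r i)) (v (l i))))"
      by (rule sum_mono) (rule le; use H in force)
    also have "\<dots> = 2 * \<bar>R\<bar> * ((\<Sum>i<n. dist (u (r i)) (u (l i))) + (\<Sum>i<n. dist (v (r i)) (v (l i))))"
      by (simp only: sum_distrib_left[symmetric] sum.distrib)
    also have "\<dots> \<le> 2 * \<bar>R\<bar> * (e' + e')"
      using d1(2)[of n l r] d2(2)[of n l r] H by (intro mult_left_mono add_mono) auto
    also have "\<dots> < e"
    proof -
      have "\<bar>R\<bar> + 1 \<noteq> 0" by linarith
      then have "e = 4 * (\<bar>R\<bar> + 1) * e'" unfolding e'_def by simp
      then show ?thesis using \<open>e' > 0\<close> by (simp add: algebra_simps)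
    qed
    finally show "(\<Sum>i<n. dist ((norm (u (r i) - v (r i)))\<^sup>2) ((norm (u (l i) - v (l i)))\<^sup>2)) < e" .
  qed
qed

lemma lipschitz_imp_absolutely_continuous:
  assumes "L-lipschitz_on {a..b} u"
  shows "absolutely_continuous_on_interval a b u"
  unfolding absolutely_continuous_on_interval_def
proof (intro allI impI)
  fix e :: real assume "e > 0"
  have L: "0 \<le> L" using assms by (rule lipschitz_on_nonneg)
  show "\<exists>\<delta>>0. \<forall>n (l :: nat \<Rightarrow> real) r. (\<forall>i<n. a \<le> l i \<and> l i \<le> r i \<and> r i \<le> b) \<and>
      (\<forall>i<n. \<forall>j<n. i \<noteq> j \<longrightarrow> {l i<..<r i} \<inter> {l j<..<r j} = {}) \<and> (\<Sum>i<n. r i - l i) < \<delta> \<longrightarrow>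
      (\<Sum>i<n. dist (u (r i)) (u (l i))) < e"
  proof (intro exI[of _ "e / (L + 1)"] conjI allI impI)
    show "e / (L + 1) > 0" using \<open>e > 0\<close> L by simp
    fix n :: nat and l r :: "nat \<Rightarrow> real"
    assume H: "(\<forall>i<n. a \<le> l i \<and> l i \<le> r i \<and> r i \<le> b) \<and>
      (\<forall>i<n. \<forall>j<n. i \<noteq> j \<longrightarrow> {l i<..<r i} \<inter> {l j<..<r j} = {}) \<and> (\<Sum>i<n. r i - l i) < e / (L + 1)"
    have "(\<Sum>i<n. dist (u (r i)) (u (l i))) \<le> (\<Sum>i<n. (L + 1) * (r i - l i))"
    proof (rule sum_mono)
      fix i assume "i \<in> {..<n}"
      then have i: "a \<le> l i" "l i \<le> r i" "r i \<le> b" using H by auto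
      then have "dist (u (r i)) (u (l i)) \<le> L * (r i - l i)"
        using lipschitz_onD[OF assms, of "r i" "l i"] by (simp add: dist_real_def)
      also have "\<dots> \<le> (L + 1) * (r i - l i)" using i by (intro mult_right_mono) auto
      finally show "dist (u (r i)) (u (l i)) \<le> (L + 1) * (r i - l i)" .
    qed
    also have "\<dots> = (L + 1) * (\<Sum>i<n. r i - l i)" by (simp add: sum_distrib_left)
    also have "\<dots> < (L + 1) * (e / (L + 1))" using H L by (intro mult_strict_left_mono) auto
    also have "\<dots> = e" using L by simp
    finally show "(\<Sum>i<n. dist (u (r i)) (u (l i))) < e" .
  qed
qed

section \<open>Lipschitz representatives\<close>

text \<open>The recursion passes to the derivative of \<open>f\<close>, as the inductions for sums,
  products and affine substitutions demand; \<open>differentiable_upto_deriv_iff\<close> returns to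
  iterated \<open>deriv\<close>.\<close>

primrec differentiable_upto :: "nat \<Rightarrow> (real \<Rightarrow> real) \<Rightarrow> bool" where
  "differentiable_upto 0 f \<longleftrightarrow> True"
| "differentiable_upto (Suc m) f \<longleftrightarrow> (\<forall>t. f field_differentiable (at t)) \<and> differentiable_upto m (deriv f)"

lemma differentiable_upto_deriv_iff:
  "(\<forall>m. differentiable_upto m f) \<longleftrightarrow> (\<forall>m t. (deriv ^^ m) f field_differentiable (at t))"
proof -
  have "differentiable_upto m f \<longleftrightarrow> (\<forall>k<m. \<forall>t. (deriv ^^ k) f field_differentiable (at t))" for m
  proof (induction m arbitrary: f)
    case (Suc m)
    have split: "(\<forall>k<Suc m. P k) \<longleftrightarrow> P 0 \<and> (\<forall>k<m. P (Suc k))" for P :: "nat \<Rightarrow> bool"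
      by (metis less_Suc_eq_0_disj)
    have "(\<forall>k<Suc m. \<forall>t. (deriv ^^ k) f field_differentiable (at t)) \<longleftrightarrow>
        (\<forall>t. f field_differentiable (at t)) \<and> (\<forall>k<m. \<forall>t. (deriv ^^ k) (deriv f) field_differentiable (at t))"
      unfolding split by (simp add: funpow_swap1)
    then show ?case using Suc.IH[of "deriv f"] by simp
  qed simp
  then show ?thesis by blast
qed

lemma differentiable_upto_mono: "differentiable_upto (Suc m) f \<Longrightarrow> differentiable_upto m f"
  by (induction m arbitrary: f) auto

lemma differentiable_upto_add:
  "differentiable_upto m f \<Longrightarrow> differentiable_upto m g \<Longrightarrow> differentiable_upto m (\<lambda>t. f t + g t)"
proof (induction m arbitrary: f g)
  case (Suc m)
  then have "deriv (\<lambda>t. f t + g t) = (\<lambda>t. deriv f t + deriv g t)" by (auto simp: fun_eq_iff)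
  with Suc show ?case by (auto intro: field_differentiable_add)
qed simp

lemma differentiable_upto_mult:
  "differentiable_upto m f \<Longrightarrow> differentiable_upto m g \<Longrightarrow> differentiable_upto m (\<lambda>t. f t * g t)"
proof (induction m arbitrary: f g)
  case (Suc m)
  then have "deriv (\<lambda>t. f t * g t) = (\<lambda>t. f t * deriv g t + deriv f t * g t)" by (auto simp: fun_eq_iff)
  with Suc differentiable_upto_mono[OF Suc.prems(1)] differentiable_upto_mono[OF Suc.prems(2)]
  show ?case by (auto intro!: field_differentiable_mult differentiable_upto_add)
qed simp

lemma differentiable_upto_const: "differentiable_upto m (\<lambda>t. c)"
  by (induction m arbitrary: c) (auto simp: field_differentiable_const)

lemma differentiable_upto_affine:
  "differentiable_upto m f \<Longrightarrow> differentiable_upto m (\<lambda>t. f (a * t + b))"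
proof (induction m arbitrary: f)
  case (Suc m)
  have D: "((\<lambda>t. f (a * t + b)) has_field_derivative a * deriv f (a * t + b)) (at t)" for t
  proof -
    have "(f has_field_derivative deriv f (a * t + b)) (at (a * t + b))"
      using Suc.prems by (auto simp: DERIV_deriv_iff_field_differentiable)
    moreover have "((\<lambda>t. a * t + b) has_field_derivative a) (at t)" by (auto intro!: derivative_eq_intros)
    ultimately have "((\<lambda>t. f (a * t + b)) has_field_derivative deriv f (a * t + b) * a) (at t)"
      by (rule DERIV_chain2)
    then show ?thesis by (simp add: mult.commute[of a "deriv _ _"])
  qed
  then have "deriv (\<lambda>t. f (a * t + b)) = (\<lambda>t. a * deriv f (a * t + b))" by (auto simp: fun_eq_iff DERIV_imp_deriv)
  moreover have "differentiable_upto m (\<lambda>t. a * deriv f (a * t + b))"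
    using Suc by (intro differentiable_upto_mult differentiable_upto_const) auto
  ultimately show ?case using D by (auto simp: field_differentiable_def)
qed simp

text \<open>Allowing a polynomial in \<open>inverse t\<close> gives a family closed under
  differentiation, so one computation of a first derivative yields smoothness at 0 of every order.
  The bump functions use \<open>flat 1\<close>.\<close>

definition flat :: "real poly \<Rightarrow> real \<Rightarrow> real" where
  "flat p t = (if 0 < t then poly p (inverse t) * exp (- inverse t) else 0)"

lemma poly_exp_tendsto_0: "((\<lambda>y. poly p y * exp (- y)) \<longlongrightarrow> (0::real)) at_top"
proof -
  have "((\<lambda>y. \<Sum>i\<le>degree p. coeff p i * (y ^ i / exp y)) \<longlongrightarrow> (\<Sum>i\<le>degree p. coeff p i * 0)) at_top"
    by (intro tendsto_intros tendsto_power_div_exp_0)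
  moreover have "(\<Sum>i\<le>degree p. coeff p i * (y ^ i / exp y)) = poly p y * exp (- y)" for y
    by (simp add: poly_altdef sum_distrib_right exp_minus divide_inverse mult.assoc)
  ultimately show ?thesis by simp
qed

text \<open>The polynomial \<open>[:0, 0, 1:]\<close> is the square of the variable: it stems from
  the derivative \<open>- 1 / t\<^sup>2\<close> of the inner function
  \<open>inverse t\<close>.\<close>

lemma flat_deriv: "(flat p has_field_derivative flat ([:0, 0, 1:] * (p - pderiv p)) t) (at t)"
proof -
  consider "t < 0" | "t = 0" | "0 < t" by linarith
  then show ?thesis
  proof cases
    case 1
    have "((\<lambda>t. 0) has_field_derivative 0) (at t)" by simp
    then have "(flat p has_field_derivative 0) (at t)"
      by (rule has_field_derivative_transform_within_open[where S = "{..<0}"]) (use 1 in \<open>auto simp: flat_def\<close>)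
    then show ?thesis using 1 by (simp add: flat_def)
  next
    case 2
    have "((\<lambda>h. flat p h / h) \<longlongrightarrow> 0) (at 0)"
    proof (rule filterlim_split_at)
      have "\<forall>\<^sub>F h in at_left 0. flat p h / h = 0" by (auto simp: eventually_at_filter flat_def)
      then show "((\<lambda>h. flat p h / h) \<longlongrightarrow> 0) (at_left 0)" by (rule tendsto_eventually)
      \<comment> \<open>The difference quotient on the right is of the same form again, with the
        polynomial multiplied by the variable.\<close>
      have "((\<lambda>h. poly ([:0, 1:] * p) (inverse h) * exp (- inverse h)) \<longlongrightarrow> 0) (at_right (0::real))"
        by (rule filterlim_compose[OF poly_exp_tendsto_0 filterlim_inverse_at_top_right])
      moreover have "\<forall>\<^sub>F h in at_right 0. poly ([:0, 1:] * p) (inverse h) * exp (- inverse h) = flat p h / h"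
        by (auto simp: eventually_at_filter flat_def divide_inverse mult.commute mult.left_commute)
      ultimately show "((\<lambda>h. flat p h / h) \<longlongrightarrow> 0) (at_right 0)" by (rule Lim_transform_eventually)
    qed
    then show ?thesis using 2 by (simp add: has_field_derivative_iff flat_def)
  next
    case 3
    have "((\<lambda>t. poly p (inverse t) * exp (- inverse t)) has_field_derivative
        poly ([:0, 0, 1:] * (p - pderiv p)) (inverse t) * exp (- inverse t)) (at t)"
      using 3 by (auto intro!: derivative_eq_intros simp: algebra_simps power2_eq_square)
    then have "(flat p has_field_derivative poly ([:0, 0, 1:] * (p - pderiv p)) (inverse t) * exp (- inverse t)) (at t)"
      by (rule has_field_derivative_transform_within_open[where S = "{0<..}"]) (use 3 in \<open>auto simp: flat_def\<close>)
    then show ?thesis using 3 by (simp add: flat_def)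
  qed
qed

lemma differentiable_upto_flat: "differentiable_upto m (flat p)"
proof (induction m arbitrary: p)
  case (Suc m)
  have "deriv (flat p) = flat ([:0, 0, 1:] * (p - pderiv p))"
    using flat_deriv by (auto simp: fun_eq_iff DERIV_imp_deriv)
  then show ?case using Suc flat_deriv[of p] by (auto simp: field_differentiable_def)
qed simp

text \<open>As \<open>n\<close> grows, \<open>flat 1 (n * t)\<close> tends to the indicator of the positive reals, so these functions
  are smooth approximations from below of the indicator of \<open>{0<..<e}\<close>.\<close>

definition smooth_indicator :: "real \<Rightarrow> nat \<Rightarrow> real \<Rightarrow> real" where
  "smooth_indicator e n t = flat 1 (real (Suc n) * t) * flat 1 (real (Suc n) * (e - t))"

lemma flat_1_bounds: "0 \<le> flat 1 t" "flat 1 t \<le> 1"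
  by (auto simp: flat_def)

lemma smooth_indicator_bounds: "0 \<le> smooth_indicator e n t" "smooth_indicator e n t \<le> 1"
  unfolding smooth_indicator_def using flat_1_bounds by (auto intro: mult_le_one)

lemma smooth_indicator_eq_0: "t \<le> 0 \<or> e \<le> t \<Longrightarrow> smooth_indicator e n t = 0"
  by (auto simp: smooth_indicator_def flat_def mult_le_0_iff zero_less_mult_iff)

lemma smooth_indicator_lim: "(\<lambda>n. smooth_indicator e n t) \<longlonglongrightarrow> indicator {0<..<e} t"
proof (cases "0 < t \<and> t < e")
  case True
  have "(\<lambda>n. flat 1 (real (Suc n) * x)) \<longlonglongrightarrow> 1" if "x > 0" for x
  proof -
    have "(\<lambda>n. exp (- (inverse (real (Suc n)) * inverse x))) \<longlonglongrightarrow> exp (- (0 * inverse x))"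
      by (intro tendsto_intros LIMSEQ_inverse_real_of_nat)
    moreover have "0 < real (Suc n) * x" for n using that by simp
    ultimately show ?thesis unfolding flat_def by (simp del: of_nat_Suc)
  qed
  from tendsto_mult[OF this[of t] this[of "e - t"]] True show ?thesis
    by (simp add: smooth_indicator_def)
next
  case False
  then have "smooth_indicator e n t = 0" for n by (intro smooth_indicator_eq_0) auto
  then show ?thesis using False by (auto simp: indicator_def)
qed

lemma differentiable_upto_smooth_indicator:
  "differentiable_upto m (\<lambda>t. smooth_indicator e n (t - a))"
proof -
  have eq: "smooth_indicator e n (t - a) = flat 1 (real (Suc n) * t + - real (Suc n) * a) *
      flat 1 (- real (Suc n) * t + real (Suc n) * (e + a))" for t
    by (simp add: smooth_indicator_def algebra_simps)
  show ?thesis unfolding eq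
    by (intro differentiable_upto_mult differentiable_upto_affine differentiable_upto_flat)
qed

lemma continuous_smooth_indicator: "continuous_on X (smooth_indicator e n)"
proof -
  have "differentiable_upto (Suc 0) (\<lambda>t. smooth_indicator e n (t - 0))" by (rule differentiable_upto_smooth_indicator)
  then show ?thesis
    by (auto intro!: continuous_at_imp_continuous_on field_differentiable_imp_continuous_at)
qed

lemma antiderivative_exists:
  fixes f :: "real \<Rightarrow> real"
  assumes f: "continuous_on UNIV f" and supp: "\<And>t. t \<le> 0 \<or> e \<le> t \<Longrightarrow> f t = 0" and "0 \<le> e"
    and bounds: "\<And>t. 0 \<le> f t" "\<And>t. f t \<le> 1"
  obtains F where "\<And>t. (F has_field_derivative f t) (at t)" "\<And>t. t \<le> 0 \<Longrightarrow> F t = 0"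
    "\<And>t. e \<le> t \<Longrightarrow> F t = F e" "\<And>t. 0 \<le> F t" "\<And>t. F t \<le> e"
proof
  \<comment> \<open>Starting at \<open>- 1\<close> puts 0 in the interior of the interval of
    integration, so that differentiability at 0 is covered; to the left of 0 the integrand
    vanishes.\<close>
  define F where "F t = integral {- 1..t} f" for t
  have int: "f integrable_on {x..y}" for x y
    by (intro integrable_continuous_real continuous_on_subset[OF f]) auto
  show F0: "F t = 0" if "t \<le> 0" for t
  proof -
    have "F t = integral {- 1..t} (\<lambda>t. 0)" unfolding F_def by (rule integral_cong) (use that supp in auto)
    then show ?thesis by simp
  qed
  have split: "F y = F x + integral {x..y} f" if "- 1 \<le> x" "x \<le> y" for x y
    unfolding F_def using that by (intro Henstock_Kurzweil_Integration.integral_combine[symmetric] int) auto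
  show Fe: "F t = F e" if "e \<le> t" for t
  proof -
    have "integral {e..t} f = integral {e..t} (\<lambda>t. 0)" by (rule integral_cong) (use supp in auto)
    then show ?thesis using split[of e t] that \<open>0 \<le> e\<close> by simp
  qed
  show "0 \<le> F t" for t
    unfolding F_def by (rule Henstock_Kurzweil_Integration.integral_nonneg[OF int bounds(1)])
  have le: "F t \<le> e" if "0 \<le> t" "t \<le> e" for t
  proof -
    have "F t = integral {0..t} f" using split[of 0 t] that F0[of 0] by simp
    also have "\<dots> \<le> integral {0..t} (\<lambda>t. 1)" by (intro integral_le int) (auto simp: bounds)
    finally show ?thesis using that by simp
  qed
  show "F t \<le> e" for t
  proof -
    consider "t \<le> 0" | "0 \<le> t" "t \<le> e" | "e \<le> t" by linarith
    then show ?thesis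
    proof cases
      case 1
      then show ?thesis using \<open>0 \<le> e\<close> by (simp add: F0)
    next
      case 2
      then show ?thesis by (rule le)
    next
      case 3
      then have "F t = F e" by (rule Fe)
      then show ?thesis using le[of e] \<open>0 \<le> e\<close> by simp
    qed
  qed
  show "(F has_field_derivative f t) (at t)" for t
  proof (cases "- 1 < t")
    case True
    have "(F has_vector_derivative f t) (at t within {- 1..t + 1})"
      unfolding F_def by (rule integral_has_vector_derivative) (use True continuous_on_subset[OF f] in auto)
    moreover have "at t within {- 1..t + 1} = at t" by (rule at_within_interior) (use True in auto)
    ultimately show ?thesis by (simp add: has_real_derivative_iff_has_vector_derivative)
  next
    case False
    have "((\<lambda>t. 0) has_field_derivative 0) (at t)" by simp
    then have "(F has_field_derivative 0) (at t)"
      by (rule has_field_derivative_transform_within_open[where S = "{..<0}"]) (use False F0 in auto)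
    then show ?thesis using False supp by simp
  qed
qed

text \<open>Subtracting two translates of one antiderivative cancels its constant value on the
  right, which makes the support compact.\<close>

lemma test_function_difference:
  assumes "0 < a" "0 < b" "0 < e" "a + e < T" "b + e < T"
  obtains \<phi> where "test_function T \<phi>" "deriv \<phi> = (\<lambda>t. smooth_indicator e n (t - a) - smooth_indicator e n (t - b))"
    "\<And>t. \<bar>\<phi> t\<bar> \<le> e" "\<And>t. t \<notin> {min a b..max a b + e} \<Longrightarrow> \<phi> t = 0"
proof -
  obtain F where F: "\<And>t. (F has_field_derivative smooth_indicator e n t) (at t)" "\<And>t. t \<le> 0 \<Longrightarrow> F t = 0"
    "\<And>t. e \<le> t \<Longrightarrow> F t = F e" "\<And>t. 0 \<le> F t" "\<And>t. F t \<le> e"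
    using antiderivative_exists[OF continuous_smooth_indicator smooth_indicator_eq_0 _ smooth_indicator_bounds]
      less_imp_le[OF assms(3)] by metis
  define \<phi> where "\<phi> t = F (t - a) - F (t - b)" for t
  have D: "(\<phi> has_field_derivative smooth_indicator e n (t - a) - smooth_indicator e n (t - b)) (at t)" for t
  proof -
    have "((\<lambda>t. F (t - c)) has_field_derivative smooth_indicator e n (t - c)) (at t)" for c
      using DERIV_shift[of F _ t "- c"] F(1)[of "t - c"] by simp
    then show ?thesis unfolding \<phi>_def by (intro DERIV_diff)
  qed
  then have d: "deriv \<phi> = (\<lambda>t. smooth_indicator e n (t - a) - smooth_indicator e n (t - b))"
    by (auto simp: fun_eq_iff DERIV_imp_deriv)
  have zero: "\<phi> t = 0" if "t \<notin> {min a b..max a b + e}" for t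
    using that F(2)[of "t - a"] F(2)[of "t - b"] F(3)[of "t - a"] F(3)[of "t - b"] by (auto simp: \<phi>_def)
  have "differentiable_upto m \<phi>" for m
  proof (cases m)
    case (Suc k)
    have "differentiable_upto k (\<lambda>t. smooth_indicator e n (t - a) + (- 1) * smooth_indicator e n (t - b))"
      by (intro differentiable_upto_add differentiable_upto_mult differentiable_upto_const differentiable_upto_smooth_indicator)
    then show ?thesis using D Suc by (auto simp: d field_differentiable_def)
  qed simp
  then have "\<forall>m t. (deriv ^^ m) \<phi> field_differentiable (at t)" using differentiable_upto_deriv_iff by blast
  moreover have supp: "closure {t. \<phi> t \<noteq> 0} \<subseteq> {min a b..max a b + e}"
  proof (rule closure_minimal)
    show "{t. \<phi> t \<noteq> 0} \<subseteq> {min a b..max a b + e}" using zero by blast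
  qed simp
  moreover have "compact (closure {t. \<phi> t \<noteq> 0})"
    using supp by (meson bounded_closed_interval bounded_subset closed_closure compact_eq_bounded_closed)
  moreover have "{min a b..max a b + e} \<subseteq> {0<..<T}" using assms by auto
  ultimately have "test_function T \<phi>" unfolding test_function_def by blast
  moreover have "\<bar>\<phi> t\<bar> \<le> e" for t
    using F(4,5)[of "t - a"] F(4,5)[of "t - b"] by (simp add: \<phi>_def abs_le_iff)
  ultimately show ?thesis using that d zero by blast
qed

section \<open>Local averages of W^{1,infinity} functions\<close>

lemma ess_bounded_integrable:
  assumes "ess_bounded (lebesgue_on {0<..<T}) g"
  shows "integrable (lebesgue_on {0<..<T::real}) g"
proof -
  interpret finite_measure "lebesgue_on {0<..<T}" by (rule finite_measure_lebesgue_on) auto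
  obtain C where "AE t in lebesgue_on {0<..<T}. \<bar>g t\<bar> \<le> C" using assms by (auto simp: ess_bounded_def)
  then show ?thesis using assms unfolding ess_bounded_def by (intro integrable_const_bound[where B = C]) auto
qed

text \<open>The values of \<open>g\<close> at nonpositive times are arbitrary; cutting them off
  makes \<open>g0\<close> integrable on every interval that ends before \<open>T\<close>, as
  Lebesgue differentiation on the whole line demands.\<close>

lemma ess_bounded_extension:
  fixes g :: "real \<Rightarrow> real"
  assumes "ess_bounded (lebesgue_on {0<..<T}) g"
  defines "g0 \<equiv> \<lambda>t. if 0 < t then g t else (0::real)"
  assumes "b < T"
  shows "g0 integrable_on {a..b}"
    and "0 < a \<Longrightarrow> integral {a..b} g0 = integral\<^sup>L (lebesgue_on {0<..<T}) (\<lambda>t. g t * indicator {a<..<b} t)"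
proof -
  define G where "G t = (if t \<in> {0<..<T} then g t else 0)" for t
  have G: "integrable lebesgue G"
    unfolding G_def using ess_bounded_integrable[OF assms(1)]
    by (subst Lebesgue_Measure.integrable_restrict_UNIV) auto
  have Gset: "set_integrable lebesgue S G" if "S \<in> sets lebesgue" for S
    unfolding set_integrable_def using G that by (intro integrable_mult_indicator)
  have "G integrable_on {a..b}" by (intro set_lebesgue_integral_eq_integral(1) Gset) simp
  moreover have eq: "G t = g0 t" if "t \<in> {a..b}" for t using that assms(3) by (auto simp: G_def g0_def)
  ultimately show "g0 integrable_on {a..b}" by (rule integrable_eq)
  assume "0 < a"
  have "integral {a..b} g0 = integral {a..b} G" by (rule integral_cong) (simp add: eq)
  also have "\<dots> = integral {a<..<b} G" by (simp add: integral_open_interval_real)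
  also have "\<dots> = (LINT x:{a<..<b}|lebesgue. G x)"
    by (intro set_lebesgue_integral_eq_integral(2)[symmetric] Gset) simp
  also have "\<dots> = integral\<^sup>L lebesgue (\<lambda>t. if t \<in> {0<..<T} then g t * indicator {a<..<b} t else 0)"
    unfolding set_lebesgue_integral_def by (rule Bochner_Integration.integral_cong) (auto simp: G_def)
  also have "\<dots> = integral\<^sup>L (lebesgue_on {0<..<T}) (\<lambda>t. g t * indicator {a<..<b} t)"
    by (subst Lebesgue_Measure.integral_restrict_UNIV) auto
  finally show "integral {a..b} g0 = integral\<^sup>L (lebesgue_on {0<..<T}) (\<lambda>t. g t * indicator {a<..<b} t)" .
qed

text \<open>The weak derivative is tested with the function from
  \<open>test_function_difference\<close>, which is bounded by \<open>e\<close> and lives on an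
  interval of length \<open>\<bar>a - b\<bar> + e\<close>. Divided by \<open>e\<close>, this is a
  Lipschitz bound for averages over intervals of length \<open>e\<close>, up to an error
  \<open>C * e\<close>.\<close>

lemma average_estimate:
  assumes W: "sobolev_W1_infty T g"
  obtains C where "0 \<le> C" "\<And>a b e. 0 < a \<Longrightarrow> 0 < b \<Longrightarrow> 0 < e \<Longrightarrow> a + e < T \<Longrightarrow> b + e < T \<Longrightarrow>
    \<bar>integral {a..a + e} (\<lambda>t. if 0 < t then g t else 0) - integral {b..b + e} (\<lambda>t. if 0 < t then g t else 0)\<bar>
      \<le> C * e * (\<bar>a - b\<bar> + e)"
proof -
  let ?M = "lebesgue_on {0<..<T}"
  interpret finite_measure ?M by (rule finite_measure_lebesgue_on) auto
  obtain h where g: "ess_bounded ?M g" and h: "ess_bounded ?M h"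
    and weak: "\<And>\<phi>. test_function T \<phi> \<Longrightarrow> integral\<^sup>L ?M (\<lambda>t. g t * deriv \<phi> t) = - integral\<^sup>L ?M (\<lambda>t. h t * \<phi> t)"
    using W unfolding sobolev_W1_infty_def by blast
  have [measurable]: "g \<in> borel_measurable ?M" using g by (simp add: ess_bounded_def)
  obtain C0 where C0: "AE t in ?M. \<bar>h t\<bar> \<le> C0" using h by (auto simp: ess_bounded_def)
  define C where "C = max C0 0"
  have C: "0 \<le> C" "AE t in ?M. \<bar>h t\<bar> \<le> C" using C0 by (auto simp: C_def elim: AE_mp)
  have gi: "integrable ?M g" by (rule ess_bounded_integrable[OF g])
  have hm: "h \<in> borel_measurable ?M" using h by (simp add: ess_bounded_def)
  have "\<bar>integral {a..a + e} (\<lambda>t. if 0 < t then g t else 0) - integral {b..b + e} (\<lambda>t. if 0 < t then g t else 0)\<bar>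
      \<le> C * e * (\<bar>a - b\<bar> + e)" if ab: "0 < a" "0 < b" "0 < e" "a + e < T" "b + e < T" for a b e
  proof -
    let ?w = "\<lambda>n t. smooth_indicator e n (t - a) - smooth_indicator e n (t - b)"
    let ?i = "\<lambda>t. indicator {a<..<a + e} t - indicator {b<..<b + e} t :: real"
    have est: "\<bar>integral\<^sup>L ?M (\<lambda>t. g t * ?w n t)\<bar> \<le> C * e * (\<bar>a - b\<bar> + e)" for n
    proof -
      obtain \<phi> where \<phi>: "test_function T \<phi>" "deriv \<phi> = ?w n" "\<And>t. \<bar>\<phi> t\<bar> \<le> e"
        "\<And>t. t \<notin> {min a b..max a b + e} \<Longrightarrow> \<phi> t = 0"
        using test_function_difference[OF ab] by blast
      have \<phi>c: "continuous_on UNIV \<phi>"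
      proof -
        have "\<phi> field_differentiable (at t)" for t using \<phi>(1) unfolding test_function_def by (metis funpow_0)
        then show ?thesis by (auto intro!: continuous_at_imp_continuous_on field_differentiable_imp_continuous_at)
      qed
      have \<phi>m [measurable]: "\<phi> \<in> borel_measurable ?M"
        by (intro measurable_restrict_space1 measurable_completion)
          (use borel_measurable_continuous_onI[OF \<phi>c] in simp)
      have "integral\<^sup>L ?M (\<lambda>t. g t * ?w n t) = - integral\<^sup>L ?M (\<lambda>t. h t * \<phi> t)"
        using weak[OF \<phi>(1)] by (simp add: \<phi>(2))
      then have "\<bar>integral\<^sup>L ?M (\<lambda>t. g t * ?w n t)\<bar> = norm (integral\<^sup>L ?M (\<lambda>t. h t * \<phi> t))" by simp
      also have "\<dots> \<le> integral\<^sup>L ?M (\<lambda>t. norm (h t * \<phi> t))" by (rule integral_norm_bound)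
      also have "\<dots> \<le> integral\<^sup>L ?M (\<lambda>t. (C * e) * indicator {min a b..max a b + e} t)"
      proof (rule integral_mono_AE')
        show "integrable ?M (\<lambda>t. (C * e) * indicator {min a b..max a b + e} t :: real)"
          using ab by (intro integrable_mult_right integrable_real_indicator emeasure_finite[THEN less_top[THEN iffD1], folded infinity_ennreal_def])
            (auto simp: sets_restrict_space_iff)
        show "AE t in ?M. norm (h t * \<phi> t) \<le> (C * e) * indicator {min a b..max a b + e} t"
          using C(2)
        proof eventually_elim
          case (elim t)
          then show ?case using \<phi>(3)[of t] \<phi>(4)[of t] C(1)
            by (cases "t \<in> {min a b..max a b + e}") (auto simp: abs_mult intro!: mult_mono)
        qed
      qed (use C(1) ab in auto)
      also have "\<dots> = (C * e) * measure ?M {min a b..max a b + e}"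
      proof -
        have "{min a b..max a b + e} \<inter> {0<..<T} = {min a b..max a b + e}" using ab by auto
        then show ?thesis by (simp add: space_restrict_space)
      qed
      also have "measure ?M {min a b..max a b + e} = \<bar>a - b\<bar> + e"
        using ab by (subst measure_restrict_space) auto
      finally show ?thesis .
    qed
    \<comment> \<open>Letting the smooth bumps tend to indicators turns the tested integrals into
      integrals over the two intervals; the bound \<open>est\<close> does not depend on
      \<open>n\<close>.\<close>
    have "(\<lambda>n. integral\<^sup>L ?M (\<lambda>t. g t * ?w n t)) \<longlonglongrightarrow> integral\<^sup>L ?M (\<lambda>t. g t * ?i t)"
    proof (rule integral_dominated_convergence[where w = "\<lambda>t. \<bar>g t\<bar>"])
      show "integrable ?M (\<lambda>t. \<bar>g t\<bar>)" using gi by simp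
      have "{c<..<c + e} \<inter> {0<..<T} \<in> sets ?M" for c by (auto simp: sets_restrict_space)
      then show "(\<lambda>t. g t * ?i t) \<in> borel_measurable ?M"
        by (intro borel_measurable_times borel_measurable_diff borel_measurable_indicator') (auto simp: sets_restrict_space_iff space_restrict_space)
      have "(\<lambda>t. smooth_indicator e n (t - c)) \<in> borel_measurable ?M" for n c
      proof -
        have "continuous_on UNIV (\<lambda>t. smooth_indicator e n (t - c))"
          by (intro continuous_on_compose2[OF continuous_smooth_indicator[of UNIV]] continuous_intros) auto
        then show ?thesis
          by (intro measurable_restrict_space1 measurable_completion) (simp add: borel_measurable_continuous_onI)
      qed
      then show "(\<lambda>t. g t * ?w n t) \<in> borel_measurable ?M" for n by (intro borel_measurable_times borel_measurable_diff) auto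
      have ind: "indicator {0<..<e} (t - c) = (indicator {c<..<c + e} t :: real)" for t c by (auto simp: indicator_def)
      show "AE t in ?M. (\<lambda>n. g t * ?w n t) \<longlonglongrightarrow> g t * ?i t"
        unfolding ind[symmetric] by (intro AE_I2 tendsto_intros smooth_indicator_lim)
      show "AE t in ?M. norm (g t * ?w n t) \<le> \<bar>g t\<bar>" for n
      proof (rule AE_I2)
        fix t
        have "\<bar>?w n t\<bar> \<le> 1"
          using smooth_indicator_bounds[of e n "t - a"] smooth_indicator_bounds[of e n "t - b"] by linarith
        from mult_left_mono[OF this abs_ge_zero[of "g t"]] show "norm (g t * ?w n t) \<le> \<bar>g t\<bar>" by (simp add: abs_mult)
      qed
    qed
    then have lim: "(\<lambda>n. \<bar>integral\<^sup>L ?M (\<lambda>t. g t * ?w n t)\<bar>) \<longlonglongrightarrow> \<bar>integral\<^sup>L ?M (\<lambda>t. g t * ?i t)\<bar>" by (rule tendsto_rabs)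
    have "\<bar>integral\<^sup>L ?M (\<lambda>t. g t * ?i t)\<bar> \<le> C * e * (\<bar>a - b\<bar> + e)"
      by (rule LIMSEQ_le_const2[OF lim]) (use est in blast)
    moreover have "integral\<^sup>L ?M (\<lambda>t. g t * ?i t) =
        integral\<^sup>L ?M (\<lambda>t. g t * indicator {a<..<a + e} t) - integral\<^sup>L ?M (\<lambda>t. g t * indicator {b<..<b + e} t)"
    proof -
      have "integrable ?M (\<lambda>t. g t * indicator {c<..<c + e} t)" if "0 < c" "c + e < T" for c
        using gi that by (intro integrable_real_mult_indicator) (auto simp: sets_restrict_space_iff)
      then show ?thesis using ab by (simp add: right_diff_distrib)
    qed
    ultimately show ?thesis using ess_bounded_extension(2)[OF g ab(4,1)] ess_bounded_extension(2)[OF g ab(5,2)] by simp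
  qed
  then show ?thesis using that C(1) by blast
qed

text \<open>Off a null set \<open>g\<close> is the limit of its averages, and
  \<open>average_estimate\<close> makes it Lipschitz there on each bounded interval. The complement
  of a null set is dense, so the Lipschitz function extends to the closure.\<close>

lemma lipschitz_representative:
  assumes W: "\<And>T. 0 < T \<Longrightarrow> sobolev_W1_infty T g"
    and bd: "\<And>T. 0 < T \<Longrightarrow> AE t in lebesgue_on {0<..<T}. 0 \<le> g t \<and> g t \<le> Km"
  obtains \<kappa> N where "\<And>t. 0 \<le> \<kappa> t" "\<And>t. \<kappa> t \<le> Km" "\<And>T. \<exists>L. L-lipschitz_on {..T} \<kappa>"
    "negligible N" "\<And>t. 0 < t \<Longrightarrow> t \<notin> N \<Longrightarrow> \<kappa> t = g t"
proof -
  define g0 where "g0 t = (if 0 < t then g t else 0)" for t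
  have g0_int: "g0 integrable_on {a..b}" for a b
    unfolding g0_def using W[of "\<bar>b\<bar> + 1"] by (intro ess_bounded_extension(1)[of "\<bar>b\<bar> + 1"]) (auto simp: sobolev_W1_infty_def)
  then have "g0 integrable_on cbox a b" for a b by simp
  then obtain N0 where N0: "negligible N0" "\<And>x e. x \<notin> N0 \<Longrightarrow> 0 < e \<Longrightarrow>
      \<exists>d>0. \<forall>h. 0 < h \<and> h < d \<longrightarrow> norm (integral (cbox x (x + h *\<^sub>R One)) g0 /\<^sub>R h ^ DIM(real) - g0 x) < e"
    using integrable_ccontinuous_explicit[of g0] by metis
  have leb: "\<exists>d>0. \<forall>h. 0 < h \<and> h < d \<longrightarrow> \<bar>integral {x..x + h} g0 / h - g0 x\<bar> < e" if "x \<notin> N0" "0 < e" for x e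
    using N0(2)[OF that] by (simp add: divide_inverse mult.commute)
  define Nb where "Nb = {t. 0 < t \<and> \<not> (0 \<le> g t \<and> g t \<le> Km)}"
  have "negligible {t \<in> {0<..<real (Suc n)}. \<not> (0 \<le> g t \<and> g t \<le> Km)}" for n
  proof -
    have "AE t in lebesgue. t \<in> {0<..<real (Suc n)} \<longrightarrow> 0 \<le> g t \<and> g t \<le> Km"
      using bd[of "real (Suc n)"] AE_restrict_space_iff[of "{0<..<real (Suc n)}" lebesgue] by auto
    then have "negligible {t. \<not> (t \<in> {0<..<real (Suc n)} \<longrightarrow> 0 \<le> g t \<and> g t \<le> Km)}"
      unfolding eventually_ae_filter_negligible using negligible_subset by blast
    moreover have "{t. \<not> (t \<in> {0<..<real (Suc n)} \<longrightarrow> 0 \<le> g t \<and> g t \<le> Km)} = {t \<in> {0<..<real (Suc n)}. \<not> (0 \<le> g t \<and> g t \<le> Km)}"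
      by auto
    ultimately show ?thesis by (simp only:)
  qed
  then have "negligible (\<Union>n. {t \<in> {0<..<real (Suc n)}. \<not> (0 \<le> g t \<and> g t \<le> Km)})" by (intro negligible_Union_nat)
  moreover have "Nb \<subseteq> (\<Union>n. {t \<in> {0<..<real (Suc n)}. \<not> (0 \<le> g t \<and> g t \<le> Km)})"
  proof
    fix t assume t: "t \<in> Nb"
    obtain n where "t < real n" using reals_Archimedean2 by blast
    then have "t \<in> {t \<in> {0<..<real (Suc n)}. \<not> (0 \<le> g t \<and> g t \<le> Km)}" using t by (auto simp: Nb_def)
    then show "t \<in> (\<Union>n. {t \<in> {0<..<real (Suc n)}. \<not> (0 \<le> g t \<and> g t \<le> Km)})" by (rule UN_I[OF UNIV_I])
  qed
  ultimately have "negligible Nb" by (rule negligible_subset)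
  define N where "N = N0 \<union> Nb"
  have N: "negligible N" using N0(1) \<open>negligible Nb\<close> by (simp add: N_def negligible_Un)
  define U where "U n = {0<..<real (Suc n)} - N" for n
  have lip: "\<exists>C. C-lipschitz_on (U n) g" for n
  proof -
    obtain C where C: "0 \<le> C" "\<And>a b e. 0 < a \<Longrightarrow> 0 < b \<Longrightarrow> 0 < e \<Longrightarrow> a + e < real (Suc n) \<Longrightarrow> b + e < real (Suc n) \<Longrightarrow>
      \<bar>integral {a..a + e} g0 - integral {b..b + e} g0\<bar> \<le> C * e * (\<bar>a - b\<bar> + e)"
      using average_estimate[OF W[of "real (Suc n)"]] unfolding g0_def by auto
    have "C-lipschitz_on (U n) g"
    proof (rule lipschitz_onI[OF _ C(1)])
      fix x y assume "x \<in> U n" "y \<in> U n"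
      then have xy: "0 < x" "x < real (Suc n)" "x \<notin> N0" "0 < y" "y < real (Suc n)" "y \<notin> N0" by (auto simp: U_def N_def)
      show "dist (g x) (g y) \<le> C * dist x y"
      proof (rule field_le_epsilon)
        fix e :: real assume "e > 0"
        then have e3: "e / 3 > 0" by simp
        obtain d1 where d1: "d1 > 0" "\<And>h. 0 < h \<Longrightarrow> h < d1 \<Longrightarrow> \<bar>integral {x..x + h} g0 / h - g0 x\<bar> < e / 3"
          using leb[OF xy(3) e3] by blast
        obtain d2 where d2: "d2 > 0" "\<And>h. 0 < h \<Longrightarrow> h < d2 \<Longrightarrow> \<bar>integral {y..y + h} g0 / h - g0 y\<bar> < e / 3"
          using leb[OF xy(6) e3] by blast
        \<comment> \<open>This bound on \<open>h\<close> keeps the error \<open>C * h\<close> of the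
          averages below \<open>e / 3\<close>; the other two thirds go to replacing averages by
          values.\<close>
        define q where "q = e / 3 / (C + 1)"
        have "q > 0" using \<open>e > 0\<close> C(1) by (simp add: q_def)
        have "Min {d1, d2, real (Suc n) - x, real (Suc n) - y, q} > 0"
          using d1(1) d2(1) xy \<open>q > 0\<close> by simp
        then obtain h where "0 < h" "h < Min {d1, d2, real (Suc n) - x, real (Suc n) - y, q}" using dense by blast
        then have h: "0 < h" "h < d1" "h < d2" "x + h < real (Suc n)" "y + h < real (Suc n)" "h < q" by auto
        have "\<bar>integral {x..x + h} g0 / h - integral {y..y + h} g0 / h\<bar> = \<bar>integral {x..x + h} g0 - integral {y..y + h} g0\<bar> / h"
          using h(1) by (simp add: diff_divide_distrib[symmetric])
        also have "\<dots> \<le> (C * h * (\<bar>x - y\<bar> + h)) / h"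
          using C(2)[OF xy(1,4) h(1,4,5)] h(1) by (intro divide_right_mono) auto
        also have "\<dots> = C * (\<bar>x - y\<bar> + h)" using h(1) by simp
        also have "\<dots> = C * \<bar>x - y\<bar> + C * h" by (rule distrib_left)
        also have "C * h \<le> (C + 1) * q" using h C(1) by (intro mult_mono) auto
        also have "(C + 1) * q = e / 3"
        proof -
          have "C + 1 \<noteq> 0" using C(1) by linarith
          then show ?thesis unfolding q_def by (rule nonzero_mult_div_cancel_left[of "C + 1" "e / 3", unfolded times_divide_eq_right[symmetric]])
        qed
        finally have "\<bar>g0 x - g0 y\<bar> \<le> C * \<bar>x - y\<bar> + e"
          using d1(2)[OF h(1,2)] d2(2)[OF h(1,3)] by linarith
        then show "dist (g x) (g y) \<le> C * dist x y + e" using xy by (simp add: g0_def dist_real_def)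
      qed
    qed
    then show ?thesis ..
  qed
  have "\<exists>C f. C-lipschitz_on (closure (U n)) f \<and> (\<forall>x\<in>U n. f x = g x)" for n
  proof -
    obtain C where "C-lipschitz_on (U n) g" using lip[of n] by blast
    from lipschitz_extend_closure[OF this] show ?thesis by blast
  qed
  then obtain C f where f: "\<And>n. (C n)-lipschitz_on (closure (U n)) (f n)" "\<And>n x. x \<in> U n \<Longrightarrow> f n x = g x" by metis
  have dense: "t \<in> closure (U n)" if t: "0 \<le> t" "t \<le> real (Suc n)" for t n
    unfolding closure_approachable
  proof (intro allI impI)
    fix e :: real assume "e > 0"
    have "max 0 (t - e) < min (real (Suc n)) (t + e)" using t \<open>e > 0\<close> by auto
    then have "\<not> negligible {max 0 (t - e)<..<min (real (Suc n)) (t + e)}"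
      by (intro open_not_negligible) (auto simp del: greaterThanLessThan_iff)
    then obtain x where "x \<in> {max 0 (t - e)<..<min (real (Suc n)) (t + e)}" "x \<notin> N"
      using N negligible_subset by blast
    then have "x \<in> U n" "dist x t < e" by (auto simp: U_def dist_real_def)
    then show "\<exists>x\<in>U n. dist x t < e" by blast
  qed
  have U_mono: "U k \<subseteq> U n" if "k \<le> n" for k n using that by (auto simp: U_def)
  \<comment> \<open>One sequence serves all \<open>n \<ge> k\<close>. It shows that the extensions
    agree where both are determined by \<open>g\<close>, and it carries the bounds of
    \<open>g\<close> to the limit.\<close>
  have limit: "\<exists>x. (\<forall>i. x i \<in> U k) \<and> x \<longlonglongrightarrow> t \<and> (\<forall>n\<ge>k. (\<lambda>i. g (x i)) \<longlonglongrightarrow> f n t)" if t: "0 \<le> t" "t \<le> real (Suc k)" for t k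
  proof -
    obtain x where x: "\<And>i. x i \<in> U k" "x \<longlonglongrightarrow> t" using dense[OF t] unfolding closure_sequential by blast
    have "(\<lambda>i. g (x i)) \<longlonglongrightarrow> f n t" if "k \<le> n" for n
    proof -
      have xn: "x i \<in> U n" for i using x(1) U_mono[OF that] by blast
      have "t \<in> closure (U n)" using t that by (intro dense) auto
      then have "(\<lambda>i. f n (x i)) \<longlonglongrightarrow> f n t"
        by (intro continuous_on_tendsto_compose[OF lipschitz_on_continuous_on[OF f(1)] x(2)])
          (use xn closure_subset in \<open>auto intro!: always_eventually\<close>)
      then show ?thesis using f(2)[OF xn] by simp
    qed
    with x show ?thesis by blast
  qed
  have agree: "f n t = f k t" if "k \<le> n" "0 \<le> t" "t \<le> real (Suc k)" for n k t
    using limit[OF that(2,3)] that(1) LIMSEQ_unique by blast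
  have bounds: "0 \<le> f k t \<and> f k t \<le> Km" if t: "0 \<le> t" "t \<le> real (Suc k)" for k t
  proof -
    obtain x where x: "\<And>i. x i \<in> U k" "(\<lambda>i. g (x i)) \<longlonglongrightarrow> f k t" using limit[OF t] by blast
    have "0 \<le> g (x i) \<and> g (x i) \<le> Km" for i using x(1)[of i] by (auto simp: U_def N_def Nb_def)
    then show ?thesis using LIMSEQ_le_const[OF x(2)] LIMSEQ_le_const2[OF x(2)] by blast
  qed
  \<comment> \<open>The index, the rounded-up time, selects an extension whose interval contains
    \<open>t\<close>; negative times get the value at 0, which preserves the Lipschitz
    bound.\<close>
  define \<kappa> where "\<kappa> t = f (nat \<lceil>max 0 t\<rceil>) (max 0 t)" for t
  have ceil: "max 0 t \<le> real (Suc (nat \<lceil>max 0 t\<rceil>))" for t :: real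
    by (rule order_trans[OF real_nat_ceiling_ge]) simp
  have ceil_less: "max 0 t < real (Suc (nat \<lceil>max 0 t\<rceil>))" for t :: real
    by (rule le_less_trans[OF real_nat_ceiling_ge]) simp
  have ceil_mono: "nat \<lceil>max 0 t\<rceil> \<le> nat \<lceil>max 0 T\<rceil>" if "t \<le> T" for t T :: real
    by (intro nat_mono ceiling_mono max.mono that order_refl)
  have \<kappa>_eq: "\<kappa> t = f (nat \<lceil>max 0 T\<rceil>) (max 0 t)" if "t \<le> T" for t T
    unfolding \<kappa>_def by (rule agree[symmetric, OF ceil_mono[OF that] max.cobounded1 ceil])
  show thesis
  proof (rule that)
    show "negligible N" by (rule N)
    show "0 \<le> \<kappa> t" "\<kappa> t \<le> Km" for t
      using bounds[OF max.cobounded1 ceil] unfolding \<kappa>_def by blast+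
    show "\<kappa> t = g t" if "0 < t" "t \<notin> N" for t
    proof -
      have "t \<in> U (nat \<lceil>max 0 t\<rceil>)" using ceil_less[of t] that by (auto simp: U_def simp del: of_nat_Suc)
      then show ?thesis using f(2) that unfolding \<kappa>_def by simp
    qed
    show "\<exists>L. L-lipschitz_on {..T} \<kappa>" for T
    proof
      define n where "n = nat \<lceil>max 0 T\<rceil>"
      show "(C n)-lipschitz_on {..T} \<kappa>"
      proof (rule lipschitz_onI)
        show "0 \<le> C n" by (rule lipschitz_on_nonneg[OF f(1)])
        fix x y assume "x \<in> {..T}" "y \<in> {..T}"
        then have xy: "x \<le> T" "y \<le> T" by auto
        have cl: "max 0 x \<in> closure (U n)" "max 0 y \<in> closure (U n)"
          unfolding n_def
          by (intro dense max.cobounded1 order_trans[OF max.mono[OF order_refl xy(1)] ceil]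
              order_trans[OF max.mono[OF order_refl xy(2)] ceil])+
        have "dist (\<kappa> x) (\<kappa> y) \<le> C n * dist (max 0 x) (max 0 y)"
          unfolding \<kappa>_eq[OF xy(1)] \<kappa>_eq[OF xy(2)] n_def[symmetric] by (rule lipschitz_onD[OF f(1) cl])
        also have "\<dots> \<le> C n * dist x y"
          by (intro mult_left_mono lipschitz_on_nonneg[OF f(1)]) (auto simp: dist_real_def)
        finally show "dist (\<kappa> x) (\<kappa> y) \<le> C n * dist x y" .
      qed
    qed
  qed
qed

section \<open>The evolution family\<close>

lemma AE_lebesgue_on_negligibleI:
  assumes "S \<in> sets lebesgue" "negligible N" "\<And>t. t \<in> S \<Longrightarrow> t \<notin> N \<Longrightarrow> P t"
  shows "AE t in lebesgue_on S. P t"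
proof -
  have "AE t in lebesgue. t \<in> S \<longrightarrow> P t"
    unfolding eventually_ae_filter_negligible using assms(2,3) by blast
  then show ?thesis using assms(1) by (simp add: AE_restrict_space_iff)
qed

lemma AE_lebesgue_on_negligibleE:
  assumes "S \<in> sets lebesgue" "AE t in lebesgue_on S. P t"
  obtains N where "negligible N" "\<And>t. t \<in> S \<Longrightarrow> t \<notin> N \<Longrightarrow> P t"
proof -
  have "AE t in lebesgue. t \<in> S \<longrightarrow> P t" using assms by (simp add: AE_restrict_space_iff)
  then show ?thesis unfolding eventually_ae_filter_negligible using that by blast
qed

lemma graph_norm_continuous_imp_continuous:
  assumes "\<And>t. t \<in> S \<Longrightarrow> ((\<lambda>r. graph_norm \<nu> (u r - u t)) \<longlongrightarrow> 0) (at t within S)"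
  shows "continuous_on S u"
  unfolding continuous_on_def
proof
  fix t assume "t \<in> S"
  show "(u \<longlongrightarrow> u t) (at t within S)"
  proof (rule LIM_zero_cancel, rule Lim_null_comparison)
    show "\<forall>\<^sub>F r in at t within S. norm (u r - u t) \<le> graph_norm \<nu> (u r - u t)"
      by (simp add: graph_norm_def)
  qed (rule assms[OF \<open>t \<in> S\<close>])
qed

text \<open>A competing evolution family is known to provide strong solutions, not mild ones, so
  \<open>mild_unique\<close> cannot be applied to it; the monotonicity \<open>diss\<close> takes its
  place.\<close>

lemma strong_solution_unique:
  assumes u: "strong_solution \<nu> A s u\<^sub>0 u" and v: "strong_solution \<nu> A s u\<^sub>0 v"
    and diss: "\<And>t x y. s \<le> t \<Longrightarrow> x \<in> stokes_domain \<Longrightarrow> y \<in> stokes_domain \<Longrightarrow> (A t x - A t y) \<bullet> (x - y) \<le> 0"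
    and t: "s \<le> t"
  shows "u t = v t"
proof -
  define z where "z r = u r - v r" for r
  define y where "y r = (norm (z r))\<^sup>2" for r
  have "continuous_on {s..} w" if "strong_solution \<nu> A s u\<^sub>0 w" for w
    by (rule graph_norm_continuous_imp_continuous[where \<nu> = \<nu>]) (use that in \<open>simp add: strong_solution_def\<close>)
  then have "continuous_on {s..} u" "continuous_on {s..} v" using u v by blast+
  then have "continuous_on {s..t} u" "continuous_on {s..t} v"
    by (auto elim: continuous_on_subset)
  then have cont: "continuous_on {s..t} (\<lambda>r. norm (u r - v r))" by (intro continuous_intros)
  have "{s..t} \<noteq> {}" using t by simp
  from continuous_attains_sup[OF compact_Icc this cont]
  obtain R where R: "\<And>r. r \<in> {s..t} \<Longrightarrow> norm (u r - v r) \<le> R" by blast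
  have ac: "absolutely_continuous_on_interval s t y"
    unfolding y_def z_def
    using u v t R unfolding strong_solution_def by (intro absolutely_continuous_norm_square_diff) auto
  have meas: "{s..} \<in> sets lebesgue" by simp
  have ode: "AE r in lebesgue_on {s..}. (u has_vector_derivative A r (u r)) (at r within {s..})"
    "AE r in lebesgue_on {s..}. (v has_vector_derivative A r (v r)) (at r within {s..})"
    using u v unfolding strong_solution_def by blast+
  from AE_lebesgue_on_negligibleE[OF meas ode(1)] obtain N1 where N1: "negligible N1"
    "\<And>r. r \<in> {s..} \<Longrightarrow> r \<notin> N1 \<Longrightarrow> (u has_vector_derivative A r (u r)) (at r within {s..})" by blast
  from AE_lebesgue_on_negligibleE[OF meas ode(2)] obtain N2 where N2: "negligible N2"
    "\<And>r. r \<in> {s..} \<Longrightarrow> r \<notin> N2 \<Longrightarrow> (v has_vector_derivative A r (v r)) (at r within {s..})" by blast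
  have "y t \<le> y s"
  proof (rule absolutely_continuous_nonincreasing[OF t ac negligible_Un[OF N1(1) N2(1)]])
    fix r assume r: "r \<in> {s..t}" "r \<notin> N1 \<union> N2"
    define D where "D = A r (u r) - A r (v r)"
    have "(z has_vector_derivative D) (at r within {s..})"
      unfolding z_def D_def using r by (intro has_vector_derivative_diff N1(2) N2(2)) auto
    then have "(z has_vector_derivative D) (at r within {s..t})"
      by (rule has_vector_derivative_within_subset) auto
    then have "((\<lambda>r. z r \<bullet> z r) has_derivative (\<lambda>h. z r \<bullet> (h *\<^sub>R D) + (h *\<^sub>R D) \<bullet> z r)) (at r within {s..t})"
      unfolding has_vector_derivative_def by (intro has_derivative_inner)
    then have "(y has_real_derivative 2 * (D \<bullet> z r)) (at r within {s..t})"
      unfolding has_field_derivative_def y_def power2_norm_eq_inner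
      by (rule has_derivative_eq_rhs) (auto simp: inner_commute)
    moreover have "D \<bullet> z r \<le> 0"
      unfolding D_def z_def using u v r unfolding strong_solution_def by (intro diss) auto
    ultimately show "\<exists>D\<le>0. (y has_real_derivative D) (at r within {s..t})"
      by (intro exI[of _ "2 * (D \<bullet> z r)"]) simp
  qed
  also have "y s = 0" using u v by (simp add: y_def z_def strong_solution_def)
  finally show ?thesis by (simp add: y_def z_def)
qed

theorem proposition3p4:
  fixes \<nu> :: real
    and chi :: "real^3 \<Rightarrow> real"
    and \<P> :: "'p measure"
    and K :: "'p \<Rightarrow> real"
    and \<rho> :: "real \<Rightarrow> 'p"
    and Kmax :: real
  assumes "\<nu> > 0"
    and "ess_bounded torus chi"
    and "AE x in torus. 0 \<le> chi x"
    and "\<forall>p\<in>space \<P>. 0 \<le> K p"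
    and "bounded (K ` space \<P>)"
    and "\<rho> \<in> measurable (lebesgue_on {0..}) \<P>"
    and "\<forall>T>0. sobolev_W1_infty T (\<lambda>t. K (\<rho> t))"
    and "\<forall>T>0. AE t in lebesgue_on {0<..<T}. 0 \<le> K (\<rho> t) \<and> K (\<rho> t) \<le> Kmax"
  shows "\<exists>U. evolution_family \<nu> (\<lambda>t. system_operator \<nu> chi K (\<rho> t)) U
    \<and> (\<forall>V. evolution_family \<nu> (\<lambda>t. system_operator \<nu> chi K (\<rho> t)) V \<longrightarrow>
          (\<forall>t s. 0 \<le> s \<and> s \<le> t \<longrightarrow> V t s = U t s))
    \<and> (\<forall>t s. 0 \<le> s \<and> s \<le> t \<longrightarrow> norm (U t s) \<le> 1)
    \<and> (\<forall>\<alpha>>0. (\<forall>p\<in>space \<P>. \<forall>v\<in>stokes_domain. - (system_operator \<nu> chi K p v \<bullet> v) \<ge> \<alpha> * (norm v)\<^sup>2) \<longrightarrow>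
          (\<forall>t s. 0 \<le> s \<and> s \<le> t \<longrightarrow> norm (U t s) \<le> exp (- \<alpha> * (t - s))))"
proof -
  note nu = \<open>\<nu> > 0\<close> and chi = \<open>ess_bounded torus chi\<close>
  obtain \<kappa> N where \<kappa>: "\<And>t. 0 \<le> \<kappa> t" "\<And>t. \<kappa> t \<le> Kmax" "\<And>T. \<exists>L. L-lipschitz_on {..T} \<kappa>"
    and N: "negligible N" and \<kappa>_eq: "\<And>t. 0 < t \<Longrightarrow> t \<notin> N \<Longrightarrow> \<kappa> t = K (\<rho> t)"
    by (rule lipschitz_representative[of "\<lambda>t. K (\<rho> t)" Kmax]) (use assms in auto)
  define A where "A t = system_operator \<nu> chi K (\<rho> t)" for t
  define B where "B = damping chi 1"
  interpret perturbed fourier_coeff "eigenvalue \<nu>" B \<kappa> Kmax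
  proof (intro perturbed.intro perturbed_axioms.intro)
    show "spectral fourier_coeff (eigenvalue \<nu>)" by (rule spectral_coeff[OF nu])
    show "bounded_linear B" unfolding B_def by (rule bounded_linear_damping[OF chi])
    show "0 \<le> B v \<bullet> v" for v unfolding B_def by (rule damping_nonneg[OF chi assms(3)])
  qed (rule \<kappa>)+
  \<comment> \<open>The system is written with the given coefficient, the perturbed semigroup with
    its representative \<open>\<kappa>\<close>; at positive times the two differ at most on
    \<open>N\<close>.\<close>
  have A_eq: "A t v = stokes \<nu> v - K (\<rho> t) *\<^sub>R B v" for t v
    unfolding A_def system_operator_def B_def by (simp only: damping_scale[OF chi, of "K (\<rho> t)" v])
  have \<rho>_space: "\<rho> t \<in> space \<P>" if "0 \<le> t" for t
    using measurable_space[OF assms(6)] that by (simp add: space_restrict_space)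
  have domain_iff: "v \<in> stokes_domain \<longleftrightarrow> gen v (stokes \<nu> v)" for v
    using stokes_gen[OF nu] gen_stokes(1)[OF nu] by blast
  have stokes_eq: "gen v w \<Longrightarrow> stokes \<nu> v = w" for v w by (rule gen_stokes(2)[OF nu])
  have A_diss: "(A t x - A t y) \<bullet> (x - y) \<le> 0" if "0 \<le> t" "x \<in> stokes_domain" "y \<in> stokes_domain" for t x y
  proof -
    have "gen (x - y) (stokes \<nu> x - stokes \<nu> y)" using that domain_iff by (intro gen_diff) auto
    then have "(stokes \<nu> x - stokes \<nu> y) \<bullet> (x - y) \<le> 0" by (rule gen_nonpos)
    moreover have "A t x - A t y = (stokes \<nu> x - stokes \<nu> y) - K (\<rho> t) *\<^sub>R B (x - y)"
      by (simp add: A_eq B_simps algebra_simps)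
    moreover have "0 \<le> K (\<rho> t) * (B (x - y) \<bullet> (x - y))"
      using assms(4) \<rho>_space[OF that(1)] B_nonneg by (intro mult_nonneg_nonneg) auto
    ultimately show ?thesis by (simp add: inner_diff_left)
  qed
  have strong: "strong_solution \<nu> A s x (sol s x)" if s: "0 \<le> s" and x: "x \<in> stokes_domain" for s x
  proof -
    have gx: "gen x (stokes \<nu> x)" using x domain_iff by blast
    obtain z where z: "continuous_on {s..} z" "\<And>t. s \<le> t \<Longrightarrow> gen (sol s x t) (z t)"
      using sol_gen[OF gx] by blast
    have graph: "((\<lambda>r. graph_norm \<nu> (sol s x r - sol s x t)) \<longlongrightarrow> 0) (at t within {s..})" if t: "s \<le> t" for t
    proof (rule Lim_transform_eventually)
      have "(sol s x \<longlongrightarrow> sol s x t) (at t within {s..})"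
        using mild_cont[OF mild_sol, of s x] continuous_on_subset[of UNIV "sol s x" "{s..}"] t
        by (auto simp: continuous_on_def)
      moreover have "(z \<longlongrightarrow> z t) (at t within {s..})" using z(1) t by (simp add: continuous_on_def)
      ultimately show "((\<lambda>r. norm (sol s x r - sol s x t) + norm (z r - z t)) \<longlongrightarrow> 0) (at t within {s..})"
        by (auto intro!: tendsto_eq_intros)
      have "stokes \<nu> (sol s x r - sol s x t) = z r - z t" if "s \<le> r" for r
        by (intro stokes_eq gen_diff z(2) t that)
      then show "\<forall>\<^sub>F r in at t within {s..}. norm (sol s x r - sol s x t) + norm (z r - z t) = graph_norm \<nu> (sol s x r - sol s x t)"
        by (auto simp: graph_norm_def eventually_at_filter)
    qed
    have "absolutely_continuous_on_interval s b (sol s x)" if "s \<le> b" for b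
      using sol_lipschitz[OF gx that] lipschitz_imp_absolutely_continuous by metis
    moreover have "AE t in lebesgue_on {s..}. (sol s x has_vector_derivative A t (sol s x t)) (at t within {s..})"
    \<comment> \<open>\<open>\<kappa>\<close> is matched with the given coefficient at positive
      times only, so the time 0 joins the null set.\<close>
    proof (rule AE_lebesgue_on_negligibleI[of _ "insert 0 N"])
      fix t assume t: "t \<in> {s..}" "t \<notin> insert 0 N"
      then have "\<kappa> t = K (\<rho> t)" using s by (intro \<kappa>_eq) auto
      moreover have "stokes \<nu> (sol s x t) = z t" using t by (intro stokes_eq z(2)) auto
      ultimately show "(sol s x has_vector_derivative A t (sol s x t)) (at t within {s..})"
        using sol_derivative[OF z, of t] t by (simp add: A_eq)
    qed (use N in auto)
    ultimately show ?thesis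
      unfolding strong_solution_def using graph gen_stokes(1)[OF nu z(2)] sol_init[of s s x] by blast
  qed
  \<comment> \<open>For \<open>t < s\<close> the map is the identity, so \<open>Blinfun\<close> is
    applied to a bounded linear map for every pair of times.\<close>
  have bl: "bounded_linear (\<lambda>x. sol s x t)" for t s
  proof (cases "s \<le> t")
    case True
    then show ?thesis by (rule bounded_linear_sol)
  next
    case False
    then have "(\<lambda>x. sol s x t) = (\<lambda>x. x)" by (simp add: sol_init)
    then show ?thesis by (simp add: bounded_linear_ident)
  qed
  define U where "U t s = Blinfun (\<lambda>x. sol s x t)" for t s
  have U: "blinfun_apply (U t s) x = sol s x t" for t s x
    unfolding U_def by (simp add: bounded_linear_Blinfun_apply[OF bl])
  have "evolution_family \<nu> A U"
    unfolding evolution_family_def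
  proof (intro conjI allI impI ballI)
    show "U s s = id_blinfun" for s by (rule blinfun_eqI) (simp add: U sol_init)
    show "U t r o\<^sub>L U r s = U t s" if "0 \<le> s \<and> s \<le> r \<and> r \<le> t" for t r s
      using that by (intro blinfun_eqI) (simp add: U sol_sol)
    show "continuous_on {(t, s). 0 \<le> s \<and> s \<le> t} (\<lambda>(t, s). blinfun_apply (U t s) x)" for x
      unfolding U by (rule continuous_on_subset[OF sol_jointly_continuous]) auto
    show "strong_solution \<nu> A s u\<^sub>0 (\<lambda>t. blinfun_apply (U t s) u\<^sub>0)" if "0 \<le> s" "u\<^sub>0 \<in> stokes_domain" for s u\<^sub>0
      unfolding U by (rule strong[OF that])
  qed
  moreover have "V t s = U t s" if V: "evolution_family \<nu> A V" and ts: "0 \<le> s" "s \<le> t" for V t s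
  proof (rule blinfun_eqI)
    fix x
    have dom: "blinfun_apply (V t s) w = blinfun_apply (U t s) w" if w: "w \<in> stokes_domain" for w
    proof -
      have "strong_solution \<nu> A s w (\<lambda>t. blinfun_apply (V t s) w)"
        using V ts w unfolding evolution_family_def by blast
      from strong_solution_unique[OF this strong[OF ts(1) w] A_diss ts(2)] show ?thesis
        using ts by (simp add: U)
    qed
    \<comment> \<open>Both operators are bounded, so agreement on the dense domain suffices; in the
      estimate below the added 1 keeps the denominator positive.\<close>
    define W where "W = V t s - U t s"
    have "norm (blinfun_apply W x) \<le> 0"
    proof (rule field_le_epsilon)
      fix e :: real assume "e > 0"
      then have "e / (norm W + 1) > 0" by (simp add: add_nonneg_pos)
      then obtain w y where wy: "gen w y" "norm (x - w) < e / (norm W + 1)" using gen_dense by blast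
      have "blinfun_apply W w = 0" using dom gen_stokes(1)[OF nu wy(1)] by (simp add: W_def blinfun.diff_left)
      then have "blinfun_apply W x = blinfun_apply W (x - w)" by (simp add: blinfun.diff_right)
      also have "norm \<dots> \<le> norm W * norm (x - w)" by (rule norm_blinfun)
      also have "\<dots> \<le> (norm W + 1) * (e / (norm W + 1))"
        using wy(2) by (intro mult_mono) auto
      also have "\<dots> = e"
        using norm_ge_zero[of W] by (simp del: norm_ge_zero)
      finally show "norm (blinfun_apply W x) \<le> 0 + e" by simp
    qed
    then show "blinfun_apply (V t s) x = blinfun_apply (U t s) x" by (simp add: W_def blinfun.diff_left)
  qed
  moreover have "norm (U t s) \<le> 1" if "s \<le> t" for t s
    by (rule norm_blinfun_bound) (auto simp: U norm_sol_le_1[OF that])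
  moreover have "norm (U t s) \<le> exp (- \<alpha> * (t - s))"
    if coercive: "\<forall>p\<in>space \<P>. \<forall>v\<in>stokes_domain. - (system_operator \<nu> chi K p v \<bullet> v) \<ge> \<alpha> * (norm v)\<^sup>2"
      and ts: "0 \<le> s" "s \<le> t" for \<alpha> t s
  proof (rule norm_blinfun_bound)
    fix x
    have "(w - \<kappa> r *\<^sub>R B v) \<bullet> v \<le> - \<alpha> * (norm v)\<^sup>2" if r: "s \<le> r" and gvw: "gen v w" for r v w
    \<comment> \<open>Coercivity speaks of the given coefficient, which at the time \<open>r\<close>
      may differ from \<open>\<kappa> r\<close>. By continuity of \<open>\<kappa>\<close> a
      violation at \<open>r\<close> would persist at a nearby time outside \<open>N\<close>, where
      the two coincide.\<close>
    proof (rule ccontr)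
      define f where "f q = (w - \<kappa> q *\<^sub>R B v) \<bullet> v" for q
      assume "\<not> (w - \<kappa> r *\<^sub>R B v) \<bullet> v \<le> - \<alpha> * (norm v)\<^sup>2"
      then have "- \<alpha> * (norm v)\<^sup>2 < f r" by (simp add: f_def)
      moreover have "isCont f r"
      proof -
        have "continuous_on UNIV f" unfolding f_def by (intro continuous_intros continuous_kappa)
        then show ?thesis by (simp add: continuous_on_eq_continuous_at)
      qed
      ultimately have "\<forall>\<^sub>F q in nhds r. - \<alpha> * (norm v)\<^sup>2 < f q"
        by (intro order_tendstoD(1)) (simp_all add: isCont_def tendsto_nhds_iff)
      then obtain d where d: "d > 0" "\<And>q. dist q r < d \<Longrightarrow> - \<alpha> * (norm v)\<^sup>2 < f q"
        unfolding eventually_nhds_metric by blast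
      have "\<not> negligible {r<..<r + d}" using d(1) by (intro open_not_negligible) auto
      then obtain q where q: "q \<in> {r<..<r + d}" "q \<notin> N" using N negligible_subset by blast
      have "\<kappa> q = K (\<rho> q)" using q r ts by (intro \<kappa>_eq) auto
      then have "f q = A q v \<bullet> v" by (simp add: f_def A_eq stokes_eq[OF gvw])
      also have "\<dots> \<le> - \<alpha> * (norm v)\<^sup>2"
        using coercive[rule_format, OF \<rho>_space[of q] gen_stokes(1)[OF nu gvw]] q r ts by (simp add: A_def)
      finally show False using d(2)[of q] q by (simp add: dist_real_def)
    qed
    from norm_sol_le[OF this ts(2)] show "norm (blinfun_apply (U t s) x) \<le> exp (- \<alpha> * (t - s)) * norm x"
      by (simp add: U)
  qed simp
  ultimately show ?thesis unfolding A_def by blast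
qed

end
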